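(* Let $c\ge 7$ be an integer and let $a,b$ be integers with $0\le a<b\le\left\lfloor \frac{c}{2}\right\rfloor$. Then there exists a number $n_{a,b,c}$, depending only on $a,b,c$, such that for every integer $n>n_{a,b,c}$, $$\overline{N}(a,c,n)>\overline{N}(b,c,n).$$
   Context: An overpartition of a positive integer $n$ is a partition of $n$ (a non-increasing sequence of positive integers with sum $n$) in which the first occurrence of each distinct part may or may not be overlined; thus a partition with $d$ distinct part sizes gives rise to $2^d$ overpartitions. The rank of an overpartition is its largest part minus its number of parts (overlines are ignored). $\overline{N}(a,c,n)$ denotes the number of overpartitions of $n$ whose rank is congruent to $a$ modulo $c$. *)

theory Defs
  imports Complex_Main "HOL-Number_Theory.Cong"
begin

text \<open>
  An overpartition is the non-increasing sequence of its parts, each part paired with a flag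
  telling whether it is overlined.
\<close>

definition overpartition :: "nat \<Rightarrow> (nat \<times> bool) list \<Rightarrow> bool" where
  "overpartition n ps \<longleftrightarrow>
     sorted_wrt (\<ge>) (map fst ps) \<and>
     (\<forall>p \<in> set ps. fst p > 0) \<and>
     sum_list (map fst ps) = n \<and>
     (\<forall>i < length ps. snd (ps ! i) \<longrightarrow> (\<forall>j < i. fst (ps ! j) \<noteq> fst (ps ! i)))"

text \<open>Unspecified on the empty list, which is an overpartition of 0 only.\<close>

definition overpartition_rank :: "(nat \<times> bool) list \<Rightarrow> int" where
  "overpartition_rank ps = int (Max (fst ` set ps)) - int (length ps)"

definition Nbar :: "int \<Rightarrow> int \<Rightarrow> nat \<Rightarrow> nat" where
  "Nbar a c n = card {ps. overpartition n ps \<and> [overpartition_rank ps = a] (mod c)}"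

text \<open>The cardinality in the definition of \<^const>\<open>Nbar\<close> is that of a finite set.\<close>

lemma finite_overpartitions: "finite {ps. overpartition n ps}"
proof (rule finite_subset)
  show "{ps. overpartition n ps} \<subseteq>
          {ps. set ps \<subseteq> {..n} \<times> (UNIV :: bool set) \<and> length ps \<le> n}"
  proof safe
    fix ps assume ps: "overpartition n ps"
    have "length ps = sum_list (map (\<lambda>_. 1) ps)"
      by (induction ps) auto
    also have "\<dots> \<le> sum_list (map fst ps)"
      by (rule sum_list_mono) (use ps in \<open>force simp: overpartition_def Suc_le_eq\<close>)
    finally show "length ps \<le> n"
      using ps by (simp add: overpartition_def)
    fix p u assume "(p, u) \<in> set ps"
    hence "p \<in> set (map fst ps)" by force
    thus "p \<le> n"
      using ps member_le_sum_list[of p "map fst ps"] by (simp add: overpartition_def)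
  qed simp
  show "finite {ps. set ps \<subseteq> {..n} \<times> (UNIV :: bool set) \<and> length ps \<le> n}"
    by (rule finite_lists_length_le) auto
qed

end

theory Submission
  imports Defs "HOL-Complex_Analysis.Complex_Analysis" "HOL-Real_Asymp.Real_Asymp"
begin

text \<open>
  Let $P(q)$ be the generating function of all overpartitions. An overpartition form of Dyson's
  adjoint map shows that the generating function for the rank $m \ge 0$ is
  $2 P(q) \sum_{k \ge 1} (-1)^{k+1} q^{k^2 + mk} (1 - q^k) / (1 + q^k)$, and the rank is symmetric
  under conjugation. Summing over the residue classes, the differences
  $\overline{N}(a,c,n) - \overline{N}(b,c,n)$ have the generating function $2 P(q) S(q)$ where,
  with $q = e^{-z}$, $S = \sum_{k \ge 1} (-1)^{k+1} e^{-k^2 z} g(kz)$ for an even function $g$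
  that is meromorphic with poles nearest to $0$ at $\pm 2 \pi i / c$.

  Near $q = 1$ the residue theorem, applied to $e^{-w^2 z} g(wz) / \sin(\pi w)$, gives $S$ up to a
  smaller error as the contribution of these two poles, while $P(e^{-z}) e^{-\pi^2/(4z)}$ varies
  slowly with the argument of $z$. Hence $2 P S$ is close to a positive number, depending on
  $\Re z$ only, times $z^{-1} e^{A/z}$ with $A = \pi^2 (1/2 - 2/c)^2$, and the saddle point of
  $e^{A/z + nz}$ at $z = \sqrt{A/n}$ contributes a positive amount. Away from $q = 1$, $\log |P|$ is
  at most $2/(5 \Re z)$ up to a constant, which is smaller than $A / \Re z$ for $c \ge 7$.
\<close>

section \<open>Generating functions of overpartitions\<close>

text \<open>Neither conjugation nor Dyson's map is built as a bijection: the combinatorics is read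
  off two recurrences for the polynomial \<open>box_gf q L l\<close> of overpartitions with parts at
  most \<open>L\<close> and at most \<open>l\<close> parts, and the second recurrence follows from
  the first by induction. The analysis is a comparison of exponents of 1/z. P supplies pi^2/4; at w
  = i x/z the Gaussian adds x^2 and 1 / sin (pi w) subtracts pi x. So every total is a square: (pi/2
  - 2 pi/c)^2 at the first poles, and (pi/2 - 3 pi/c)^2 on a contour half way to the second poles at
  4 pi i/c. The hypothesis c >= 7 puts these second poles below the pole pi i of the tanh factor and
  keeps 3 pi/c below pi/2, so that the second square is the smaller one. It also makes the first at
  least 9 pi^2/196, about 0.453, whereas the worst minor arc gives pi^2/4 - 2 - 2/25, about 0.387;
  the constant 2/5 separates the two. For c = 6 the first square would be only pi^2/36.\<close>

definition weight :: "(nat \<times> bool) list \<Rightarrow> nat" where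
  "weight ps = sum_list (map fst ps)"

definition first_part :: "(nat \<times> bool) list \<Rightarrow> nat" where
  "first_part ps = (if ps = [] then 0 else fst (hd ps))"

definition overpartitions :: "(nat \<times> bool) list set" where
  "overpartitions = {ps. overpartition (weight ps) ps}"

definition ovp_box :: "nat \<Rightarrow> nat \<Rightarrow> (nat \<times> bool) list set" where
  "ovp_box L l = {ps \<in> overpartitions. first_part ps \<le> L \<and> length ps \<le> l}"

definition box_gf :: "'a::comm_ring_1 \<Rightarrow> nat \<Rightarrow> nat \<Rightarrow> 'a" where
  "box_gf q L l = (\<Sum>ps\<in>ovp_box L l. q ^ weight ps)"

lemma weight_simps [simp]: "weight [] = 0" "weight (p # ps) = fst p + weight ps"
  by (simp_all add: weight_def)

lemma first_part_simps [simp]: "first_part [] = 0" "first_part (p # ps) = fst p"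
  by (simp_all add: first_part_def)

lemma overpartitions_Nil [simp]: "[] \<in> overpartitions"
  by (simp add: overpartitions_def overpartition_def)

lemma overpartitions_le_first_part: "ps \<in> overpartitions \<Longrightarrow> x \<in> set ps \<Longrightarrow> fst x \<le> first_part ps"
  by (cases ps) (auto simp: overpartitions_def overpartition_def)

text \<open>In a sorted list only a first part of the tail can equal a new first part, so the
  marking rule, which looks at all earlier positions, becomes one local test. For an empty tail the
  test is void, because \<open>first_part [] = 0 < p\<close>.\<close>

lemma overpartitions_Cons:
  "(p, f) # ps \<in> overpartitions \<longleftrightarrow>
     0 < p \<and> ps \<in> overpartitions \<and> first_part ps \<le> p \<and> (first_part ps = p \<longrightarrow> \<not> snd (hd ps))"
  (is "?lhs \<longleftrightarrow> ?rhs")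
proof
  assume L: ?lhs
  then have pos: "0 < p" and ge: "\<And>x. x \<in> set ps \<Longrightarrow> fst x \<le> p"
    and mark: "\<And>i j. i < Suc (length ps) \<Longrightarrow> snd (((p, f) # ps) ! i) \<Longrightarrow> j < i \<Longrightarrow>
        fst (((p, f) # ps) ! j) \<noteq> fst (((p, f) # ps) ! i)"
    by (auto simp: overpartitions_def overpartition_def)
  have "ps \<in> overpartitions"
    using L mark[of "Suc _" "Suc _"] by (auto simp: overpartitions_def overpartition_def weight_def)
  moreover have "first_part ps \<le> p"
    using ge by (cases ps) auto
  moreover have "\<not> snd (hd ps)" if "first_part ps = p"
    using that pos mark[of 1 0] by (cases ps) auto
  ultimately show ?rhs using pos by blast
next
  assume R: ?rhs
  then have srt: "sorted_wrt (\<ge>) (map fst ps)" and pos: "\<forall>x\<in>set ps. 0 < fst x"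
    and mark: "\<And>i j. i < length ps \<Longrightarrow> snd (ps ! i) \<Longrightarrow> j < i \<Longrightarrow> fst (ps ! j) \<noteq> fst (ps ! i)"
    by (auto simp: overpartitions_def overpartition_def)
  have le: "fst x \<le> p" if "x \<in> set ps" for x
    using overpartitions_le_first_part[OF _ that] R by fastforce
  have new: "p \<noteq> fst (ps ! i)" if i: "i < length ps" "snd (ps ! i)" for i
  proof
    assume eq: "p = fst (ps ! i)"
    have "fst (ps ! i) \<le> first_part ps"
      using overpartitions_le_first_part R i by (metis nth_mem)
    with R eq have fp: "first_part ps = p" by linarith
    have "ps \<noteq> []" using i by auto
    then have h: "ps ! 0 = hd ps" "first_part ps = fst (hd ps)"
      by (auto simp: hd_conv_nth first_part_def)
    show False
      using mark[of i 0] i fp h eq R by (cases "i = 0") auto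
  qed
  have "fst (((p, f) # ps) ! j) \<noteq> fst (((p, f) # ps) ! i)"
    if "i < Suc (length ps)" "snd (((p, f) # ps) ! i)" "j < i" for i j
    using that new mark by (cases i; cases j) auto
  then show ?lhs
    using R srt pos le by (auto simp: overpartitions_def overpartition_def weight_def)
qed

lemma overpartitions_first_part_0: "ps \<in> overpartitions \<Longrightarrow> first_part ps = 0 \<Longrightarrow> ps = []"
  by (cases ps) (auto simp: overpartitions_Cons)

lemma overpartitions_length_le_weight: "ps \<in> overpartitions \<Longrightarrow> length ps \<le> weight ps"
  by (induction ps) (auto simp: overpartitions_Cons)

lemma overpartitions_first_part_le_weight: "ps \<in> overpartitions \<Longrightarrow> first_part ps \<le> weight ps"
  by (cases ps) auto

lemma overpartitions_rank:
  assumes "ps \<in> overpartitions" "ps \<noteq> []"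
  shows "overpartition_rank ps = int (first_part ps) - int (length ps)"
proof -
  have "Max (fst ` set ps) = first_part ps"
    using assms overpartitions_le_first_part[OF assms(1)]
    by (intro Max_eqI) (auto simp: first_part_def)
  then show ?thesis by (simp add: overpartition_rank_def)
qed

lemma finite_ovp_box [simp]: "finite (ovp_box L l)"
proof (rule finite_subset)
  show "ovp_box L l \<subseteq> {ps. set ps \<subseteq> {..L} \<times> UNIV \<and> length ps \<le> l}"
    by (force simp: ovp_box_def dest: overpartitions_le_first_part)
  show "finite {ps. set ps \<subseteq> {..L} \<times> (UNIV :: bool set) \<and> length ps \<le> l}"
    by (rule finite_lists_length_le) auto
qed

lemma ovp_box_0 [simp]: "ovp_box 0 l = {[]}" "ovp_box L 0 = {[]}"
  by (auto simp: ovp_box_def overpartitions_first_part_0)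

lemma box_gf_0 [simp]: "box_gf q 0 l = 1" "box_gf q L 0 = 1"
  by (simp_all add: box_gf_def)

text \<open>Removing the first part. An overpartition whose first part is $L$ and overlined cannot
  follow another $L$; toggling the overline pairs it with one that can.\<close>

lemma box_gf_Suc:
  "box_gf q (Suc L) (Suc l) =
     box_gf q L (Suc l) + q ^ Suc L * (box_gf q (Suc L) l + box_gf q L l)"
proof -
  define B where "B f = {ps \<in> ovp_box (Suc L) l. first_part ps = Suc L \<and> snd (hd ps) = f}" for f
  have fin: "finite (B f)" for f by (simp add: B_def)
  define s where "s f = (\<Sum>ps\<in>B f. q ^ weight ps)" for f
  have split: "ovp_box (Suc L) l = ovp_box L l \<union> (B False \<union> B True)"
    by (auto simp: ovp_box_def B_def)
  have "box_gf q (Suc L) l = box_gf q L l + (s False + s True)"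
    unfolding box_gf_def split s_def
    by (subst sum.union_disjoint, simp, simp add: fin, force simp: ovp_box_def B_def,
        subst sum.union_disjoint) (auto simp: fin B_def)
  moreover have "s True = s False"
  proof -
    have flip: "(Suc L, g) # tl ps \<in> B g" "Suc L + weight (tl ps) = weight ps"
        "(Suc L, f) # tl ps = ps" if "ps \<in> B f" for ps f g
      using that by (cases ps; auto simp: B_def ovp_box_def overpartitions_Cons)+
    show ?thesis
      unfolding s_def
      by (rule sum.reindex_bij_witness[of _ "\<lambda>ps. (Suc L, True) # tl ps"
            "\<lambda>ps. (Suc L, False) # tl ps"]) (simp_all add: flip(1,3) flip(2)[symmetric])
  qed
  moreover have "box_gf q (Suc L) (Suc l) =
      box_gf q L (Suc l) + q ^ Suc L * (2 * (box_gf q L l + s False))"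
  proof -
    define C where "C = (UNIV :: bool set) \<times> (ovp_box L l \<union> B False)"
    have inj: "inj_on (\<lambda>(f, ps). (Suc L, f) # ps) C"
      by (auto simp: inj_on_def)
    have split': "ovp_box (Suc L) (Suc l) = ovp_box L (Suc l) \<union> (\<lambda>(f, ps). (Suc L, f) # ps) ` C"
      (is "?l = ?r")
    proof (rule set_eqI)
      fix ps show "ps \<in> ?l \<longleftrightarrow> ps \<in> ?r"
        by (cases ps) (auto simp: ovp_box_def C_def B_def overpartitions_Cons image_iff le_Suc_eq first_part_def)
    qed
    have disj: "ovp_box L (Suc l) \<inter> (\<lambda>(f, ps). (Suc L, f) # ps) ` C = {}"
      by (auto simp: ovp_box_def)
    have "finite C" by (simp add: C_def fin)
    then have "box_gf q (Suc L) (Suc l) =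
        box_gf q L (Suc l) + (\<Sum>ps\<in>(\<lambda>(f, ps). (Suc L, f) # ps) ` C. q ^ weight ps)"
      unfolding box_gf_def split' by (intro sum.union_disjoint disj) auto
    also have "(\<Sum>ps\<in>(\<lambda>(f, ps). (Suc L, f) # ps) ` C. q ^ weight ps) =
        (\<Sum>(f, ps)\<in>C. q ^ (Suc L + weight ps))"
      by (subst sum.reindex[OF inj]) (simp add: case_prod_unfold)
    also have "(\<Sum>(f, ps)\<in>C. q ^ (Suc L + weight ps)) =
        (\<Sum>f\<in>(UNIV::bool set). \<Sum>ps\<in>ovp_box L l \<union> B False. q ^ Suc L * q ^ weight ps)"
      unfolding C_def by (subst sum.cartesian_product[symmetric]) (simp add: power_add mult.assoc)
    also have "\<dots> = 2 * (\<Sum>ps\<in>ovp_box L l \<union> B False. q ^ Suc L * q ^ weight ps)"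
      by (simp add: UNIV_bool del: power_Suc)
    also have "(\<Sum>ps\<in>ovp_box L l \<union> B False. q ^ Suc L * q ^ weight ps) =
        q ^ Suc L * (box_gf q L l + s False)"
    proof -
      have "(\<Sum>ps\<in>ovp_box L l \<union> B False. q ^ weight ps) = box_gf q L l + s False"
        unfolding box_gf_def s_def by (intro sum.union_disjoint finite_ovp_box fin) (auto simp: B_def ovp_box_def)
      then show ?thesis by (simp only: sum_distrib_left[symmetric])
    qed
    finally show ?thesis by (simp add: algebra_simps)
  qed
  ultimately show ?thesis by (simp add: algebra_simps)
qed

text \<open>The conjugate of \<open>box_gf_Suc\<close>: combinatorially it removes the first column
  instead of the first row. It is derived from the row recurrence alone, by a double
  induction.\<close>

lemma box_gf_Suc':
  "box_gf q (Suc L) (Suc l) =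
     box_gf q (Suc L) l + q ^ Suc l * (box_gf q L (Suc l) + box_gf q L l)"
proof (induction L arbitrary: l)
  case 0
  show ?case
    by (induction l) (simp_all add: box_gf_Suc[of q 0] algebra_simps)
next
  case (Suc L)
  note outer = Suc.IH
  show ?case
  proof (induction l)
    case 0
    have "box_gf q (Suc (Suc L)) (Suc 0) = box_gf q (Suc L) (Suc 0) + q * (q ^ Suc L * (1 + 1))"
      by (simp add: box_gf_Suc[of q "Suc L" 0])
    also have "box_gf q (Suc L) (Suc 0) = 1 + q * (box_gf q L (Suc 0) + 1)"
      using outer[of 0] by simp
    finally show ?case
      by (simp add: box_gf_Suc[of q L 0] distrib_left add_ac)
  next
    case (Suc l)
    let ?E = "box_gf q" and ?u = "q ^ Suc (Suc L)" and ?v = "q ^ Suc (Suc l)"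
    \<comment> \<open>The row recurrence expresses this difference in the second argument by three
      such differences that the two induction hypotheses evaluate; collecting powers of
      \<open>q\<close> then undoes the row recurrence at \<open>Suc L\<close>.\<close>
    have "?E (Suc (Suc L)) (Suc (Suc l)) - ?E (Suc (Suc L)) (Suc l) =
        (?E (Suc L) (Suc (Suc l)) - ?E (Suc L) (Suc l)) +
        ?u * ((?E (Suc (Suc L)) (Suc l) - ?E (Suc (Suc L)) l) + (?E (Suc L) (Suc l) - ?E (Suc L) l))"
      unfolding box_gf_Suc[of q "Suc L" l] box_gf_Suc[of q "Suc L" "Suc l"]
      by (simp only: algebra_simps)
    also have "\<dots> = ?v * (?E L (Suc (Suc l)) + ?E L (Suc l)) +
        ?u * (q ^ Suc l * (?E (Suc L) (Suc l) + ?E (Suc L) l) + q ^ Suc l * (?E L (Suc l) + ?E L l))"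
      by (subst Suc.IH, subst outer[of "Suc l"], subst outer[of l]) (simp only: add_diff_cancel_left')
    also have "\<dots> = ?v * ((?E L (Suc (Suc l)) + q ^ Suc L * (?E (Suc L) (Suc l) + ?E L (Suc l))) +
        (?E L (Suc l) + q ^ Suc L * (?E (Suc L) l + ?E L l)))"
      by (simp add: algebra_simps)
    also have "\<dots> = ?v * (?E (Suc L) (Suc (Suc l)) + ?E (Suc L) (Suc l))"
      by (simp only: box_gf_Suc[of q L l] box_gf_Suc[of q L "Suc l"])
    finally show ?case by (simp only: diff_eq_eq add.commute)
  qed
qed

text \<open>Exchanging the arguments exchanges the two recurrences, and the boundary values agree.
  This symmetry takes the place of conjugation.\<close>

lemma box_gf_commute: "box_gf q L l = box_gf q l L"
proof (induction "L + l" arbitrary: L l rule: less_induct)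
  case less
  show ?case
  proof (cases L; cases l)
    fix L' l' assume eq: "L = Suc L'" "l = Suc l'"
    show ?thesis
      using less[of L' "Suc l'"] less[of "Suc L'" l'] less[of L' l']
      by (simp only: eq) (simp add: box_gf_Suc[of q L' l'] box_gf_Suc'[of q l' L'])
  qed auto
qed

section \<open>Infinite sums over overpartitions and the product formula for P\<close>

lemma infsum_exhaust:
  fixes f :: "'a \<Rightarrow> 'b::banach"
  assumes "f summable_on A" "incseq B" "(\<Union>i::nat. B i) = A" "\<And>i. finite (B i)"
  shows "(\<lambda>i. sum f (B i)) \<longlonglongrightarrow> infsum f A"
proof -
  have "filterlim B (finite_subsets_at_top A) sequentially"
    unfolding filterlim_finite_subsets_at_top
  proof safe
    fix X assume X: "finite X" "X \<subseteq> A"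
    have "\<exists>n. X \<subseteq> B n"
      using X
    proof (induction X)
      case (insert x X)
      then obtain n m where "X \<subseteq> B n" "x \<in> B m" using assms(3) by blast
      then have "insert x X \<subseteq> B (max m n)"
        using monoD[OF assms(2), of m "max m n"] monoD[OF assms(2), of n "max m n"] by auto
      then show ?case by blast
    qed auto
    then obtain n where "X \<subseteq> B n" ..
    then show "\<forall>\<^sub>F i in sequentially. finite (B i) \<and> X \<subseteq> B i \<and> B i \<subseteq> A"
      using assms monoD[OF assms(2), of n] by (auto simp: eventually_sequentially intro!: exI[of _ n])
  qed
  from filterlim_compose[OF infsum_tendsto[OF assms(1)] this] show ?thesis .
qed

text \<open>All series for generating functions arise by grouping a set of overpartitions by some
  statistic \<open>\<kappa>\<close>: the largest part, the length, the weight, or a quotient of the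
  rank by the modulus.\<close>

lemma infsum_fibers:
  fixes f :: "'a \<Rightarrow> 'b::banach" and \<kappa> :: "'a \<Rightarrow> nat"
  assumes "f summable_on A"
  shows "(\<lambda>i. infsum f {x \<in> A. \<kappa> x = i}) sums infsum f A"
proof -
  let ?B = "\<lambda>i. {x \<in> A. \<kappa> x = i}"
  have bij: "bij_betw snd (Sigma UNIV ?B) A"
    by (rule bij_betw_byWitness[of _ "\<lambda>x. (\<kappa> x, x)"]) auto
  have "((\<lambda>p. f (snd p)) has_sum infsum f A) (Sigma UNIV ?B)"
    using has_sum_reindex_bij_betw[OF bij, of f "infsum f A"] assms by simp
  moreover have "((\<lambda>y. f (snd (i, y))) has_sum infsum f (?B i)) (?B i)" for i
    using summable_on_subset_banach[OF assms, of "?B i"] by auto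
  ultimately show ?thesis
    by (intro has_sum_imp_sums) (rule has_sum_SigmaD)
qed

text \<open>The bound is independent of \<open>l\<close>, and its exponent stays bounded as
  \<open>L\<close> grows. This gives absolute convergence over all overpartitions before any product
  formula is available.\<close>

lemma box_gf_le_exp:
  fixes r :: real
  assumes r: "0 \<le> r" "r < 1"
  shows "box_gf r L l \<le> exp (\<Sum>j<L. 2 * r ^ Suc j / (1 - r))"
proof (induction L)
  case (Suc L)
  show ?case
  proof (cases l)
    case 0
    then show ?thesis using r by (simp add: sum_nonneg del: sum.lessThan_Suc)
  next
    case (Suc k)
    let ?x = "r ^ Suc L"
    have x: "0 \<le> ?x" "?x \<le> r" "?x < 1"
      using r power_decreasing[of 1 "Suc L" r] by (auto simp del: power_Suc)
    \<comment> \<open>Enlarging \<open>k\<close> to \<open>Suc k\<close> on the right of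
      \<open>box_gf_Suc\<close> leaves an inequality in which only the length \<open>l\<close>
      occurs, so that it can be solved for \<open>box_gf r (Suc L) l\<close>.\<close>
    have mono: "box_gf r M k \<le> box_gf r M (Suc k)" for M
      unfolding box_gf_def using r by (intro sum_mono2 finite_ovp_box) (auto simp: ovp_box_def)
    have "box_gf r (Suc L) l \<le> box_gf r L l + ?x * (box_gf r (Suc L) l + box_gf r L l)"
      unfolding Suc
      by (subst box_gf_Suc) (intro add_left_mono mult_left_mono add_mono mono x)
    then have "box_gf r (Suc L) l * (1 - ?x) \<le> box_gf r L l * (1 + ?x)"
      by (simp add: algebra_simps)
    then have "box_gf r (Suc L) l \<le> box_gf r L l * ((1 + ?x) / (1 - ?x))"
      using x by (simp add: pos_le_divide_eq)
    also have "\<dots> \<le> exp (\<Sum>j<L. 2 * r ^ Suc j / (1 - r)) * exp (2 * ?x / (1 - r))"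
    proof (intro mult_mono)
      have "(1 + ?x) / (1 - ?x) = 1 + 2 * ?x / (1 - ?x)" using x by (simp add: field_simps)
      also have "\<dots> \<le> 1 + 2 * ?x / (1 - r)" using x r by (intro add_left_mono divide_left_mono) auto
      also have "\<dots> \<le> exp (2 * ?x / (1 - r))" by (rule exp_ge_add_one_self)
      finally show "(1 + ?x) / (1 - ?x) \<le> exp (2 * ?x / (1 - r))" .
    qed (use Suc.IH x in auto)
    finally show ?thesis by (simp add: exp_add)
  qed
qed simp

lemma overpartitions_finite_subset_ovp_box:
  assumes "finite F" "F \<subseteq> overpartitions"
  shows "\<exists>L. F \<subseteq> ovp_box L L"
proof -
  have "\<And>ps. ps \<in> F \<Longrightarrow> weight ps \<le> (\<Sum>ps\<in>F. weight ps)"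
    using assms by (intro member_le_sum) auto
  then have "F \<subseteq> ovp_box (\<Sum>ps\<in>F. weight ps) (\<Sum>ps\<in>F. weight ps)"
    using assms(2) overpartitions_length_le_weight overpartitions_first_part_le_weight unfolding ovp_box_def by fastforce
  then show ?thesis ..
qed

lemma summable_on_overpartitions_real:
  fixes r :: real
  assumes r: "0 \<le> r" "r < 1"
  shows "(\<lambda>ps. r ^ weight ps) summable_on overpartitions"
proof (rule nonneg_bdd_above_summable_on)
  have "sum (\<lambda>ps. r ^ weight ps) F \<le> exp (2 / (1 - r) * (1 / (1 - r)))"
    if F: "F \<subseteq> overpartitions" "finite F" for F
  proof -
    obtain L where L: "F \<subseteq> ovp_box L L" using overpartitions_finite_subset_ovp_box F by blast
    have "sum (\<lambda>ps. r ^ weight ps) F \<le> box_gf r L L"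
      unfolding box_gf_def using L r by (intro sum_mono2) auto
    also have "\<dots> \<le> exp (\<Sum>j<L. 2 * r ^ Suc j / (1 - r))"
      by (rule box_gf_le_exp[OF r])
    also have "(\<Sum>j<L. 2 * r ^ Suc j / (1 - r)) = 2 / (1 - r) * (\<Sum>j<L. r ^ Suc j)"
      by (simp add: sum_distrib_left sum_divide_distrib)
    also have "(\<Sum>j<L. r ^ Suc j) \<le> (\<Sum>j<L. r ^ j)"
      using r by (intro sum_mono power_decreasing) auto
    also have "\<dots> \<le> (\<Sum>j. r ^ j)"
      using r by (intro sum_le_suminf summable_geometric) auto
    also have "\<dots> = 1 / (1 - r)" using r by (simp add: suminf_geometric)
    finally show ?thesis using r by (auto simp: divide_right_mono)
  qed
  then show "bdd_above (sum (\<lambda>ps. r ^ weight ps) ` {F. F \<subseteq> overpartitions \<and> finite F})"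
    by (auto intro!: bdd_aboveI2)
qed (use r in auto)

text \<open>In Ln (1 + x) - Ln (1 - x) the even powers cancel. The exponential form lets the factors
  be multiplied later without a choice of branch.\<close>

lemma odd_power_series:
  fixes x :: complex
  assumes "norm x < 1"
  shows "exp (\<Sum>m. 2 * x ^ (2 * m + 1) / of_nat (2 * m + 1)) = (1 + x) / (1 - x)"
    and "summable (\<lambda>m. 2 * x ^ (2 * m + 1) / of_nat (2 * m + 1))"
proof -
  have "(\<lambda>n. (-1) ^ Suc n / of_nat n * x ^ n - (-1) ^ Suc n / of_nat n * (- x) ^ n) sums
      (Ln (1 + x) - Ln (1 + - x))"
    using assms by (intro sums_diff Ln_series) auto
  then have "(\<lambda>m. (\<lambda>n. (-1) ^ Suc n / of_nat n * x ^ n - (-1) ^ Suc n / of_nat n * (- x) ^ n)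
      (2 * m + 1)) sums (Ln (1 + x) - Ln (1 + - x))"
  proof (subst sums_mono_reindex)
    fix n :: nat assume "n \<notin> range (\<lambda>m. 2 * m + 1)"
    then have "even n" by (metis oddE rangeI)
    then show "(-1) ^ Suc n / of_nat n * x ^ n - (-1) ^ Suc n / of_nat n * (- x) ^ n = 0" by simp
  qed (auto simp: strict_mono_def)
  also have "(\<lambda>m. (\<lambda>n. (-1) ^ Suc n / of_nat n * x ^ n - (-1) ^ Suc n / of_nat n * (- x) ^ n)
      (2 * m + 1)) = (\<lambda>m. 2 * x ^ (2 * m + 1) / of_nat (2 * m + 1))"
    by (intro ext) (simp add: power_minus[of x] field_simps)
  finally have s: "(\<lambda>m. 2 * x ^ (2 * m + 1) / of_nat (2 * m + 1)) sums (Ln (1 + x) - Ln (1 + - x))" .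
  then show "summable (\<lambda>m. 2 * x ^ (2 * m + 1) / of_nat (2 * m + 1))" by (rule sums_summable)
  have "1 + x \<noteq> 0" "1 - x \<noteq> 0" using assms norm_minus_cancel[of x] by (auto simp: add_eq_0_iff2 simp del: norm_minus_cancel)
  then show "exp (\<Sum>m. 2 * x ^ (2 * m + 1) / of_nat (2 * m + 1)) = (1 + x) / (1 - x)"
    using s by (simp add: sums_iff exp_diff)
qed

definition gf :: "complex \<Rightarrow> (nat \<times> bool) list set \<Rightarrow> complex" where
  "gf q X = infsum (\<lambda>ps. q ^ weight ps) X"

lemma norm_summable_overpartitions:
  fixes q :: complex
  assumes "norm q < 1" "X \<subseteq> overpartitions"
  shows "(\<lambda>ps. norm q ^ weight ps) summable_on X"
  by (rule summable_on_subset_banach[OF summable_on_overpartitions_real]) (use assms in auto)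

lemma summable_overpartitions:
  fixes q :: complex
  assumes "norm q < 1" "X \<subseteq> overpartitions"
  shows "(\<lambda>ps. q ^ weight ps) summable_on X"
  by (rule abs_summable_summable) (use norm_summable_overpartitions[OF assms] in \<open>simp add: norm_power\<close>)

lemma gf_Un:
  assumes "norm q < 1" "X \<subseteq> overpartitions" "Y \<subseteq> overpartitions" "X \<inter> Y = {}"
  shows "gf q (X \<union> Y) = gf q X + gf q Y"
  unfolding gf_def using assms by (intro infsum_Un_disjoint summable_overpartitions) auto

lemma gf_Diff:
  assumes "norm q < 1" "X \<subseteq> overpartitions" "Y \<subseteq> X"
  shows "gf q (X - Y) = gf q X - gf q Y"
  using gf_Un[of q "X - Y" Y] assms by (simp add: Un_absorb2 Diff_subset subset_trans[OF Diff_subset] subset_trans[of Y X] Int_commute[of _ Y])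

lemma gf_ovp_box [simp]: "gf q (ovp_box L l) = box_gf q L l"
  by (simp add: gf_def box_gf_def)

lemma gf_fibers:
  assumes "norm q < 1" "X \<subseteq> overpartitions"
  shows "(\<lambda>i. gf q {ps \<in> X. \<kappa> ps = (i::nat)}) sums gf q X"
  unfolding gf_def by (rule infsum_fibers[OF summable_overpartitions[OF assms]])

text \<open>Writing |q|^w as the square of sqrt |q| ^ w, one factor pays for the decay in
  \<open>m\<close> and the other for the convergence of the sum.\<close>

lemma norm_gf_le:
  assumes "norm q < 1" "X \<subseteq> overpartitions" "\<And>ps. ps \<in> X \<Longrightarrow> m \<le> weight ps"
  shows "norm (gf q X) \<le> sqrt (norm q) ^ m * infsum (\<lambda>ps. sqrt (norm q) ^ weight ps) overpartitions"
proof -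
  let ?s = "sqrt (norm q)"
  have s: "0 \<le> ?s" "?s < 1" using assms(1) by auto
  have sm: "(\<lambda>ps. ?s ^ weight ps) summable_on overpartitions" by (rule summable_on_overpartitions_real[OF s])
  then have sm': "(\<lambda>ps. ?s ^ weight ps) summable_on X"
    using assms(2) by (rule summable_on_subset_banach)
  have "norm (gf q X) \<le> infsum (\<lambda>ps. ?s ^ m * ?s ^ weight ps) X"
    unfolding gf_def
  proof (rule norm_infsum_le)
    show "((\<lambda>ps. q ^ weight ps) has_sum infsum (\<lambda>ps. q ^ weight ps) X) X"
      using summable_overpartitions assms by simp
    show "((\<lambda>ps. ?s ^ m * ?s ^ weight ps) has_sum infsum (\<lambda>ps. ?s ^ m * ?s ^ weight ps) X) X"
      using sm' by (intro has_sum_infsum summable_on_cmult_right)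
    fix ps assume "ps \<in> X"
    then have "m \<le> weight ps" by (rule assms(3))
    then have "?s ^ (weight ps + weight ps) \<le> ?s ^ (m + weight ps)"
      using s by (intro power_decreasing) auto
    then show "norm (q ^ weight ps) \<le> ?s ^ m * ?s ^ weight ps"
      by (simp add: norm_power power_add flip: power_mult_distrib)
  qed
  also have "\<dots> = ?s ^ m * infsum (\<lambda>ps. ?s ^ weight ps) X"
    by (rule infsum_cmult_right')
  also have "\<dots> \<le> ?s ^ m * infsum (\<lambda>ps. ?s ^ weight ps) overpartitions"
    using s assms(2) by (intro mult_left_mono infsum_mono_neutral sm sm') auto
  finally show ?thesis .
qed

lemma summable_on_geometric2:
  fixes r :: real
  assumes "0 \<le> r" "r < 1"
  shows "(\<lambda>(j::nat, m::nat). r ^ j * r ^ m) summable_on UNIV \<times> UNIV"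
proof (rule summable_on_SigmaI)
  have g: "((\<lambda>j. r ^ j) has_sum (1 / (1 - r))) (UNIV :: nat set)"
    using assms by (intro sums_nonneg_imp_has_sum geometric_sums) auto
  show "((\<lambda>m. case (j, m) of (j, m) \<Rightarrow> r ^ j * r ^ m) has_sum r ^ j * (1 / (1 - r))) UNIV" for j
    using has_sum_cmult_right[OF g] by simp
  show "(\<lambda>j. r ^ j * (1 / (1 - r))) summable_on (UNIV :: nat set)"
    using g by (intro summable_on_cmult_left) (auto simp: summable_on_def)
qed (use assms in auto)

lemma summable_on_geometric2_comparison:
  fixes f :: "nat \<Rightarrow> nat \<Rightarrow> complex" and r :: real
  assumes "0 \<le> r" "r < 1" "\<And>j m. norm (f j m) \<le> C * (r ^ j * r ^ m)"
  shows "(\<lambda>(j, m). f j m) summable_on UNIV \<times> UNIV"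
proof (rule abs_summable_summable, rule Infinite_Sum.abs_summable_on_comparison_test')
  show "(\<lambda>x. C * (case x of (j, m) \<Rightarrow> r ^ j * r ^ m)) summable_on (UNIV :: nat set) \<times> (UNIV :: nat set)"
    by (rule summable_on_cmult_right[OF summable_on_geometric2]) (use assms in auto)
qed (use assms in \<open>auto simp: case_prod_unfold\<close>)

lemma suminf_swap:
  fixes f :: "nat \<Rightarrow> nat \<Rightarrow> complex"
  assumes "(\<lambda>(j, m). f j m) summable_on UNIV \<times> UNIV"
  shows "(\<lambda>j. \<Sum>m. f j m) sums (\<Sum>m. \<Sum>j. f j m)" "summable (\<lambda>m. \<Sum>j. f j m)"
proof -
  let ?S = "infsum (\<lambda>(j, m). f j m) (UNIV \<times> UNIV)"
  have *: "(\<lambda>j. \<Sum>m. g j m) sums infsum (\<lambda>(j, m). g j m) (UNIV \<times> UNIV)"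
    if g: "(\<lambda>(j, m). g j m) summable_on UNIV \<times> UNIV" for g :: "nat \<Rightarrow> nat \<Rightarrow> complex"
  proof -
    have "g j summable_on UNIV" for j
      using summable_on_SigmaD1[of g UNIV "\<lambda>_. UNIV" j] g by simp
    then have "(g j has_sum (\<Sum>m. g j m)) UNIV" for j
      using has_sum_imp_sums by (metis has_sum_infsum sums_unique)
    then show ?thesis
      by (intro has_sum_imp_sums has_sum_SigmaD[OF has_sum_infsum[OF g]]) auto
  qed
  have sw: "(\<lambda>(m, j). f j m) summable_on UNIV \<times> UNIV"
    using assms summable_on_swap[of "\<lambda>(j, m). f j m" UNIV UNIV] by (simp add: case_prod_unfold)
  have "infsum (\<lambda>(m, j). f j m) (UNIV \<times> UNIV) = ?S"
    using infsum_swap_banach[OF assms] infsum_Sigma'_banach[OF assms] infsum_Sigma'_banach[OF sw] by simp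
  then show "(\<lambda>j. \<Sum>m. f j m) sums (\<Sum>m. \<Sum>j. f j m)" "summable (\<lambda>m. \<Sum>j. f j m)"
    using *[OF assms] *[OF sw] by (auto simp: sums_iff)
qed

lemma one_minus_power_neq_0:
  fixes q :: complex
  assumes "norm q < 1" "n > 0"
  shows "1 - q ^ n \<noteq> 0" "1 + q ^ n \<noteq> 0"
proof -
  have "norm (q ^ n) < 1" using assms by (simp add: norm_power power_less_one_iff)
  then have "q ^ n \<noteq> 1" "q ^ n \<noteq> - 1" by auto
  then show "1 - q ^ n \<noteq> 0" "1 + q ^ n \<noteq> 0"
    by (simp_all add: add_eq_0_iff)
qed

text \<open>The limit of \<open>box_gf_Suc\<close> as the permitted number of parts tends to
  infinity, solved for the new value.\<close>

lemma gf_first_part_le_Suc: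
  assumes q: "norm q < 1"
  shows "gf q {ps \<in> overpartitions. first_part ps \<le> Suc L} =
    gf q {ps \<in> overpartitions. first_part ps \<le> L} * ((1 + q ^ Suc L) / (1 - q ^ Suc L))"
proof -
  have lim: "(\<lambda>i. box_gf q L i) \<longlonglongrightarrow> gf q {ps \<in> overpartitions. first_part ps \<le> L}" for L
    unfolding box_gf_def gf_def
    using q by (intro infsum_exhaust summable_overpartitions) (auto simp: incseq_def ovp_box_def finite_ovp_box[unfolded ovp_box_def])
  let ?G = "\<lambda>L. gf q {ps \<in> overpartitions. first_part ps \<le> L}"
  have "(\<lambda>i. box_gf q L (Suc i) + q ^ Suc L * (box_gf q (Suc L) i + box_gf q L i)) \<longlonglongrightarrow>
      ?G L + q ^ Suc L * (?G (Suc L) + ?G L)"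
    by (intro tendsto_intros lim LIMSEQ_Suc)
  moreover have "(\<lambda>i. box_gf q (Suc L) (Suc i)) \<longlonglongrightarrow> ?G (Suc L)"
    by (intro lim LIMSEQ_Suc)
  ultimately have "?G (Suc L) = ?G L + q ^ Suc L * (?G (Suc L) + ?G L)"
    unfolding box_gf_Suc by (rule LIMSEQ_unique[rotated])
  then have "?G (Suc L) * (1 - q ^ Suc L) = ?G L * (1 + q ^ Suc L)" by (simp add: algebra_simps del: power_Suc)
  then show ?thesis
    using one_minus_power_neq_0[OF q, of "Suc L"] by (simp add: nonzero_eq_divide_eq del: power_Suc)
qed

text \<open>The logarithm of the product of (1 + q^j) / (1 - q^j) is a double series; summing it
  over \<open>j\<close> first, by the geometric series, leaves a Lambert series over odd numbers.
  The exponential also shows that P has no zero, so that later formulas may divide by it.\<close>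

lemma gf_overpartitions:
  assumes q: "norm q < 1"
  shows "gf q overpartitions = exp (\<Sum>m. 2 / of_nat (2 * m + 1) * (q ^ (2 * m + 1) / (1 - q ^ (2 * m + 1))))"
proof -
  define u where "u = (\<lambda>j m. 2 * (q ^ Suc j) ^ (2 * m + 1) / of_nat (2 * m + 1))"
  let ?G = "\<lambda>L. gf q {ps \<in> overpartitions. first_part ps \<le> L}"
  have G: "?G L = exp (\<Sum>j<L. \<Sum>m. u j m)" for L
  proof (induction L)
    case 0
    have "{ps \<in> overpartitions. first_part ps \<le> 0} = {[]}" using overpartitions_first_part_0 by auto
    then show ?case by (simp add: gf_def)
  next
    case (Suc L)
    have "norm (q ^ Suc L) < 1" using q by (simp add: norm_power power_less_one_iff del: power_Suc)
    then show ?case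
      unfolding gf_first_part_le_Suc[OF q] Suc
      by (simp add: exp_add u_def odd_power_series(1)[symmetric] del: power_Suc)
  qed
  have "(\<lambda>i. gf q {ps \<in> overpartitions. first_part ps = i}) sums gf q overpartitions"
    by (rule gf_fibers[OF q]) auto
  then have "(\<lambda>n. \<Sum>i\<le>n. gf q {ps \<in> overpartitions. first_part ps = i}) \<longlonglongrightarrow> gf q overpartitions"
    by (simp add: sums_def_le)
  moreover have "(\<Sum>i\<le>n. gf q {ps \<in> overpartitions. first_part ps = i}) = ?G n" for n
  proof (induction n)
    case (Suc n)
    have "{ps \<in> overpartitions. first_part ps \<le> Suc n} =
        {ps \<in> overpartitions. first_part ps \<le> n} \<union> {ps \<in> overpartitions. first_part ps = Suc n}" by auto
    then show ?case using Suc by (simp add: gf_Un[OF q] disjoint_iff)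
  qed auto
  ultimately have lim: "?G \<longlonglongrightarrow> gf q overpartitions" by simp
  have "(\<lambda>(j, m). u j m) summable_on UNIV \<times> UNIV"
  proof (rule summable_on_geometric2_comparison[of "norm q" _ 2])
    fix j m
    have "norm (u j m) \<le> 2 * norm q ^ (Suc j * (2 * m + 1))"
    proof -
      have "norm (u j m) = 2 * norm q ^ (Suc j * (2 * m + 1)) / real (2 * m + 1)"
        unfolding u_def norm_divide norm_mult norm_power norm_of_nat power_mult by simp
      also have "\<dots> \<le> 2 * norm q ^ (Suc j * (2 * m + 1)) / 1"
        by (intro divide_left_mono) auto
      finally show ?thesis by (simp only: div_by_1)
    qed
    also have "\<dots> \<le> 2 * norm q ^ (j + m)"
      using q by (intro mult_left_mono power_decreasing) auto
    finally show "norm (u j m) \<le> 2 * (norm q ^ j * norm q ^ m)" by (simp add: power_add)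
  qed (use q in auto)
  from suminf_swap(1)[OF this] have "(\<lambda>L. \<Sum>j<L. \<Sum>m. u j m) \<longlonglongrightarrow> (\<Sum>m. \<Sum>j. u j m)"
    by (simp add: sums_def)
  from tendsto_exp[OF this] have "gf q overpartitions = exp (\<Sum>m. \<Sum>j. u j m)"
    using lim G LIMSEQ_unique by auto
  also have "(\<lambda>m. \<Sum>j. u j m) = (\<lambda>m. 2 / of_nat (2 * m + 1) * (q ^ (2 * m + 1) / (1 - q ^ (2 * m + 1))))"
  proof
    fix m
    let ?x = "q ^ (2 * m + 1)"
    have "norm ?x < 1" using q by (simp add: norm_power power_less_one_iff del: power_Suc)
    then have "(\<lambda>j. 2 / of_nat (2 * m + 1) * (?x * ?x ^ j)) sums (2 / of_nat (2 * m + 1) * (?x * (1 / (1 - ?x))))"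
      by (intro sums_mult geometric_sums)
    moreover have "u j m = 2 / of_nat (2 * m + 1) * (?x * ?x ^ j)" for j
    proof -
      have "(q ^ Suc j) ^ (2 * m + 1) = ?x ^ Suc j"
        by (simp only: power_mult[symmetric] mult.commute)
      then show ?thesis by (simp add: u_def)
    qed
    ultimately show "(\<Sum>j. u j m) = 2 / of_nat (2 * m + 1) * (?x / (1 - ?x))"
      by (simp add: sums_iff)
  qed
  finally show ?thesis .
qed

section \<open>The rank generating function\<close>

definition rank_ge :: "nat \<Rightarrow> (nat \<times> bool) list set" where
  "rank_ge m = {ps \<in> overpartitions. ps \<noteq> [] \<and> length ps + m \<le> first_part ps}"

lemma rank_ge_subset [simp]: "rank_ge m \<subseteq> overpartitions"
  by (auto simp: rank_ge_def)

text \<open>Grouping by the largest part \<open>Suc (i + m)\<close> turns the condition on the rank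
  into the bound \<open>Suc i\<close> for the number of parts, and fixing the largest part is a
  difference of two boxes.\<close>

lemma gf_rank_ge_sums:
  assumes q: "norm q < 1"
  shows "(\<lambda>i. box_gf q (Suc (i + m)) (Suc i) - box_gf q (i + m) (Suc i)) sums gf q (rank_ge m)"
proof -
  have "(\<lambda>i. gf q {ps \<in> rank_ge m. first_part ps - m = i}) sums gf q (rank_ge m)"
    by (rule gf_fibers[OF q]) simp
  \<comment> \<open>A nonempty member has at least one part, hence a largest part above
    \<open>m\<close>. So the truncated subtraction loses nothing, and the index may start at
    1.\<close>
  moreover have "{ps \<in> rank_ge m. first_part ps - m = 0} = {}"
    by (auto simp: rank_ge_def neq_Nil_conv)
  then have "gf q {ps \<in> rank_ge m. first_part ps - m = 0} = 0"
    by (simp only:) (simp add: gf_def)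
  moreover have "gf q {ps \<in> rank_ge m. first_part ps - m = Suc i} =
      box_gf q (Suc (i + m)) (Suc i) - box_gf q (i + m) (Suc i)" for i
  proof -
    have "{ps \<in> rank_ge m. first_part ps - m = Suc i} = ovp_box (Suc (i + m)) (Suc i) - ovp_box (i + m) (Suc i)"
      by (auto simp: rank_ge_def ovp_box_def)
    also have "gf q \<dots> = gf q (ovp_box (Suc (i + m)) (Suc i)) - gf q (ovp_box (i + m) (Suc i))"
      by (rule gf_Diff[OF q]) (auto simp: ovp_box_def)
    finally show ?thesis by simp
  qed
  ultimately show ?thesis
    using sums_Suc_iff[of "\<lambda>i. gf q {ps \<in> rank_ge m. first_part ps - m = i}"]
    by (simp only: add_0_right)
qed

text \<open>The complementary set, grouped by length instead of largest part. The empty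
  overpartition belongs to it and is the summand 1 at \<open>i = 0\<close>.\<close>

lemma gf_rank_le_sums:
  assumes q: "norm q < 1"
  shows "(\<lambda>i. if i = 0 then 1 else box_gf q (i + m) i - box_gf q (i + m) (i - 1)) sums
    (gf q overpartitions - gf q (rank_ge (Suc m)))"
proof -
  have "(\<lambda>i. gf q {ps \<in> overpartitions - rank_ge (Suc m). length ps = i}) sums gf q (overpartitions - rank_ge (Suc m))"
    by (rule gf_fibers[OF q]) auto
  moreover have "gf q {ps \<in> overpartitions - rank_ge (Suc m). length ps = i} =
      (if i = 0 then 1 else box_gf q (i + m) i - box_gf q (i + m) (i - 1))" for i
  proof (cases i)
    case 0
    have "{ps \<in> overpartitions - rank_ge (Suc m). length ps = 0} = {[]}"
      by (auto simp: rank_ge_def)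
    then show ?thesis using 0 by (simp add: gf_def)
  next
    case (Suc j)
    have "{ps \<in> overpartitions - rank_ge (Suc m). length ps = Suc j} = ovp_box (Suc j + m) (Suc j) - ovp_box (Suc j + m) j"
      by (auto simp: rank_ge_def ovp_box_def)
    also have "gf q \<dots> = gf q (ovp_box (Suc j + m) (Suc j)) - gf q (ovp_box (Suc j + m) j)"
      by (rule gf_Diff[OF q]) (auto simp: ovp_box_def)
    finally show ?thesis using Suc by simp
  qed
  moreover have "gf q (overpartitions - rank_ge (Suc m)) = gf q overpartitions - gf q (rank_ge (Suc m))"
    by (rule gf_Diff[OF q]) auto
  ultimately show ?thesis by simp
qed

text \<open>The algebraic form of Dyson's map, which deletes the first column of a diagram with
  $\ell$ rows and adds a row of length $\ell + m + 1$.\<close>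

lemma gf_rank_ge_rec:
  assumes q: "norm q < 1"
  shows "gf q (rank_ge m) + gf q (rank_ge (Suc m)) =
    q ^ Suc m * (2 * gf q overpartitions - (gf q (rank_ge (m + 2)) + gf q (rank_ge (m + 3))))"
proof -
  let ?E = "box_gf q"
  let ?A = "\<lambda>i. ?E (Suc (i + m)) (Suc i) - ?E (i + m) (Suc i)"
  let ?B = "\<lambda>i. ?E (Suc (i + m)) i - ?E (i + m) i"
  let ?X = "\<lambda>k i. if i = 0 then 1 else ?E (i + k) i - ?E (i + k) (i - 1)"
  have "(\<lambda>i. ?B (Suc i)) sums gf q (rank_ge (Suc m))"
    using gf_rank_ge_sums[OF q, of "Suc m"] by simp
  \<comment> \<open>\<open>?B 0\<close> vanishes because boxes without rows contain only the empty
    list; the shift by one therefore aligns this series with \<open>?A\<close>.\<close>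
  then have "?B sums gf q (rank_ge (Suc m))"
    by (subst (asm) sums_Suc_iff) simp
  with gf_rank_ge_sums[OF q, of m]
  have 1: "(\<lambda>i. ?A i + ?B i) sums (gf q (rank_ge m) + gf q (rank_ge (Suc m)))"
    by (rule sums_add)
  have 2: "(\<lambda>i. q ^ Suc m * (?X (m + 1) i + ?X (m + 2) i)) sums
      (q ^ Suc m * ((gf q overpartitions - gf q (rank_ge (Suc (m + 1)))) + (gf q overpartitions - gf q (rank_ge (Suc (m + 2))))))"
    by (intro sums_mult sums_add gf_rank_le_sums q)
  have "?A i + ?B i = q ^ Suc m * (?X (m + 1) i + ?X (m + 2) i)" for i
  proof (cases i)
    case 0
    then show ?thesis using box_gf_Suc[of q m 0] by simp
  next
    case (Suc j)
    have "?A i + ?B i =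
        q ^ Suc (i + m) * (?E (Suc (i + m)) i + ?E (i + m) i) +
        q ^ Suc (i + m) * (?E (Suc (i + m)) j + ?E (i + m) j)"
      using box_gf_Suc[of q "i + m" i] box_gf_Suc[of q "i + m" j] Suc by simp
    also have "\<dots> = q ^ Suc m * (q ^ i * (?E (i + m) i + ?E (i + m) j) +
        q ^ i * (?E (Suc (i + m)) i + ?E (Suc (i + m)) j))"
      by (simp add: power_add algebra_simps)
    also have "\<dots> = q ^ Suc m * (?X (m + 1) i + ?X (m + 2) i)"
      using box_gf_Suc'[of q "i + m" j] box_gf_Suc'[of q "Suc (i + m)" j] Suc by simp
    finally show ?thesis .
  qed
  then have "gf q (rank_ge m) + gf q (rank_ge (Suc m)) =
      q ^ Suc m * ((gf q overpartitions - gf q (rank_ge (Suc (m + 1)))) + (gf q overpartitions - gf q (rank_ge (Suc (m + 2)))))"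
    using sums_unique2[OF 1] 2 by simp
  then show ?thesis by (simp add: algebra_simps numeral_2_eq_2 numeral_3_eq_3)
qed

text \<open>Each application of the recurrence gains a factor of norm at most \<open>norm q\<close>,
  and the bound \<open>B\<close> is uniform in \<open>m\<close>. This provides uniqueness in the
  proof of the rank formula.\<close>

lemma eq_0_if_contracting:
  fixes \<delta> :: "nat \<Rightarrow> complex"
  assumes q: "norm q < 1" and B: "\<And>m. norm (\<delta> m) \<le> B"
    and rec: "\<And>m. \<delta> m = - (q ^ Suc m * \<delta> (m + 2))"
  shows "\<delta> m = 0"
proof -
  have "norm (\<delta> m) \<le> norm q ^ k * B" for k
  proof (induction k arbitrary: m)
    case (Suc k)
    have "norm (\<delta> m) = norm q ^ Suc m * norm (\<delta> (m + 2))"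
      by (subst rec) (simp add: norm_mult norm_power)
    also have "\<dots> \<le> norm q ^ 1 * (norm q ^ k * B)"
      using q Suc by (intro mult_mono power_decreasing) auto
    finally show ?case by (simp add: mult.assoc)
  qed (use B in simp)
  moreover have "(\<lambda>k. norm q ^ k * B) \<longlonglongrightarrow> 0"
    using q by (intro tendsto_mult_left_zero LIMSEQ_power_zero) auto
  ultimately have "norm (\<delta> m) \<le> 0"
    by (intro LIMSEQ_le_const[of _ _ "norm (\<delta> m)"]) auto
  then show ?thesis by simp
qed

lemma norm_one_plus_power_ge:
  fixes q :: complex
  assumes "norm q < 1"
  shows "1 - norm q \<le> norm (1 + q ^ Suc k)" "1 - norm q \<le> norm (1 - q ^ Suc k)"
proof -
  have *: "norm (q ^ Suc k) \<le> norm q"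
    using power_decreasing[of 1 "Suc k" "norm q"] assms by (simp add: norm_power norm_mult)
  show "1 - norm q \<le> norm (1 + q ^ Suc k)"
    using * norm_triangle_ineq2[of 1 "- (q ^ Suc k)"] by simp
  show "1 - norm q \<le> norm (1 - q ^ Suc k)"
    using * norm_triangle_ineq2[of 1 "q ^ Suc k"] by simp
qed

text \<open>After multiplication by 2P the series \<open>H m\<close> satisfies the recurrence of
  \<open>gf_rank_ge_rec\<close>. That recurrence only sees sums of two neighbours, so contraction
  yields \<open>\<epsilon> m + \<epsilon> (Suc m) = 0\<close> for the difference of the two sides.
  Hence the norm of \<open>\<epsilon> m\<close> does not depend on \<open>m\<close>, and it is 0
  because both sides decay as \<open>m\<close> grows.\<close>

lemma gf_rank_ge:
  assumes q: "norm q < 1"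
  shows "(\<lambda>k. (-1) ^ k * q ^ ((Suc k)\<^sup>2 + m * Suc k) / (1 + q ^ Suc k)) sums (gf q (rank_ge m) / (2 * gf q overpartitions))"
proof -
  define P where "P = gf q overpartitions"
  have P0: "P \<noteq> 0" unfolding P_def gf_overpartitions[OF q] by simp
  define r where "r = norm q"
  have r: "0 \<le> r" "r < 1" using q by (auto simp: r_def)
  define h where "h = (\<lambda>m k. (-1) ^ k * q ^ ((Suc k)\<^sup>2 + m * Suc k) / (1 + q ^ Suc k))"
  define b where "b = (\<lambda>m k. (-1) ^ k * q ^ ((Suc k)\<^sup>2 + m * Suc k))"
  have b_le: "norm (b m k) \<le> r ^ m * r ^ k" for m k
  proof -
    have "norm (b m k) = r ^ ((Suc k)\<^sup>2 + m * Suc k)"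
      by (simp add: b_def norm_mult norm_power r_def)
    also have "\<dots> \<le> r ^ (m + k)"
      using r by (intro power_decreasing) (auto simp: power2_eq_square)
    finally show ?thesis by (simp add: power_add)
  qed
  have h_le: "norm (h m k) \<le> r ^ m * r ^ k / (1 - r)" for m k
  proof -
    have "norm (h m k) = norm (b m k) / norm (1 + q ^ Suc k)"
      by (simp add: h_def b_def norm_divide)
    also have "\<dots> \<le> r ^ m * r ^ k / (1 - r)"
      using b_le norm_one_plus_power_ge(1)[OF q, of k] r
      by (intro frac_le) (auto simp: r_def)
    finally show ?thesis .
  qed
  have sum_b: "summable (b m)" for m
    by (rule summable_comparison_test'[of "\<lambda>k. r ^ m * r ^ k"]) (use r b_le in auto)
  have sum_h: "summable (h m)" for m
    by (rule summable_comparison_test'[of "\<lambda>k. r ^ m * r ^ k / (1 - r)" 0])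
       (use r h_le in \<open>auto intro!: summable_divide\<close>)
  define H where "H = (\<lambda>m. suminf (h m))"
  have H_le: "norm (H m) \<le> r ^ m * (1 / (1 - r) / (1 - r))" for m
  proof -
    have "norm (H m) \<le> (\<Sum>k. r ^ m * r ^ k / (1 - r))"
      unfolding H_def by (rule norm_suminf_le) (use r h_le in \<open>auto intro!: summable_divide\<close>)
    also have "\<dots> = r ^ m * (\<Sum>k. r ^ k) / (1 - r)"
      using r by (subst suminf_divide, simp, subst suminf_mult) auto
    finally show ?thesis using r by (simp add: suminf_geometric)
  qed
  \<comment> \<open>Adding neighbours cancels the denominators and leaves the partial theta series
    \<open>b m\<close>. Its exponent at (m, k + 1) is m + 1 plus the exponent at (m + 2, k), so
    removing the first term gives the same series at m + 2 with the opposite sign.\<close>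
  have Hrec: "H m + H (Suc m) = q ^ Suc m * (1 - (H (m + 2) + H (m + 3)))" for m
  proof -
    have add: "H m + H (Suc m) = suminf (b m)" for m
    proof -
      have "h m k + h (Suc m) k = b m k" for k
      proof -
        have "q ^ ((Suc k)\<^sup>2 + Suc m * Suc k) = q ^ Suc k * q ^ ((Suc k)\<^sup>2 + m * Suc k)"
          by (simp only: power_add[symmetric]) (simp add: ac_simps)
        then have "h m k + h (Suc m) k = b m k * (1 + q ^ Suc k) / (1 + q ^ Suc k)"
          unfolding h_def b_def by (simp only: add_divide_distrib[symmetric]) (simp add: algebra_simps del: power_Suc)
        then show ?thesis using one_minus_power_neq_0(2)[OF q, of "Suc k"] by simp
      qed
      then show ?thesis
        unfolding H_def by (subst suminf_add[OF sum_h sum_h]) simp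
    qed
    have "b m (Suc k) = - (q ^ Suc m * b (m + 2) k)" for k
    proof -
      have "(Suc (Suc k))\<^sup>2 + m * Suc (Suc k) = Suc m + ((Suc k)\<^sup>2 + (m + 2) * Suc k)"
        by (simp add: power2_eq_square)
      then have "q ^ ((Suc (Suc k))\<^sup>2 + m * Suc (Suc k)) = q ^ Suc m * q ^ ((Suc k)\<^sup>2 + (m + 2) * Suc k)"
        by (simp only: power_add)
      moreover have "(-1) ^ Suc k * (u * v) = - (u * ((-1) ^ k * v))" for u v :: complex by simp
      ultimately show ?thesis by (simp only: b_def)
    qed
    then have "suminf (b m) = b m 0 + (\<Sum>k. - (q ^ Suc m * b (m + 2) k))"
      using suminf_split_head[OF sum_b, of m] by simp
    also have "(\<Sum>k. - (q ^ Suc m * b (m + 2) k)) = - (q ^ Suc m * suminf (b (m + 2)))"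
      by (subst suminf_minus, intro summable_mult sum_b, subst suminf_mult[OF sum_b]) simp
    finally have "suminf (b m) = q ^ Suc m * (1 - suminf (b (m + 2)))"
      by (simp add: b_def algebra_simps)
    then show ?thesis
      unfolding add using add[of "m + 2"] by (simp add: numeral_3_eq_3 numeral_2_eq_2)
  qed
  define \<epsilon> where "\<epsilon> m = gf q (rank_ge m) - 2 * P * H m" for m
  obtain C where C: "norm (gf q (rank_ge m)) \<le> sqrt r ^ m * C" "0 \<le> C" for m
  proof
    show "norm (gf q (rank_ge m)) \<le> sqrt r ^ m * infsum (\<lambda>ps. sqrt r ^ weight ps) overpartitions" for m
      unfolding r_def
    proof (rule norm_gf_le[OF q])
      fix ps assume "ps \<in> rank_ge m"
      then show "m \<le> weight ps" using overpartitions_first_part_le_weight[of ps] by (simp add: rank_ge_def)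
    qed simp
    show "0 \<le> infsum (\<lambda>ps. sqrt r ^ weight ps) overpartitions" using r by (intro infsum_nonneg) auto
  qed
  define D where "D = 2 * norm P * (1 / (1 - r) / (1 - r))"
  have D: "0 \<le> D" using r by (simp add: D_def)
  have \<epsilon>_le: "norm (\<epsilon> m) \<le> sqrt r ^ m * C + r ^ m * D" for m
  proof -
    have "norm (\<epsilon> m) \<le> norm (gf q (rank_ge m)) + 2 * norm P * norm (H m)"
      unfolding \<epsilon>_def using norm_triangle_ineq4[of "gf q (rank_ge m)" "2 * P * H m"]
      by (simp add: norm_mult)
    also have "2 * norm P * norm (H m) \<le> 2 * norm P * (r ^ m * (1 / (1 - r) / (1 - r)))"
      by (intro mult_left_mono H_le) auto
    finally show ?thesis using C(1)[of m] by (simp add: D_def mult_ac)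
  qed
  have "\<epsilon> m + \<epsilon> (Suc m) = 0" for m
  proof (rule eq_0_if_contracting[OF q, where \<delta> = "\<lambda>m. \<epsilon> m + \<epsilon> (Suc m)"])
    show "norm (\<epsilon> m + \<epsilon> (Suc m)) \<le> 2 * (C + D)" for m
    proof -
      have "norm (\<epsilon> m) \<le> C + D" for m
      proof -
        have "sqrt r ^ m * C \<le> 1 * C" "r ^ m * D \<le> 1 * D"
          using r C(2) D by (intro mult_right_mono power_le_one; simp)+
        then show ?thesis using \<epsilon>_le[of m] by linarith
      qed
      then show ?thesis using norm_triangle_ineq[of "\<epsilon> m" "\<epsilon> (Suc m)"]
        by (smt (verit))
    qed
    show "\<epsilon> m + \<epsilon> (Suc m) = - (q ^ Suc m * (\<epsilon> (m + 2) + \<epsilon> (Suc (m + 2))))" for m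
    proof -
      have "\<epsilon> m + \<epsilon> (Suc m) = (gf q (rank_ge m) + gf q (rank_ge (Suc m))) - 2 * P * (H m + H (Suc m))"
        by (simp add: \<epsilon>_def algebra_simps)
      also have "\<dots> = - (q ^ Suc m * (\<epsilon> (m + 2) + \<epsilon> (m + 3)))"
        unfolding gf_rank_ge_rec[OF q] Hrec by (simp add: \<epsilon>_def P_def algebra_simps)
      finally show ?thesis by (simp add: numeral_3_eq_3)
    qed
  qed
  then have step: "norm (\<epsilon> (Suc m)) = norm (\<epsilon> m)" for m
    by (metis add_eq_0_iff norm_minus_cancel)
  have const: "norm (\<epsilon> (m + k)) = norm (\<epsilon> m)" for k
    by (induction k) (simp_all add: step)
  have "(\<lambda>k. sqrt r ^ k * C + r ^ k * D) \<longlonglongrightarrow> 0 * C + 0 * D"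
    using r by (intro tendsto_intros LIMSEQ_power_zero) auto
  then have "(\<lambda>k. sqrt r ^ (k + m) * C + r ^ (k + m) * D) \<longlonglongrightarrow> 0"
    using LIMSEQ_ignore_initial_segment by fastforce
  moreover have "norm (\<epsilon> m) \<le> sqrt r ^ (k + m) * C + r ^ (k + m) * D" for k
    using \<epsilon>_le[of "k + m"] const[of k] by (simp add: add.commute)
  ultimately have "norm (\<epsilon> m) \<le> 0"
    by (intro LIMSEQ_le_const[of _ _ "norm (\<epsilon> m)"]) auto
  then have "H m = gf q (rank_ge m) / (2 * gf q overpartitions)"
    using P0 by (simp add: \<epsilon>_def P_def field_simps)
  then show ?thesis
    using sum_h[of m] by (simp add: H_def h_def sums_iff)
qed

section \<open>Symmetry of the rank under conjugation\<close>

definition cell :: "nat \<Rightarrow> nat \<Rightarrow> (nat \<times> bool) list set" where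
  "cell L l = {ps \<in> overpartitions. first_part ps = L \<and> length ps = l}"

text \<open>A cell is a second difference of boxes and inherits the symmetry of
  \<open>box_gf\<close>. Exchanging the largest part with the number of parts changes the sign of
  the rank.\<close>

lemma gf_cell_commute:
  assumes q: "norm q < 1"
  shows "gf q (cell L l) = gf q (cell l L)"
proof (cases "L = 0 \<or> l = 0")
  case True
  have "cell L 0 = (if L = 0 then {[]} else {})" "cell 0 L = (if L = 0 then {[]} else {})" for L
    by (auto simp: cell_def overpartitions_first_part_0 dest: overpartitions_first_part_0)
  then show ?thesis using True by auto
next
  case False
  have *: "gf q (cell (Suc L) (Suc l)) =
      box_gf q (Suc L) (Suc l) - box_gf q L (Suc l) - (box_gf q (Suc L) l - box_gf q L l)" for L l
  proof -
    have "cell (Suc L) (Suc l) = (ovp_box (Suc L) (Suc l) - ovp_box L (Suc l)) - (ovp_box (Suc L) l - ovp_box L l)"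
      by (auto simp: cell_def ovp_box_def)
    also have "gf q \<dots> = gf q (ovp_box (Suc L) (Suc l) - ovp_box L (Suc l)) - gf q (ovp_box (Suc L) l - ovp_box L l)"
      by (rule gf_Diff[OF q]) (auto simp: ovp_box_def)
    also have "gf q (ovp_box (Suc L) (Suc l) - ovp_box L (Suc l)) = gf q (ovp_box (Suc L) (Suc l)) - gf q (ovp_box L (Suc l))"
      by (rule gf_Diff[OF q]) (auto simp: ovp_box_def)
    also have "gf q (ovp_box (Suc L) l - ovp_box L l) = gf q (ovp_box (Suc L) l) - gf q (ovp_box L l)"
      by (rule gf_Diff[OF q]) (auto simp: ovp_box_def)
    finally show ?thesis by simp
  qed
  obtain L' l' where "L = Suc L'" "l = Suc l'" using False by (meson not0_implies_Suc)
  then show ?thesis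
    using *[of L' l'] *[of l' L'] by (simp add: box_gf_commute[of q "Suc l'"] box_gf_commute[of q l'])
qed

definition rank_eq :: "int \<Rightarrow> (nat \<times> bool) list set" where
  "rank_eq m = {ps \<in> overpartitions. ps \<noteq> [] \<and> int (first_part ps) - int (length ps) = m}"

lemma rank_eq_subset [simp]: "rank_eq m \<subseteq> overpartitions"
  by (auto simp: rank_eq_def)

lemma gf_rank_eq_uminus:
  assumes q: "norm q < 1"
  shows "gf q (rank_eq (- int m)) = gf q (rank_eq (int m))"
proof -
  have "(\<lambda>i. gf q {ps \<in> rank_eq (- int m). first_part ps = i}) sums gf q (rank_eq (- int m))"
    by (rule gf_fibers[OF q]) auto
  moreover have "(\<lambda>i. gf q {ps \<in> rank_eq (int m). length ps = i}) sums gf q (rank_eq (int m))"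
    by (rule gf_fibers[OF q]) auto
  moreover have "{ps \<in> rank_eq (- int m). first_part ps = i} = (if i = 0 then {} else cell i (i + m))" for i
    by (auto simp: rank_eq_def cell_def dest: overpartitions_first_part_0)
  moreover have "{ps \<in> rank_eq (int m). length ps = i} = (if i = 0 then {} else cell (i + m) i)" for i
    by (auto simp: rank_eq_def cell_def)
  moreover have "gf q (if i = 0 then {} else cell i (i + m)) = gf q (if i = 0 then {} else cell (i + m) i)" for i
    using gf_cell_commute[OF q] by simp
  ultimately have "(\<lambda>i. gf q (if i = 0 then {} else cell (i + m) i)) sums gf q (rank_eq (- int m))"
    "(\<lambda>i. gf q (if i = 0 then {} else cell (i + m) i)) sums gf q (rank_eq (int m))"
    by (simp_all only:)
  then show ?thesis by (rule sums_unique2)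
qed

lemma gf_rank_eq:
  assumes q: "norm q < 1"
  shows "(\<lambda>k. (-1) ^ k * q ^ ((Suc k)\<^sup>2 + m * Suc k) * (1 - q ^ Suc k) / (1 + q ^ Suc k)) sums
    (gf q (rank_eq (int m)) / (2 * gf q overpartitions))"
proof -
  have "rank_eq (int m) = rank_ge m - rank_ge (Suc m)"
    by (auto simp: rank_eq_def rank_ge_def)
  then have eq: "gf q (rank_eq (int m)) = gf q (rank_ge m) - gf q (rank_ge (Suc m))"
    by (simp add: gf_Diff[OF q] rank_ge_def Collect_mono_iff)
  have split: "q ^ ((Suc k)\<^sup>2 + Suc m * Suc k) = q ^ ((Suc k)\<^sup>2 + m * Suc k) * q ^ Suc k" for k
    by (simp only: power_add[symmetric]) (simp add: ac_simps)
  show ?thesis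
    using sums_diff[OF gf_rank_ge[OF q, of m] gf_rank_ge[OF q, of "Suc m"]]
    unfolding eq diff_divide_distrib[symmetric] split
    by (simp only: right_diff_distrib mult_1_right mult.assoc)
qed

section \<open>Ranks in a residue class and differences of two classes\<close>

definition rank_cong :: "int \<Rightarrow> int \<Rightarrow> (nat \<times> bool) list set" where
  "rank_cong a c = {ps \<in> overpartitions. ps \<noteq> [] \<and> [int (first_part ps) - int (length ps) = a] (mod c)}"

lemma card_rank_cong:
  assumes "n > 0"
  shows "card {ps \<in> rank_cong a c. weight ps = n} = Nbar a c n"
proof -
  have "{ps \<in> rank_cong a c. weight ps = n} = {ps. overpartition n ps \<and> [overpartition_rank ps = a] (mod c)}"
  proof (intro set_eqI)
    fix ps
    have "overpartition n ps \<longleftrightarrow> ps \<in> overpartitions \<and> weight ps = n"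
      by (auto simp: overpartitions_def weight_def overpartition_def)
    moreover have "ps \<noteq> []" if "weight ps = n" using that assms by auto
    ultimately show "ps \<in> {ps \<in> rank_cong a c. weight ps = n} \<longleftrightarrow>
        ps \<in> {ps. overpartition n ps \<and> [overpartition_rank ps = a] (mod c)}"
      using overpartitions_rank[of ps] by (auto simp: rank_cong_def)
  qed
  then show ?thesis by (simp add: Nbar_def)
qed

text \<open>The coefficient at 0 is replaced by 0: the rank of the empty overpartition is
  unspecified, and \<open>rank_cong\<close> leaves that overpartition out.\<close>

lemma Nbar_sums:
  assumes q: "norm q < 1"
  shows "(\<lambda>n. of_nat (if n = 0 then 0 else Nbar a c n) * q ^ n) sums gf q (rank_cong a c)"
proof -
  have "(\<lambda>n. gf q {ps \<in> rank_cong a c. weight ps = n}) sums gf q (rank_cong a c)"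
    by (rule gf_fibers[OF q]) (auto simp: rank_cong_def)
  moreover have "gf q {ps \<in> rank_cong a c. weight ps = n} = of_nat (if n = 0 then 0 else Nbar a c n) * q ^ n" for n
  proof (cases "n = 0")
    case True
    have "ps = []" if "ps \<in> overpartitions" "weight ps = 0" for ps
      using overpartitions_length_le_weight[of ps] that by simp
    then have "{ps \<in> rank_cong a c. weight ps = n} = {}" using True by (auto simp: rank_cong_def)
    then show ?thesis using True by (simp only:) (simp add: gf_def)
  next
    case False
    have "finite {ps \<in> rank_cong a c. weight ps = n}"
      by (rule finite_subset[OF _ finite_overpartitions[of n]]) (auto simp: rank_cong_def overpartitions_def)
    then have "gf q {ps \<in> rank_cong a c. weight ps = n} = (\<Sum>ps\<in>{ps \<in> rank_cong a c. weight ps = n}. q ^ n)"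
      by (simp add: gf_def)
    then show ?thesis using card_rank_cong[of n a c] False by simp
  qed
  ultimately show ?thesis by simp
qed

text \<open>The summation index $k$ stands for $k + 1 \ge 1$ here and in the other series below.\<close>

definition rank_term :: "nat \<Rightarrow> complex \<Rightarrow> nat \<Rightarrow> nat \<Rightarrow> complex" where
  "rank_term c q m k = (-1) ^ k * q ^ ((Suc k)\<^sup>2 + m * Suc k) * (1 - q ^ Suc k)
     / ((1 + q ^ Suc k) * (1 - q ^ (c * Suc k)))"

text \<open>Over the ranks m, m + c, m + 2c, ... the series of \<open>gf_rank_eq\<close> is
  geometric in the progression index; summing over that index first is the origin of the denominator
  1 - q^(c (k + 1)).\<close>

lemma rank_series_residue_class:
  fixes q :: complex
  assumes q: "norm q < 1" and c: "c > 0"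
  shows "(\<lambda>j. gf q (rank_eq (int (m + c * j))) / (2 * gf q overpartitions)) sums
      (\<Sum>k. rank_term c q m k)"
    and "summable (rank_term c q m)"
proof -
  define r where "r = norm q"
  have r: "0 \<le> r" "r < 1" using q by (auto simp: r_def)
  define f where "f = (\<lambda>j k. (-1) ^ k * q ^ ((Suc k)\<^sup>2 + (m + c * j) * Suc k) * (1 - q ^ Suc k) / (1 + q ^ Suc k))"
  have row: "(\<Sum>k. f j k) = gf q (rank_eq (int (m + c * j))) / (2 * gf q overpartitions)" for j
    using gf_rank_eq[OF q, of "m + c * j"] by (simp add: f_def sums_iff)
  have sm: "(\<lambda>(j, k). f j k) summable_on UNIV \<times> UNIV"
  proof (rule summable_on_geometric2_comparison[OF r])
    fix j k
    have "norm (f j k) = r ^ ((Suc k)\<^sup>2 + (m + c * j) * Suc k) * (norm (1 - q ^ Suc k) / norm (1 + q ^ Suc k))"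
      by (simp add: f_def norm_mult norm_divide norm_power r_def)
    also have "\<dots> \<le> r ^ (j + k) * (2 / (1 - r))"
    proof (intro mult_mono power_decreasing frac_le)
      have "j \<le> (m + c * j) * Suc k" using c by (simp add: trans_le_add1 trans_le_add2)
      then show "j + k \<le> (Suc k)\<^sup>2 + (m + c * j) * Suc k"
        by (simp add: power2_eq_square)
      have "norm (q ^ Suc k) \<le> 1" using r by (simp add: norm_power r_def power_le_one del: power_Suc)
      then show "norm (1 - q ^ Suc k) \<le> 2"
        using norm_triangle_ineq4[of 1 "q ^ Suc k"] by simp
      show "1 - r \<le> norm (1 + q ^ Suc k)" unfolding r_def by (rule norm_one_plus_power_ge[OF q])
    qed (use r in auto)
    finally show "norm (f j k) \<le> 2 / (1 - r) * (r ^ j * r ^ k)" by (simp add: power_add mult_ac)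
  qed
  have col: "(\<Sum>j. f j k) = rank_term c q m k" for k
  proof -
    let ?x = "q ^ (c * Suc k)" and ?g = "(-1) ^ k * q ^ ((Suc k)\<^sup>2 + m * Suc k) * (1 - q ^ Suc k) / (1 + q ^ Suc k)"
    have "norm ?x < 1" using q c by (simp add: norm_power power_less_one_iff)
    then have "(\<lambda>j. ?g * ?x ^ j) sums (?g * (1 / (1 - ?x)))"
      by (intro sums_mult geometric_sums)
    moreover have "f j k = ?g * ?x ^ j" for j
    proof -
      have "(Suc k)\<^sup>2 + (m + c * j) * Suc k = (Suc k)\<^sup>2 + m * Suc k + c * Suc k * j"
        by (simp add: algebra_simps)
      then have "q ^ ((Suc k)\<^sup>2 + (m + c * j) * Suc k) = q ^ ((Suc k)\<^sup>2 + m * Suc k) * ?x ^ j"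
        by (simp only: power_add power_mult)
      then show ?thesis by (simp add: f_def)
    qed
    ultimately show ?thesis by (simp add: sums_iff rank_term_def)
  qed
  show "(\<lambda>j. gf q (rank_eq (int (m + c * j))) / (2 * gf q overpartitions)) sums
      (\<Sum>k. rank_term c q m k)"
    using suminf_swap(1)[OF sm] unfolding row col .
  show "summable (rank_term c q m)"
    using suminf_swap(2)[OF sm] unfolding col .
qed

text \<open>The nonnegative ranks in the class form the progression from a, and the negatives of its
  negative ranks form the progression from c - a, to which \<open>gf_rank_eq_uminus\<close>
  applies.\<close>

lemma gf_rank_cong:
  assumes q: "norm q < 1" and a: "a < c"
  shows "gf q (rank_cong (int a) (int c)) = 2 * gf q overpartitions * ((\<Sum>k. rank_term c q a k) + (\<Sum>k. rank_term c q (c - a) k))"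
proof -
  let ?R = "rank_cong (int a) (int c)"
  define \<rho> where "\<rho> = (\<lambda>ps :: (nat \<times> bool) list. int (first_part ps) - int (length ps))"
  have \<rho>: "rank_eq m = {ps \<in> overpartitions. ps \<noteq> [] \<and> \<rho> ps = m}"
      "?R = {ps \<in> overpartitions. ps \<noteq> [] \<and> [\<rho> ps = int a] (mod int c)}" for m
    by (simp_all add: rank_eq_def rank_cong_def \<rho>_def)
  have P0: "gf q overpartitions \<noteq> 0" unfolding gf_overpartitions[OF q] by simp
  have c: "c > 0" using a by simp
  have sub: "?R \<subseteq> overpartitions" by (auto simp: rank_cong_def)
  have split: "gf q ?R = gf q {ps \<in> ?R. \<rho> ps \<ge> 0} + gf q {ps \<in> ?R. \<rho> ps < 0}"
    by (subst gf_Un[OF q, symmetric]) (use sub in \<open>auto intro!: arg_cong[of _ _ "gf q"]\<close>)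
  have pos: "(\<lambda>j. gf q (rank_eq (int (a + c * j)))) sums gf q {ps \<in> ?R. \<rho> ps \<ge> 0}"
  proof -
    have "(\<lambda>j. gf q {ps \<in> {ps \<in> ?R. \<rho> ps \<ge> 0}. nat (\<rho> ps) div c = j}) sums gf q {ps \<in> ?R. \<rho> ps \<ge> 0}"
      by (rule gf_fibers[OF q]) (use sub in auto)
    moreover have "{ps \<in> {ps \<in> ?R. \<rho> ps \<ge> 0}. nat (\<rho> ps) div c = j} = rank_eq (int (a + c * j))" for j
    proof -
      have "x \<ge> 0 \<and> [x = int a] (mod int c) \<and> nat x div c = j \<longleftrightarrow> x = int (a + c * j)" for x :: int
      proof
        assume *: "x \<ge> 0 \<and> [x = int a] (mod int c) \<and> nat x div c = j"
        then obtain n where n: "x = int n" using nonneg_int_cases by blast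
        have "[n = a] (mod c)" using * unfolding n cong_int_iff by simp
        with * n a have "n mod c = a" "n div c = j" by (simp_all add: unique_euclidean_semiring_class.cong_def)
        then show "x = int (a + c * j)" using n by (metis add.commute mult_div_mod_eq)
      next
        assume x: "x = int (a + c * j)"
        have "[a + c * j = a] (mod c)" by (simp add: unique_euclidean_semiring_class.cong_def)
        then have "[x = int a] (mod int c)" using x by (simp only: cong_int_iff)
        then show "x \<ge> 0 \<and> [x = int a] (mod int c) \<and> nat x div c = j"
          using x a by (simp only: nat_int) simp
      qed
      then show ?thesis unfolding \<rho> by blast
    qed
    ultimately show ?thesis by simp
  qed
  have neg: "(\<lambda>j. gf q (rank_eq (- int (c - a + c * j)))) sums gf q {ps \<in> ?R. \<rho> ps < 0}"
  proof -
    have "(\<lambda>j. gf q {ps \<in> {ps \<in> ?R. \<rho> ps < 0}. nat (- \<rho> ps + int a - int c) div c = j}) sums gf q {ps \<in> ?R. \<rho> ps < 0}"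
      by (rule gf_fibers[OF q]) (use sub in auto)
    moreover have "{ps \<in> {ps \<in> ?R. \<rho> ps < 0}. nat (- \<rho> ps + int a - int c) div c = j} = rank_eq (- int (c - a + c * j))" for j
    proof -
      have "x < 0 \<and> [x = int a] (mod int c) \<and> nat (- x + int a - int c) div c = j \<longleftrightarrow> x = - int (c - a + c * j)" for x :: int
      proof
        assume *: "x < 0 \<and> [x = int a] (mod int c) \<and> nat (- x + int a - int c) div c = j"
        then have "int c dvd int a - x"
          by (simp add: cong_iff_dvd_diff dvd_diff_commute)
        then obtain k where k: "int a - x = int c * k" ..
        with * have "int c * k > 0" by linarith
        then have "k > 0" using c by (simp add: zero_less_mult_iff)
        then have "- x + int a - int c = int (c * nat (k - 1))"
          using k by (simp add: algebra_simps)
        then have "nat (- x + int a - int c) = c * nat (k - 1)" by (simp only: nat_int)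
        with * c have "nat (k - 1) = j" by simp
        with \<open>- x + int a - int c = int (c * nat (k - 1))\<close> show "x = - int (c - a + c * j)"
          using a by (simp add: of_nat_diff)
      next
        assume x: "x = - int (c - a + c * j)"
        have "int a - x = int c * (1 + int j)" using a x by (simp add: of_nat_diff algebra_simps)
        then have "[int a = x] (mod int c)" by (simp add: cong_iff_dvd_diff)
        moreover have "- x + int a - int c = int (c * j)" using a x by (simp add: of_nat_diff)
        ultimately show "x < 0 \<and> [x = int a] (mod int c) \<and> nat (- x + int a - int c) div c = j"
          using a x c by (simp add: cong_sym_eq del: of_nat_mult)
      qed
      then show ?thesis unfolding \<rho> by blast
    qed
    ultimately show ?thesis by simp
  qed
  have "gf q {ps \<in> ?R. \<rho> ps \<ge> 0} / (2 * gf q overpartitions) = (\<Sum>k. rank_term c q a k)"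
    using sums_unique2[OF sums_divide[OF pos] rank_series_residue_class(1)[OF q c, of a]] .
  moreover have "gf q {ps \<in> ?R. \<rho> ps < 0} / (2 * gf q overpartitions) = (\<Sum>k. rank_term c q (c - a) k)"
    using sums_unique2[OF sums_divide[OF neg] rank_series_residue_class(1)[OF q c, of "c - a", folded gf_rank_eq_uminus[OF q]]] .
  ultimately show ?thesis using P0 split by (simp add: field_simps)
qed

text \<open>With x = q^(k + 1), the product x^a (1 - x^(b - a)) (1 - x^(c - a - b)) is x^a + x^(c -
  a) - x^b - x^(c - b), the four progressions of the two classes. The factors become hyperbolic
  sines in the symmetric form of the kernel.\<close>

definition theta_term :: "nat \<Rightarrow> nat \<Rightarrow> nat \<Rightarrow> complex \<Rightarrow> nat \<Rightarrow> complex" where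
  "theta_term a b c q k = (-1) ^ k * q ^ ((Suc k)\<^sup>2 + a * Suc k) * (1 - q ^ Suc k) *
     (1 - q ^ ((b - a) * Suc k)) * (1 - q ^ ((c - a - b) * Suc k)) / ((1 + q ^ Suc k) * (1 - q ^ (c * Suc k)))"

lemma Nbar_diff_sums:
  assumes q: "norm q < 1" and ab: "a < b" "2 * b \<le> c"
  shows "(\<lambda>n. of_real (if n = 0 then 0 else real (Nbar (int a) (int c) n) - real (Nbar (int b) (int c) n)) * q ^ n)
    sums (2 * gf q overpartitions * (\<Sum>k. theta_term a b c q k))"
    and "summable (theta_term a b c q)"
proof -
  define s where "s = rank_term c q"
  have c: "c > 0" "a < c" "b < c" using ab by auto
  have sm: "summable (s m)" for m
    unfolding s_def by (rule rank_series_residue_class(2)[OF q c(1)])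
  have "theta_term a b c q k = (s a k + s (c - a) k) - (s b k + s (c - b) k)" for k
  proof -
    define x where "x = q ^ Suc k"
    have e: "q ^ ((Suc k)\<^sup>2 + m * Suc k) = q ^ (Suc k)\<^sup>2 * x ^ m" "q ^ (m * Suc k) = x ^ m" for m
      by (simp_all add: x_def power_add power_mult[symmetric] mult.commute del: power_Suc)
    have "x ^ b = x ^ a * x ^ (b - a)" "x ^ (c - b) = x ^ a * x ^ (c - a - b)"
        "x ^ (c - a) = x ^ a * (x ^ (b - a) * x ^ (c - a - b))"
      using ab by (simp_all flip: power_add)
    then have key: "x ^ a * (1 - x ^ (b - a)) * (1 - x ^ (c - a - b)) = x ^ a + x ^ (c - a) - (x ^ b + x ^ (c - b))"
      by (simp add: algebra_simps)
    let ?u = "(-1) ^ k * q ^ (Suc k)\<^sup>2 * (1 - x)" and ?v = "(1 + x) * (1 - x ^ c)"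
    have "theta_term a b c q k = ?u * (x ^ a * (1 - x ^ (b - a)) * (1 - x ^ (c - a - b))) / ?v"
      unfolding theta_term_def e x_def[symmetric] by (simp only: mult_ac)
    also have "\<dots> = (?u * x ^ a / ?v + ?u * x ^ (c - a) / ?v) - (?u * x ^ b / ?v + ?u * x ^ (c - b) / ?v)"
      unfolding key by (simp only: add_divide_distrib[symmetric] diff_divide_distrib[symmetric] distrib_left right_diff_distrib)
    also have "\<dots> = (s a k + s (c - a) k) - (s b k + s (c - b) k)"
      unfolding s_def rank_term_def e x_def[symmetric] by (simp only: mult_ac)
    finally show ?thesis .
  qed
  then have t: "theta_term a b c q = (\<lambda>k. (s a k + s (c - a) k) - (s b k + s (c - b) k))" by blast
  show "summable (theta_term a b c q)"
    unfolding t by (intro summable_diff summable_add sm)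
  have "(\<Sum>k. theta_term a b c q k) = ((\<Sum>k. s a k) + (\<Sum>k. s (c - a) k)) - ((\<Sum>k. s b k) + (\<Sum>k. s (c - b) k))"
    unfolding t by (simp add: suminf_diff[symmetric] suminf_add[symmetric] summable_add sm)
  then have "2 * gf q overpartitions * (\<Sum>k. theta_term a b c q k) = gf q (rank_cong (int a) (int c)) - gf q (rank_cong (int b) (int c))"
    using gf_rank_cong[OF q c(2)] gf_rank_cong[OF q c(3)] by (simp add: s_def right_diff_distrib)
  moreover have "(\<lambda>n. of_real (if n = 0 then 0 else real (Nbar (int a) (int c) n) - real (Nbar (int b) (int c) n)) * q ^ n) =
      (\<lambda>n. of_nat (if n = 0 then 0 else Nbar (int a) (int c) n) * q ^ n - of_nat (if n = 0 then 0 else Nbar (int b) (int c) n) * q ^ n)"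
    by (auto simp: left_diff_distrib)
  ultimately show "(\<lambda>n. of_real (if n = 0 then 0 else real (Nbar (int a) (int c) n) - real (Nbar (int b) (int c) n)) * q ^ n)
    sums (2 * gf q overpartitions * (\<Sum>k. theta_term a b c q k))"
    using sums_diff[OF Nbar_sums[OF q, of "int a" "int c"] Nbar_sums[OF q, of "int b" "int c"]]
    by simp
qed

section \<open>The logarithm of the generating function of all overpartitions\<close>

definition odd_real :: "nat \<Rightarrow> real" where "odd_real m = real (2 * m + 1)"

text \<open>This is $\log P(e^{-z})$.\<close>

definition log_gf :: "complex \<Rightarrow> complex" where
  "log_gf z = (\<Sum>m. of_real (2 / odd_real m) / (exp (of_real (odd_real m) * z) - 1))"

lemma odd_real_pos [simp]: "odd_real m > 0" "odd_real m \<ge> 0" "odd_real m \<ge> 1" "odd_real m \<noteq> 0" "\<bar>odd_real m\<bar> = odd_real m"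
  by (simp_all add: odd_real_def)

text \<open>Grouping the series for pi^2/6 in pairs separates the odd squares from the even ones,
  and the latter make up a quarter of it. The value is the coefficient of 1/z in the growth of log
  P.\<close>

lemma sums_inverse_odd_squares: "(\<lambda>m. 2 / (odd_real m)\<^sup>2) sums (pi\<^sup>2 / 4)"
proof -
  let ?f = "\<lambda>n. 1 / (real n + 1)\<^sup>2"
  have f: "?f sums (pi\<^sup>2 / 6)" using inverse_squares_sums by (simp add: add.commute)
  have "(\<lambda>n. \<Sum>i = n * 2..<n * 2 + 2. ?f i) sums (pi\<^sup>2 / 6)"
    by (rule sums_group[OF f]) simp
  then have "(\<lambda>n. 1 / (odd_real n)\<^sup>2 + 1 / 4 * ?f n) sums (pi\<^sup>2 / 6)"
    by (simp add: odd_real_def numeral_2_eq_2 power2_eq_square field_simps)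
  from sums_diff[OF this sums_mult[OF f, of "1/4"]]
  have "(\<lambda>n. 1 / (odd_real n)\<^sup>2) sums (pi\<^sup>2 / 8)" by (simp add: field_simps)
  from sums_mult[OF this, of 2] show ?thesis by simp
qed

lemma norm_exp_minus_1_ge_Re:
  assumes "Re w \<ge> 0"
  shows "norm (exp w - 1) \<ge> Re w"
proof -
  have "Re w \<le> exp (Re w) - 1" using exp_ge_add_one_self[of "Re w"] by linarith
  also have "\<dots> = norm (exp w) - norm (1::complex)" by simp
  also have "\<dots> \<le> norm (exp w - 1)" by (rule norm_triangle_ineq2)
  finally show ?thesis .
qed

text \<open>The identity behind it is |e^w - 1|^2 = (e^u - 1)^2 + 4 e^u sin^2 (Im w / 2) with u = Re
  w.\<close>

lemma norm_exp_minus_1_ge_sin: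
  assumes "Re w \<ge> 0"
  shows "norm (exp w - 1) \<ge> 2 * \<bar>sin (Im w / 2)\<bar>"
proof -
  let ?e = "exp (Re w)" and ?s = "sin (Im w / 2)"
  have e: "1 \<le> ?e" using assms by simp
  have c: "cos (Im w) = 1 - 2 * ?s\<^sup>2"
    using cos_double_sin[of "Im w / 2"] by simp
  have alg: "(e * c - 1)\<^sup>2 + (e * s)\<^sup>2 = e\<^sup>2 * (s\<^sup>2 + c\<^sup>2) - 2 * e * c + 1" for e c s :: real
    by (simp add: power2_eq_square algebra_simps)
  have "(norm (exp w - 1))\<^sup>2 = (?e * cos (Im w) - 1)\<^sup>2 + (?e * sin (Im w))\<^sup>2"
    by (simp add: cmod_power2 Re_exp Im_exp)
  also have "\<dots> = ?e\<^sup>2 * ((sin (Im w))\<^sup>2 + (cos (Im w))\<^sup>2) - 2 * ?e * cos (Im w) + 1"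
    by (rule alg)
  also have "\<dots> = (?e - 1)\<^sup>2 + 4 * ?e * ?s\<^sup>2"
    by (simp only: sin_cos_squared_add) (simp add: c power2_eq_square algebra_simps)
  also have "\<dots> \<ge> 0 + 4 * 1 * ?s\<^sup>2"
    using e by (intro add_mono mult_right_mono) auto
  finally have "(2 * \<bar>?s\<bar>)\<^sup>2 \<le> (norm (exp w - 1))\<^sup>2" by (simp add: power_mult_distrib)
  then show ?thesis by (rule power2_le_imp_le) simp
qed

lemma abs_sin_ge_half:
  assumes "\<bar>x\<bar> \<le> pi / 2"
  shows "\<bar>sin x\<bar> \<ge> \<bar>x\<bar> / 2"
proof -
  have *: "x / 2 \<le> sin x" if x: "0 \<le> x" "x \<le> pi / 2" for x :: real
  \<comment> \<open>The derivative cos y - 1/2 is nonnegative only up to pi/3; beyond that point sin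
    x is at least sin (pi/3) > 0.8, which exceeds pi/4.\<close>
  proof (cases "x \<le> pi / 3")
    case True
    have "sin 0 - 0 / 2 \<le> sin x - x / 2"
    proof (rule DERIV_nonneg_imp_nondecreasing[OF x(1)])
      fix y assume y: "0 \<le> y" "y \<le> x"
      have "cos (pi / 3) \<le> cos y" using y True by (intro cos_monotone_0_pi_le) auto
      then show "\<exists>D. ((\<lambda>x. sin x - x / 2) has_real_derivative D) (at y) \<and> 0 \<le> D"
        by (intro exI[of _ "cos y - 1 / 2"] conjI) (auto intro!: derivative_eq_intros simp: cos_60)
    qed
    then show ?thesis by simp
  next
    case False
    have "sin (pi / 3) \<le> sin x" using False x by (intro sin_monotone_2pi_le) auto
    moreover have "1.6 \<le> sqrt 3" by (rule real_le_rsqrt) (simp add: power2_eq_square)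
    ultimately have "0.8 \<le> sin x" by (simp add: sin_60)
    then show ?thesis using x pi_approx by simp
  qed
  show ?thesis
  proof (cases "x \<ge> 0")
    case True
    then show ?thesis using *[of x] assms by auto
  next
    case False
    then show ?thesis using *[of "- x"] assms by auto
  qed
qed

section \<open>Upper bounds for log P away from the real axis\<close>

lemma norm_log_gf_term:
  assumes "Re z > 0"
  shows "norm (of_real (2 / odd_real m) / (exp (of_real (odd_real m) * z) - 1) :: complex) \<le> 2 / (odd_real m)\<^sup>2 / Re z"
    and "exp (of_real (odd_real m) * z) \<noteq> 1"
proof -
  have "odd_real m * Re z \<le> norm (exp (of_real (odd_real m) * z) - 1)"
    using norm_exp_minus_1_ge_Re[of "of_real (odd_real m) * z"] assms by (simp add: less_imp_le)
  moreover have "odd_real m * Re z > 0" using assms by simp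
  ultimately show "norm (of_real (2 / odd_real m) / (exp (of_real (odd_real m) * z) - 1) :: complex) \<le> 2 / (odd_real m)\<^sup>2 / Re z"
    and "exp (of_real (odd_real m) * z) \<noteq> 1"
    using frac_le[of "2 / odd_real m" "2 / odd_real m" "odd_real m * Re z" "norm (exp (of_real (odd_real m) * z) - 1)"]
    by (auto simp: norm_divide norm_mult power2_eq_square divide_divide_eq_left mult.assoc)
qed

lemma summable_log_gf:
  assumes "Re z > 0"
  shows "summable (\<lambda>m. norm (of_real (2 / odd_real m) / (exp (of_real (odd_real m) * z) - 1) :: complex))"
    "summable (\<lambda>m. of_real (2 / odd_real m) / (exp (of_real (odd_real m) * z) - 1) :: complex)"
proof -
  have "summable (\<lambda>m. 2 / (odd_real m)\<^sup>2 / Re z)"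
    using sums_inverse_odd_squares by (intro summable_divide) (rule sums_summable)
  then show s: "summable (\<lambda>m. norm (of_real (2 / odd_real m) / (exp (of_real (odd_real m) * z) - 1) :: complex))"
    by (rule summable_comparison_test'[where N = 0]) (use norm_log_gf_term(1)[OF assms] in simp)
  then show "summable (\<lambda>m. of_real (2 / odd_real m) / (exp (of_real (odd_real m) * z) - 1) :: complex)"
    by (rule summable_norm_cancel)
qed

text \<open>Bounding every term as for real z would only give pi^2 / (4 Re z). For the indices in
  \<open>F\<close> that majorant is exchanged for the actual norm; two well chosen indices suffice
  on the minor arcs.\<close>

lemma Re_log_gf_le_drop:
  assumes z: "Re z > 0" and F: "finite F"
  shows "Re (log_gf z) \<le> pi\<^sup>2 / 4 / Re z - (\<Sum>m\<in>F. 2 / (odd_real m)\<^sup>2 / Re z)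
    + (\<Sum>m\<in>F. 2 / odd_real m / norm (exp (of_real (odd_real m) * z) - 1))"
proof -
  define g where "g = (\<lambda>m. norm (of_real (2 / odd_real m) / (exp (of_real (odd_real m) * z) - 1) :: complex))"
  define u where "u = (\<lambda>m. 2 / (odd_real m)\<^sup>2 / Re z)"
  have u: "u sums (pi\<^sup>2 / 4 / Re z)"
    unfolding u_def by (intro sums_divide sums_inverse_odd_squares)
  have g: "summable g" unfolding g_def by (rule summable_log_gf[OF z])
  have le: "g m \<le> u m" for m unfolding g_def u_def by (rule norm_log_gf_term[OF z])
  have "(\<Sum>m\<in>F. u m - g m) \<le> (\<Sum>m. u m - g m)"
    using F u g le by (intro sum_le_suminf summable_diff) (auto simp: sums_iff)
  also have "\<dots> = pi\<^sup>2 / 4 / Re z - suminf g"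
    using u g by (subst suminf_diff[symmetric]) (auto simp: sums_iff)
  finally have "suminf g \<le> pi\<^sup>2 / 4 / Re z - (\<Sum>m\<in>F. u m) + (\<Sum>m\<in>F. g m)"
    by (simp add: sum_subtractf)
  moreover have "Re (log_gf z) \<le> suminf g"
    using complex_Re_le_cmod[of "log_gf z"] summable_norm[OF summable_log_gf(1)[OF z]]
    unfolding log_gf_def g_def by linarith
  moreover have "(\<Sum>m\<in>F. g m) = (\<Sum>m\<in>F. 2 / odd_real m / norm (exp (of_real (odd_real m) * z) - 1))"
    by (intro sum.cong) (auto simp: g_def norm_divide norm_mult)
  ultimately show ?thesis by (simp add: u_def)
qed

text \<open>All terms are bounded as for real $z$, except the first one and the one for $3\theta$ or $5\theta$:
  away from $\theta = 0$, these two cannot both be close to $2 \pi \mathbb{Z}$.\<close>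

lemma Re_log_gf_minor_arc:
  assumes t: "t > 0" and \<theta>: "100 * t \<le> \<bar>\<theta>\<bar>" "\<bar>\<theta>\<bar> \<le> pi"
  shows "Re (log_gf (Complex t \<theta>)) \<le> 2 / 5 / t + 10"
proof -
  let ?z = "Complex t \<theta>"
  define N where "N k = norm (exp (of_real (odd_real k) * ?z) - 1)" for k
  have N_sin: "2 * \<bar>sin (odd_real k * \<bar>\<theta>\<bar> / 2)\<bar> \<le> N k" for k
    using norm_exp_minus_1_ge_sin[of "of_real (odd_real k) * ?z"] t
    by (cases "\<theta> \<ge> 0") (auto simp: N_def less_imp_le)
  have N_sin': "\<bar>odd_real k * \<bar>\<theta>\<bar> / 2 - real j * pi\<bar> \<le> N k" if "\<bar>odd_real k * \<bar>\<theta>\<bar> / 2 - real j * pi\<bar> \<le> pi / 2" for k j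
  proof -
    have "\<bar>sin (odd_real k * \<bar>\<theta>\<bar> / 2 - real j * pi)\<bar> = \<bar>sin (odd_real k * \<bar>\<theta>\<bar> / 2)\<bar>"
      by (simp add: sin_diff abs_mult)
    then show ?thesis using abs_sin_ge_half[OF that] N_sin[of k] by linarith
  qed
  have odd_real: "odd_real 0 = 1" "odd_real 1 = 3" "odd_real (Suc 0) = 3" "odd_real 2 = 5" by (simp_all add: odd_real_def)
  have pi2: "pi\<^sup>2 \<le> 9.87"
    using power_mono[of pi "3.1415926535899" 2] pi_approx by (simp add: power2_eq_square)
  have bound: "Re (log_gf ?z) \<le> pi\<^sup>2 / 4 / t - (\<Sum>m\<in>F. 2 / (odd_real m)\<^sup>2 / t) + (\<Sum>m\<in>F. 2 / odd_real m / N m)"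
    if "finite F" for F
    using Re_log_gf_le_drop[of ?z F] that t by (simp add: N_def)
  show ?thesis
  proof (cases "\<bar>\<theta>\<bar> \<le> pi / 3")
    case True
    \<comment> \<open>Here both \<open>\<theta>\<close> / 2 and 3 \<open>\<theta>\<close> / 2 stay
      in the range where the sine is comparable to its argument. The two terms cost 1/25 + 1/225 in
      place of 2 + 2/9.\<close>
    have "50 * t \<le> N 0" "150 * t \<le> N 1"
      using N_sin'[of 0 0] N_sin'[of 1 0] True \<theta> t by (auto simp: odd_real)
    then have "2 / 1 / N 0 \<le> 2 / 1 / (50 * t)" "2 / 3 / N 1 \<le> 2 / 3 / (150 * t)"
      using t by (intro divide_left_mono mult_pos_pos; simp)+
    then have "Re (log_gf ?z) \<le> pi\<^sup>2 / 4 / t - (2 / t + 2 / 9 / t) + (2 / 1 / (50 * t) + 2 / 3 / (150 * t))"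
      using bound[of "{0, 1}"] by (simp add: odd_real)
    also have "\<dots> = (pi\<^sup>2 / 4 - 2 - 2 / 9 + 1 / 25 + 1 / 225) / t"
      using t by (simp add: field_simps)
    also have "\<dots> \<le> (2 / 5) / t"
      using pi2 t by (intro divide_right_mono) auto
    finally show ?thesis by simp
  next
    case False
    have N0: "1 / 2 \<le> N 0"
      using N_sin'[of 0 0] False \<theta> pi_approx by (auto simp: odd_real)
    then have 0: "2 / 1 / N 0 \<le> 2 / 1 / (1 / 2)" by (intro divide_left_mono mult_pos_pos) auto
    show ?thesis
    proof (cases "\<bar>\<bar>\<theta>\<bar> - 2 * pi / 3\<bar> \<le> pi / 15")
      case True
      \<comment> \<open>Near 2 pi/3 the term for 3 \<open>\<theta>\<close> can be as large as on the
        real axis, but 5 |\<open>\<theta>\<close>| / 2 - 2 pi lies between -pi/2 and -pi/6. This is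
        the tightest case, with pi^2/4 - 2 - 2/25 just below 2/5.\<close>
      have "1 / 2 \<le> N 2"
        using N_sin'[of 2 2] True False \<theta> pi_approx by (auto simp: odd_real abs_if split: if_splits)
      then have "2 / 5 / N 2 \<le> 2 / 5 / (1 / 2)" by (intro divide_left_mono mult_pos_pos) auto
      with 0 have "Re (log_gf ?z) \<le> pi\<^sup>2 / 4 / t - (2 / t + 2 / 25 / t) + (4 + 4 / 5)"
        using bound[of "{0, 2}"] by (simp add: odd_real)
      also have "\<dots> = (pi\<^sup>2 / 4 - 2 - 2 / 25) / t + (4 + 4 / 5)"
        using t by (simp add: field_simps)
      also have "\<dots> \<le> (2 / 5) / t + 10"
        using pi2 t by (intro add_mono divide_right_mono) auto
      finally show ?thesis by simp
    next
      case far: False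
      \<comment> \<open>A distance of more than pi/15 from 2 pi/3 puts 3 |\<open>\<theta>\<close>| /
        2 at a distance of more than pi/10 from pi.\<close>
      have "3 / 10 \<le> N 1"
        using N_sin'[of 1 1] far False \<theta> pi_approx by (auto simp: odd_real abs_if split: if_splits)
      then have "2 / 3 / N 1 \<le> 2 / 3 / (3 / 10)" by (intro divide_left_mono mult_pos_pos) auto
      with 0 have "Re (log_gf ?z) \<le> pi\<^sup>2 / 4 / t - (2 / t + 2 / 9 / t) + (4 + 20 / 9)"
        using bound[of "{0, 1}"] by (simp add: odd_real)
      also have "\<dots> = (pi\<^sup>2 / 4 - 2 - 2 / 9) / t + (4 + 20 / 9)"
        using t by (simp add: field_simps)
      also have "\<dots> \<le> (2 / 5) / t + 10"
        using pi2 t by (intro add_mono divide_right_mono) auto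
      finally show ?thesis by simp
    qed
  qed
qed

section \<open>The deviation of log P from its leading term\<close>

text \<open>The Bose-Einstein function without its pole at 0. In the series for log P the parts 1/x
  add up to pi^2 / (4z), so the values of \<open>bose\<close> at odd multiples of z describe the
  rest.\<close>

definition bose :: "complex \<Rightarrow> complex" where
  "bose x = 1 / (exp x - 1) - 1 / x"

definition bose' :: "complex \<Rightarrow> complex" where
  "bose' x = 1 / x\<^sup>2 - exp x / (exp x - 1)\<^sup>2"

lemma has_field_derivative_bose:
  assumes "exp x \<noteq> 1"
  shows "(bose has_field_derivative bose' x) (at x)"
proof -
  have "x \<noteq> 0" using assms by auto
  then show ?thesis
    unfolding bose_def[abs_def] bose'_def using assms
    by (auto intro!: derivative_eq_intros simp: power2_eq_square)
qed

text \<open>The singularity at 0 is removable: \<open>bose\<close> is K / G with the entire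
  functions G = (e^x - 1) / x and K = (1 - G) / x. The truncated sector together with 0 is a compact
  set on which G has no zero, so the derivative of K / G is bounded there.\<close>

lemma bose'_bounded_near_0:
  "\<exists>C. \<forall>x. 0 < Re x \<and> Re x \<le> 1 \<and> \<bar>Im x\<bar> \<le> M * Re x \<longrightarrow> norm (bose' x) \<le> C"
proof -
  define G where "G = (\<lambda>x::complex. if x = 0 then 1 else (exp x - 1) / x)"
  have d: "deriv (\<lambda>x. exp x - 1) (0::complex) = 1"
    by (rule DERIV_imp_deriv) (auto intro!: derivative_eq_intros)
  have G: "G holomorphic_on UNIV"
    by (rule pole_theorem_0[of "\<lambda>x. exp x - 1" _ 0]) (auto simp: G_def d intro!: holomorphic_intros)
  define K where "K = (\<lambda>x::complex. if x = 0 then - deriv G 0 else (1 - G x) / x)"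
  have d': "deriv (\<lambda>x. 1 - G x) 0 = - deriv G 0"
  proof (rule DERIV_imp_deriv)
    have "(G has_field_derivative deriv G 0) (at 0)"
      using G holomorphic_derivI[of G UNIV 0] by simp
    then show "((\<lambda>x. 1 - G x) has_field_derivative - deriv G 0) (at 0)"
      by (auto intro!: derivative_eq_intros)
  qed
  have K: "K holomorphic_on UNIV"
    by (rule pole_theorem_0[of "\<lambda>x. 1 - G x" _ 0])
       (auto simp: K_def d' G_def[THEN fun_cong, of 0] intro!: holomorphic_intros G)
  define U where "U = {x. G x \<noteq> 0}"
  define S where "S = {x. 0 \<le> Re x \<and> Re x \<le> 1 \<and> \<bar>Im x\<bar> \<le> M * Re x}"
  have "open U"
  proof -
    have "continuous_on UNIV G" by (rule holomorphic_on_imp_continuous_on[OF G])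
    then have "open (G -` (- {0}))" by (intro open_vimage) auto
    then show ?thesis by (simp add: U_def vimage_def)
  qed
  have hol: "(\<lambda>x. K x / G x) holomorphic_on U"
    by (intro holomorphic_on_divide holomorphic_on_subset[OF K] holomorphic_on_subset[OF G])
       (auto simp: U_def)
  have SU: "S \<subseteq> U"
  proof
    fix x assume x: "x \<in> S"
    show "x \<in> U"
    proof (cases "x = 0")
      case False
      then have "Re x > 0" using x by (cases "Re x = 0") (auto simp: S_def complex_eq_iff)
      then have "exp x - 1 \<noteq> 0" using norm_exp_minus_1_ge_Re[of x] by auto
      then show ?thesis using False by (simp add: U_def G_def)
    qed (simp add: U_def G_def)
  qed
  have "compact S"
  proof (rule compact_eq_bounded_closed[THEN iffD2], rule conjI)
    have eq: "S = {x. 0 \<le> Re x} \<inter> {x. Re x \<le> 1} \<inter> {x. \<bar>Im x\<bar> \<le> M * Re x}"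
      by (auto simp: S_def)
    show "closed S"
      unfolding eq by (intro closed_Int closed_Collect_le continuous_intros)
    have "norm x \<le> 1 + \<bar>M\<bar>" if "x \<in> S" for x
    proof -
      have "norm x \<le> \<bar>Re x\<bar> + \<bar>Im x\<bar>" by (rule cmod_le)
      also have "\<bar>Im x\<bar> \<le> \<bar>M\<bar> * 1"
        using that mult_mono[OF abs_ge_self[of M], of "Re x" 1] by (auto simp: S_def)
      finally show ?thesis using that by (auto simp: S_def)
    qed
    then show "bounded S" by (auto simp: bounded_iff)
  qed
  moreover have "continuous_on S (deriv (\<lambda>x. K x / G x))"
    by (intro holomorphic_on_imp_continuous_on holomorphic_on_subset[OF holomorphic_deriv[OF hol \<open>open U\<close>] SU])
  ultimately have "bounded (deriv (\<lambda>x. K x / G x) ` S)"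
    by (intro compact_imp_bounded compact_continuous_image)
  then obtain C where C: "\<And>x. x \<in> S \<Longrightarrow> norm (deriv (\<lambda>x. K x / G x) x) \<le> C"
    by (auto simp: bounded_iff)
  have "norm (bose' x) \<le> C" if x: "0 < Re x" "Re x \<le> 1" "\<bar>Im x\<bar> \<le> M * Re x" for x
  proof -
    have e: "exp x \<noteq> 1" using norm_exp_minus_1_ge_Re[of x] x by auto
    have eq: "K y / G y = bose y" if "Re y > 0" for y
    proof -
      have "exp y - 1 \<noteq> 0" "y \<noteq> 0" using norm_exp_minus_1_ge_Re[of y] that by auto
      then show ?thesis by (simp add: K_def G_def bose_def field_simps)
    qed
    have "((\<lambda>x. K x / G x) has_field_derivative bose' x) (at x)"
    proof (rule has_field_derivative_transform_within_open[OF has_field_derivative_bose[OF e]])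
      show "open {y. Re y > 0}" by (rule open_halfspace_Re_gt)
    qed (use x eq in auto)
    then have "deriv (\<lambda>x. K x / G x) x = bose' x" by (rule DERIV_imp_deriv)
    then show ?thesis using C[of x] x by (simp add: S_def)
  qed
  then show ?thesis by blast
qed

text \<open>e^x / (e^x - 1)^2 is 1 / (2 sinh (x/2))^2, and 2 |sinh (x/2)| is at least 2 sinh (Re x /
  2), hence at least Re x.\<close>

lemma norm_bose'_le_inverse_square:
  assumes "Re x > 0"
  shows "norm (bose' x) \<le> 2 / (Re x)\<^sup>2"
proof -
  have "norm (exp x / (exp x - 1)\<^sup>2) = 1 / (norm (exp (x / 2) - exp (- (x / 2))))\<^sup>2"
  proof -
    have "exp x - 1 = exp (x / 2) * (exp (x / 2) - exp (- (x / 2)))"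
      by (simp add: right_diff_distrib flip: exp_add)
    then have "(exp x - 1)\<^sup>2 = exp x * (exp (x / 2) - exp (- (x / 2)))\<^sup>2"
      by (simp add: power_mult_distrib power2_eq_square flip: exp_add)
    then show ?thesis by (simp add: norm_divide norm_power)
  qed
  also have "\<dots> \<le> 1 / (Re x)\<^sup>2"
  proof (intro divide_left_mono power_mono mult_pos_pos zero_less_power)
    have "Re x \<le> exp (Re x / 2) - exp (- (Re x / 2))"
      using exp_ge_add_one_self[of "Re x / 2"] assms
        real_le_x_sinh[of "Re x / 2"] by (simp add: sinh_def exp_minus)
    also have "\<dots> = norm (exp (x / 2)) - norm (exp (- (x / 2)))" by simp
    also have "\<dots> \<le> norm (exp (x / 2) - exp (- (x / 2)))" by (rule norm_triangle_ineq2)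
    finally show "Re x \<le> norm (exp (x / 2) - exp (- (x / 2)))" .
    then show "0 < norm (exp (x / 2) - exp (- (x / 2)))" using assms by linarith
  qed (use assms in auto)
  finally have 1: "norm (exp x / (exp x - 1)\<^sup>2) \<le> 1 / (Re x)\<^sup>2" .
  have "norm (1 / x\<^sup>2) = 1 / (norm x)\<^sup>2" by (simp add: norm_divide norm_power)
  also have "\<dots> \<le> 1 / (Re x)\<^sup>2"
    using assms complex_Re_le_cmod[of x] by (intro divide_left_mono power_mono mult_pos_pos zero_less_power) auto
  finally show ?thesis
    unfolding bose'_def using 1 norm_triangle_ineq4[of "1 / x\<^sup>2" "exp x / (exp x - 1)\<^sup>2"] by simp
qed

text \<open>Boundedness near 0 and quadratic decay in one estimate; this shape allows a sum over all
  odd multiples of z to be bounded uniformly in Re z.\<close>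

lemma bose'_sector_bound:
  "\<exists>C\<ge>0. \<forall>x. 0 < Re x \<and> \<bar>Im x\<bar> \<le> M * Re x \<longrightarrow> norm (bose' x) \<le> C / (1 + Re x)\<^sup>2"
proof -
  obtain C where C: "\<And>x. 0 < Re x \<Longrightarrow> Re x \<le> 1 \<Longrightarrow> \<bar>Im x\<bar> \<le> M * Re x \<Longrightarrow> norm (bose' x) \<le> C"
    using bose'_bounded_near_0[of M] by blast
  have "norm (bose' x) \<le> (4 * \<bar>C\<bar> + 8) / (1 + Re x)\<^sup>2" if x: "0 < Re x" "\<bar>Im x\<bar> \<le> M * Re x" for x
  proof (cases "Re x \<le> 1")
    case True
    have "norm (bose' x) * (1 + Re x)\<^sup>2 \<le> \<bar>C\<bar> * (1 + 1)\<^sup>2"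
      using C[OF x(1) True x(2)] x True by (intro mult_mono power_mono) auto
    then show ?thesis using x by (simp add: pos_le_divide_eq)
  next
    case False
    have "norm (bose' x) \<le> 2 / (Re x)\<^sup>2" by (rule norm_bose'_le_inverse_square[OF x(1)])
    also have "\<dots> = 8 / (2 * Re x)\<^sup>2" by (simp add: power2_eq_square)
    also have "\<dots> \<le> (4 * \<bar>C\<bar> + 8) / (1 + Re x)\<^sup>2"
      using False by (intro frac_le power_mono) auto
    finally show ?thesis .
  qed
  then show ?thesis by (intro exI[of _ "4 * \<bar>C\<bar> + 8"]) auto
qed

lemma log_gf_bose_sums:
  assumes z: "Re z > 0"
  shows "(\<lambda>m. of_real (2 / odd_real m) * bose (of_real (odd_real m) * z)) sums (log_gf z - of_real (pi\<^sup>2 / 4) / z)"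
proof -
  have "z \<noteq> 0" using z by auto
  have "(\<lambda>m. of_real (2 / (odd_real m)\<^sup>2) / z) sums (of_real (pi\<^sup>2 / 4) / z)"
    by (intro sums_divide sums_of_real sums_inverse_odd_squares)
  moreover have "(\<lambda>m. of_real (2 / odd_real m) / (exp (of_real (odd_real m) * z) - 1)) sums log_gf z"
    unfolding log_gf_def by (rule summable_sums[OF summable_log_gf(2)[OF z]])
  ultimately have "(\<lambda>m. of_real (2 / odd_real m) / (exp (of_real (odd_real m) * z) - 1) - of_real (2 / (odd_real m)\<^sup>2) / z) sums
      (log_gf z - of_real (pi\<^sup>2 / 4) / z)"
    by (rule sums_diff[rotated])
  moreover have "of_real (2 / odd_real m) / (exp (of_real (odd_real m) * z) - 1) - of_real (2 / (odd_real m)\<^sup>2) / z =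
      of_real (2 / odd_real m) * bose (of_real (odd_real m) * z)" for m
    using \<open>z \<noteq> 0\<close> by (simp add: bose_def right_diff_distrib power2_eq_square)
  ultimately show ?thesis by simp
qed

text \<open>Knowing how $P(e^{-z}) e^{-\pi^2/(4z)}$ varies along a vertical line, relative to its positive value
  at the real point, makes the modular transformation of $P$ unnecessary.\<close>

lemma log_gf_variation:
  "\<exists>C\<ge>0. \<forall>t v. t > 0 \<and> \<bar>v\<bar> \<le> M \<longrightarrow>
     norm ((log_gf (Complex t (t * v)) - of_real (pi\<^sup>2 / 4) / Complex t (t * v)) -
           (log_gf (of_real t) - of_real (pi\<^sup>2 / 4) / of_real t)) \<le> C * \<bar>v\<bar>"
proof -
  obtain C where C: "C \<ge> 0" "\<And>x. 0 < Re x \<Longrightarrow> \<bar>Im x\<bar> \<le> M * Re x \<Longrightarrow> norm (bose' x) \<le> C / (1 + Re x)\<^sup>2"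
    using bose'_sector_bound[of M] by blast
  have "norm ((log_gf (Complex t (t * v)) - of_real (pi\<^sup>2 / 4) / Complex t (t * v)) -
           (log_gf (of_real t) - of_real (pi\<^sup>2 / 4) / of_real t)) \<le> 2 * C * \<bar>v\<bar>"
    if t: "t > 0" and v: "\<bar>v\<bar> \<le> M" for t v
  proof -
    let ?z = "Complex t (t * v)"
    let ?d = "\<lambda>m. of_real (2 / odd_real m) * bose (of_real (odd_real m) * ?z) - of_real (2 / odd_real m) * bose (of_real (odd_real m) * of_real t)"
    have s: "?d sums ((log_gf ?z - of_real (pi\<^sup>2 / 4) / ?z) - (log_gf (of_real t) - of_real (pi\<^sup>2 / 4) / of_real t))"
      using t by (intro sums_diff log_gf_bose_sums) auto
    \<comment> \<open>The terms t / (1 + k t)^2 form a kind of Riemann sum for the integral of (1 +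
      x)^(-2). Since k = 2m + 1 is at least m + 1, each is dominated by
      \<open>T m - T (Suc m)\<close>, and the telescoping sum is 1 whatever t is.\<close>
    define T where "T = (\<lambda>m. 1 / (1 + real m * t))"
    have le: "norm (?d m) \<le> 2 * C * \<bar>v\<bar> * (T m - T (Suc m))" for m
    proof -
      define k where "k = odd_real m"
      have k: "k \<ge> 1" by (simp add: k_def)
      let ?S = "closed_segment (of_real k * of_real t) (of_real k * ?z)"
      have inS: "Re x = k * t \<and> \<bar>Im x\<bar> \<le> M * Re x" if "x \<in> ?S" for x
      proof -
        have "\<exists>u. 0 \<le> u \<and> u \<le> 1 \<and> x = (1 - u) *\<^sub>R (of_real k * of_real t) + u *\<^sub>R (of_real k * ?z)"
          using that by (simp only: in_segment)
        then obtain u where u: "0 \<le> u" "u \<le> 1" "x = (1 - u) *\<^sub>R (of_real k * of_real t) + u *\<^sub>R (of_real k * ?z)"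
          by (elim exE conjE)
        have "Re x = k * t" "Im x = u * (k * t * v)" unfolding u(3) by (simp_all add: algebra_simps)
        moreover have "\<bar>u * (k * t * v)\<bar> \<le> 1 * (k * t * M)"
          unfolding abs_mult using u k t v by (intro mult_mono) auto
        ultimately show ?thesis by (simp add: mult_ac)
      qed
      have "norm (bose (of_real k * ?z) - bose (of_real k * of_real t)) \<le>
          C / (1 + k * t)\<^sup>2 * norm (of_real k * ?z - of_real k * of_real t)"
      proof (rule field_differentiable_bound[of ?S bose bose'])
        fix x assume x: "x \<in> ?S"
        have Re: "Re x > 0" using inS[OF x] k t by simp
        then have "exp x \<noteq> 1" using norm_exp_minus_1_ge_Re[of x] by auto
        then show "(bose has_field_derivative bose' x) (at x within ?S)"
          by (rule has_field_derivative_at_within[OF has_field_derivative_bose])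
        show "norm (bose' x) \<le> C / (1 + k * t)\<^sup>2" using C(2)[of x] Re inS[OF x] by auto
      qed auto
      also have "norm (of_real k * ?z - of_real k * of_real t) = k * t * \<bar>v\<bar>"
      proof -
        have "of_real k * ?z - of_real k * of_real t = of_real (k * t * v) * \<i>"
          by (simp add: complex_eq_iff)
        then show ?thesis using k t by (simp add: norm_mult abs_mult)
      qed
      finally have 1: "norm (bose (of_real k * ?z) - bose (of_real k * of_real t)) \<le> C / (1 + k * t)\<^sup>2 * (k * t * \<bar>v\<bar>)" .
      have "norm (?d m) = 2 / k * norm (bose (of_real k * ?z) - bose (of_real k * of_real t))"
        unfolding right_diff_distrib[symmetric] norm_mult k_def[symmetric] norm_of_real using k by simp
      also have "\<dots> \<le> 2 / k * (C / (1 + k * t)\<^sup>2 * (k * t * \<bar>v\<bar>))"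
        using k by (intro mult_left_mono 1) auto
      also have "\<dots> = 2 * C * \<bar>v\<bar> * (t / (1 + k * t)\<^sup>2)"
        using k by simp
      also have "t / (1 + k * t)\<^sup>2 \<le> t / ((1 + real m * t) * (1 + real (Suc m) * t))"
        unfolding power2_eq_square using t by (intro divide_left_mono mult_mono mult_pos_pos)
          (auto simp: k_def odd_real_def intro!: add_pos_nonneg)
      also have "\<dots> = T m - T (Suc m)"
      proof -
        have "1 + real m * t > 0" "1 + real (Suc m) * t > 0" using t by (auto intro!: add_pos_nonneg)
        then show ?thesis unfolding T_def by (simp add: field_simps)
      qed
      finally show ?thesis using C(1) by (simp add: mult_left_mono)
    qed
    have "T \<longlonglongrightarrow> 0" unfolding T_def using t by real_asymp
    then have "(\<lambda>m. T m - T (Suc m)) sums (T 0 - 0)" by (rule telescope_sums')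
    then have Ts: "(\<lambda>m. 2 * C * \<bar>v\<bar> * (T m - T (Suc m))) sums (2 * C * \<bar>v\<bar>)"
      using sums_mult[of _ 1 "2 * C * \<bar>v\<bar>"] by (simp add: T_def)
    have "norm (suminf ?d) \<le> (\<Sum>m. 2 * C * \<bar>v\<bar> * (T m - T (Suc m)))"
      using le Ts by (intro norm_suminf_le) (auto simp: sums_iff)
    then show ?thesis using s Ts by (simp add: sums_iff)
  qed
  then show ?thesis using C(1) by (intro exI[of _ "2 * C"]) auto
qed

text \<open>Used to measure the minor arcs against P(e^{-t}), where a loss of order 1 / sqrt t in
  the exponent is harmless. The bound |bose x| <= 1 / sqrt x on the positive axis makes the series
  converge like the sum of k^(-3/2).\<close>

lemma Re_log_gf_real_ge: "\<exists>C. \<forall>t>0. Re (log_gf (of_real t)) \<ge> pi\<^sup>2 / 4 / t - C / sqrt t"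
proof -
  let ?K = "\<Sum>m. 2 * odd_real m powr (- 3 / 2)"
  have sm: "summable (\<lambda>m. 2 * odd_real m powr (- 3 / 2))"
  proof (rule summable_mult, rule summable_comparison_test')
    show "summable (\<lambda>m. real (Suc m) powr (- 3 / 2))"
      by (subst summable_Suc_iff) (simp add: summable_real_powr_iff)
    show "norm (odd_real m powr (- 3 / 2)) \<le> real (Suc m) powr (- 3 / 2)" if "m \<ge> 0" for m
      by (simp add: odd_real_def powr_mono2')
  qed
  have "Re (log_gf (of_real t)) \<ge> pi\<^sup>2 / 4 / t - ?K / sqrt t" if t: "t > 0" for t
  proof -
    let ?f = "\<lambda>m. of_real (2 / odd_real m) * bose (of_real (odd_real m) * of_real t)"
    have s: "?f sums (log_gf (of_real t) - of_real (pi\<^sup>2 / 4) / of_real t)"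
      using t by (intro log_gf_bose_sums) auto
    have le: "norm (?f m) \<le> 2 * odd_real m powr (- 3 / 2) / sqrt t" for m
    proof -
      define x where "x = odd_real m * t"
      have x: "x > 0" using t by (simp add: x_def)
      have e: "x \<le> exp x - 1" "exp x - 1 > 0" using x exp_ge_add_one_self[of x] by linarith+
      have "bose (of_real x) = of_real (1 / (exp x - 1) - 1 / x)"
        by (simp add: bose_def exp_of_real)
      moreover have "1 / (exp x - 1) \<le> 1 / x" using e x by (intro divide_left_mono) auto
      moreover have "1 / (exp x - 1) \<ge> 1 / x - 1"
      proof -
        have "1 - x \<le> exp (- x)" using exp_ge_add_one_self[of "- x"] by simp
        then have "(1 - x) * exp x \<le> 1" by (simp add: exp_minus field_simps)
        then have "exp x - 1 \<le> x * exp x" by (simp add: algebra_simps)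
        then have "(1 - x) * (exp x - 1) \<le> x" by (simp add: algebra_simps)
        then have "(1 - x) / x \<le> 1 / (exp x - 1)" using x e by (simp add: field_simps)
        then show ?thesis using x by (simp add: diff_divide_distrib)
      qed
      moreover have "1 / (exp x - 1) > 0" using e by simp
      ultimately have b: "norm (bose (of_real x)) \<le> min 1 (1 / x)"
        by (simp del: of_real_diff of_real_divide)
      also have "\<dots> \<le> 1 / sqrt x"
      proof (cases "x \<le> 1")
        case True
        then have "sqrt x \<le> 1" "sqrt x > 0" using x by auto
        then show ?thesis by (simp add: min_le_iff_disj)
      next
        case False
        then have "1 * sqrt x \<le> sqrt x * sqrt x" by (intro mult_right_mono) auto
        then have "1 / x \<le> 1 / sqrt x" using x by (intro divide_left_mono) auto
        then show ?thesis by (simp add: min_le_iff_disj)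
      qed
      finally have "norm (?f m) \<le> 2 / odd_real m * (1 / sqrt x)"
        unfolding norm_mult norm_of_real by (intro mult_mono) (simp_all add: x_def)
      also have "\<dots> = 2 * odd_real m powr (- 3 / 2) / sqrt t"
      proof -
        have "odd_real m powr (- 3 / 2) = 1 / (odd_real m * sqrt (odd_real m))"
          using powr_add[of "odd_real m" "-1" "-1/2"] by (simp add: powr_minus powr_half_sqrt field_simps)
        then show ?thesis by (simp add: x_def real_sqrt_mult)
      qed
      finally show ?thesis .
    qed
    have "norm (suminf ?f) \<le> (\<Sum>m. 2 * odd_real m powr (- 3 / 2) / sqrt t)"
      using le sm by (intro norm_suminf_le summable_divide) auto
    also have "\<dots> = ?K / sqrt t" by (rule suminf_divide[OF sm])
    finally have "norm (log_gf (of_real t) - of_real (pi\<^sup>2 / 4) / of_real t) \<le> ?K / sqrt t"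
      using s by (simp add: sums_iff)
    then have "\<bar>Re (log_gf (of_real t) - of_real (pi\<^sup>2 / 4 / t))\<bar> \<le> ?K / sqrt t"
      using abs_Re_le_cmod order_trans by (metis of_real_divide)
    then show ?thesis by (simp del: of_real_divide)
  qed
  then show ?thesis by blast
qed

section \<open>The alternating sum near $q = 1$\<close>

text \<open>In the application d = b - a and e = c - a - b. The relation between the parameters is
  what makes the kernel even.\<close>

locale rank_kernel =
  fixes a d e c :: nat
  assumes sum: "2 * a + d + e = c" and d: "d \<ge> 1" and e: "e \<ge> 1" and c: "c \<ge> 7"
begin

definition den :: "complex \<Rightarrow> complex" where
  "den x = (1 + exp (- x)) * (\<Sum>j<c. exp (- x) ^ j)"

definition num :: "complex \<Rightarrow> complex" where
  "num x = exp (- x) ^ a * (1 - exp (- x) ^ d) * (1 - exp (- x) ^ e)"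

text \<open>
  Equivalently, $2 \tanh(x/2) \sinh(dx/2) \sinh(ex/2) / \sinh(cx/2)$ by $2a + d + e = c$. In the form
  below the singularity at $0$ is removed and the bound for $\Re x \to \infty$ is visible.
\<close>

definition kern :: "complex \<Rightarrow> complex" where
  "kern x = num x / den x"

lemma geometric: "(1 - x) * (\<Sum>j<c. x ^ j) = 1 - (x::complex) ^ c"
  using one_diff_power_eq[of x c] by simp

text \<open>Both numerator and denominator change by the factor X^c with X = e^{-x}: the numerator
  by 2a + d + e = c, the denominator by reversal of the geometric sum. Evenness makes the later
  integrand odd, so that its residues at opposite points agree.\<close>

lemma kern_uminus: "kern (- x) = kern x"
proof -
  let ?X = "exp (- x)" and ?Y = "exp x"
  have XY: "?X * ?Y = 1" by (simp add: exp_minus)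
  have pow: "?X ^ n * ?Y ^ n = 1" for n by (simp flip: power_mult_distrib add: XY)
  have sumrev: "(\<Sum>j<c. ?X ^ j) = ?X ^ (c - 1) * (\<Sum>j<c. ?Y ^ j)"
  proof -
    have "(\<Sum>j<c. ?X ^ j) = (\<Sum>j<c. ?X ^ (c - Suc j))"
      by (rule sum.nat_diff_reindex[symmetric])
    also have "\<dots> = (\<Sum>j<c. ?X ^ (c - 1) * ?Y ^ j)"
    proof (rule sum.cong)
      fix j assume "j \<in> {..<c}"
      then have "?X ^ (c - 1) = ?X ^ (c - Suc j) * ?X ^ j" by (simp flip: power_add)
      then show "?X ^ (c - Suc j) = ?X ^ (c - 1) * ?Y ^ j" using pow[of j] by (simp add: mult.assoc)
    qed simp
    finally show ?thesis by (simp add: sum_distrib_left)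
  qed
  have cs: "c = a + a + d + e" using sum by simp
  have f: "1 - ?X ^ n = - (?X ^ n * (1 - ?Y ^ n))" for n
    using pow[of n] by (simp add: algebra_simps)
  have "1 + ?X = ?X * (1 + ?Y)" using XY by (simp add: algebra_simps)
  then have "den x = ?X * (1 + ?Y) * (?X ^ (c - 1) * (\<Sum>j<c. ?Y ^ j))"
    by (simp only: den_def sumrev)
  also have "\<dots> = ?X ^ c * den (- x)"
  proof -
    have "?X ^ c = ?X * ?X ^ (c - 1)" using c by (simp flip: power_Suc)
    then show ?thesis by (simp add: den_def mult_ac)
  qed
  finally have den: "den x = ?X ^ c * den (- x)" .
  have "?X ^ c * num (- x) = ?X ^ a * (?X ^ a * ?Y ^ a) * (?X ^ d * (1 - ?Y ^ d)) * (?X ^ e * (1 - ?Y ^ e))"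
    unfolding num_def by (subst cs) (simp only: power_add mult_ac minus_minus)
  also have "\<dots> = num x"
    unfolding pow num_def f[of d] f[of e] by simp
  finally have "num x = ?X ^ c * num (- x)" ..
  then show ?thesis unfolding kern_def den by simp
qed

lemma kern_0 [simp]: "kern 0 = 0"
  using d by (simp add: kern_def num_def)

text \<open>All zeros lie on the imaginary axis, at odd multiples of pi i and at those multiples of
  2 pi i/c that are not multiples of 2 pi i. By c >= 7, pi exceeds 4 pi/c, so below that height only
  2 pi/c remains.\<close>

lemma den_nonzero:
  assumes "Re x \<noteq> 0 \<or> (\<bar>Im x\<bar> < 4 * pi / c \<and> \<bar>Im x\<bar> \<noteq> 2 * pi / c)"
  shows "den x \<noteq> 0"
proof
  assume "den x = 0"
  then consider "exp (- x) = -1" | "(\<Sum>j<c. exp (- x) ^ j) = 0"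
    by (auto simp: den_def add_eq_0_iff)
  then show False
  proof cases
    case 1
    then have "norm (exp (- x)) = 1" by simp
    then have Re: "Re x = 0" by simp
    have "cos (Im x) = -1" using arg_cong[OF 1, of Re] Re by (simp add: Re_exp)
    moreover have "\<bar>Im x\<bar> < pi"
    proof -
      have "4 * pi / c \<le> 4 * pi / 7" using c by (intro divide_left_mono) auto
      then show ?thesis using assms Re by auto
    qed
    then have "cos pi < cos \<bar>Im x\<bar>" by (intro cos_monotone_0_pi) auto
    ultimately show False by simp
  next
    case 2
    then have X: "exp (- x) ^ c = 1" using geometric[of "exp (- x)"] by simp
    then have "norm (exp (- x)) ^ c = 1" by (metis norm_one norm_power)
    then have "norm (exp (- x)) = 1"
      using c power_eq_imp_eq_base[of "norm (exp (- x))" c 1] by simp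
    then have Re: "Re x = 0" by simp
    have "exp (of_nat c * (- x)) = 1" using X by (simp only: exp_of_nat_mult)
    then obtain n :: int where "Im (of_nat c * (- x)) = of_int (2 * n) * pi"
      by (auto simp: exp_eq_1)
    then have "- (Im x * c) = 2 * pi * n" by (simp add: mult_ac)
    then have n: "Im x * c = - (2 * pi * n)" by linarith
    have "\<bar>Im x\<bar> * c = \<bar>Im x * c\<bar>" by (simp add: abs_mult)
    also have "\<dots> = \<bar>2 * pi * n\<bar>" unfolding n by (rule abs_minus_cancel)
    also have "\<dots> = 2 * pi * \<bar>n\<bar>" by (simp add: abs_mult)
    finally have "\<bar>Im x\<bar> * c = 2 * pi * \<bar>n\<bar>" .
    then have Im: "\<bar>Im x\<bar> = 2 * pi * \<bar>n\<bar> / c" using c by (simp add: field_simps)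
    then have "2 * pi * \<bar>n\<bar> / c < 4 * pi / c" using assms Re by auto
    then have "real_of_int \<bar>n\<bar> < 2" using c by (simp add: divide_less_cancel)
    then have "\<bar>n\<bar> = 0 \<or> \<bar>n\<bar> = 1" by linarith
    then show False
    proof
      assume "\<bar>n\<bar> = 0"
      then have "x = 0" using Im Re by (simp add: complex_eq_iff)
      with 2 c show False by simp
    next
      assume "\<bar>n\<bar> = 1"
      then show False using Im assms Re by simp
    qed
  qed
qed

lemma kern_bounded_right:
  assumes "Re x \<ge> 1"
  shows "norm (kern x) \<le> 32"
proof -
  let ?X = "exp (- x)"
  define r where "r = norm ?X"
  have r: "0 \<le> r" "r \<le> 1 / 2"
  proof -
    have "r = exp (- Re x)" by (simp add: r_def)
    also have "\<dots> \<le> exp (- 1)" using assms by simp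
    also have "\<dots> \<le> 1 / 2" using exp_ge_add_one_self[of 1] by (simp add: exp_minus field_simps)
    finally show "r \<le> 1 / 2" .
  qed (simp add: r_def)
  have p: "norm (?X ^ n) \<le> 1" for n
    unfolding norm_power r_def[symmetric] using r by (intro power_le_one) auto
  have m: "norm (1 - ?X ^ n) \<le> 2" for n
    using p[of n] norm_triangle_ineq4[of 1 "?X ^ n"] by simp
  have "norm (num x) \<le> 1 * 2 * 2"
    unfolding num_def norm_mult by (intro mult_mono p m) auto
  moreover have "norm (den x) \<ge> 1 / 8"
  proof -
    have 1: "norm (1 + ?X) \<ge> 1 / 2"
      using norm_triangle_ineq2[of 1 "- ?X"] r by (simp add: r_def)
    have "norm (?X ^ c) \<le> 1 / 2"
      unfolding norm_power r_def[symmetric] using power_decreasing[of 1 c r] r c by simp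
    then have "1 / 2 \<le> norm (1 - ?X ^ c)" using norm_triangle_ineq2[of 1 "?X ^ c"] by simp
    also have "\<dots> = norm (1 - ?X) * norm (\<Sum>j<c. ?X ^ j)" by (simp only: geometric[symmetric] norm_mult)
    also have "\<dots> \<le> 2 * norm (\<Sum>j<c. ?X ^ j)" using m[of 1] by (intro mult_right_mono) auto
    finally have "1 / 4 \<le> norm (\<Sum>j<c. ?X ^ j)" by simp
    with 1 have "1 / 2 * (1 / 4) \<le> norm (den x)"
      unfolding den_def norm_mult by (intro mult_mono) auto
    then show ?thesis by simp
  qed
  ultimately have "norm (num x) / norm (den x) \<le> 4 / (1 / 8)" by (intro frac_le) auto
  then show ?thesis by (simp add: kern_def norm_divide)
qed

lemma continuous_on_num: "continuous_on S num" and continuous_on_den: "continuous_on S den"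
  unfolding num_def[abs_def] den_def[abs_def] by (intro continuous_intros)+

lemma holomorphic_num: "num holomorphic_on S" and holomorphic_den: "den holomorphic_on S"
  unfolding num_def[abs_def] den_def[abs_def] by (intro holomorphic_intros)+

text \<open>The double cone meets the imaginary axis only at 3 pi i/c, between two poles. It
  contains the images under w \<mapsto> w z of the horizontal contour for all slopes |v| <= M, so
  \<open>B\<close> serves every t.\<close>

lemma kern_bounded_line:
  "\<exists>B\<ge>0. \<forall>x. \<bar>Im x - 3 * pi / c\<bar> \<le> M * \<bar>Re x\<bar> \<longrightarrow> norm (kern x) \<le> B"
proof -
  define S where "S = {x. \<bar>Re x\<bar> \<le> 1} \<inter> {x. \<bar>Im x - 3 * pi / c\<bar> \<le> M * \<bar>Re x\<bar>}"
  have "compact S"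
  proof (rule compact_eq_bounded_closed[THEN iffD2], rule conjI)
    show "closed S" unfolding S_def by (intro closed_Int closed_Collect_le continuous_intros)
    have "norm x \<le> 1 + (\<bar>M\<bar> + \<bar>3 * pi / c\<bar>)" if "x \<in> S" for x
    proof -
      have "norm x \<le> \<bar>Re x\<bar> + \<bar>Im x\<bar>" by (rule cmod_le)
      moreover have "M * \<bar>Re x\<bar> \<le> \<bar>M\<bar> * 1" using that by (intro mult_mono) (auto simp: S_def)
      moreover have "\<bar>Im x\<bar> \<le> \<bar>Im x - 3 * pi / c\<bar> + \<bar>3 * pi / c\<bar>" by linarith
      moreover have "\<bar>Re x\<bar> \<le> 1" "\<bar>Im x - 3 * pi / c\<bar> \<le> M * \<bar>Re x\<bar>" using that by (auto simp: S_def)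
      ultimately show ?thesis by linarith
    qed
    then show "bounded S" by (auto simp: bounded_iff)
  qed
  moreover have "continuous_on S kern"
    unfolding kern_def[abs_def]
  proof (intro continuous_on_divide continuous_on_num continuous_on_den ballI den_nonzero)
    fix x assume x: "x \<in> S"
    show "Re x \<noteq> 0 \<or> (\<bar>Im x\<bar> < 4 * pi / c \<and> \<bar>Im x\<bar> \<noteq> 2 * pi / c)"
    proof (cases "Re x = 0")
      case True
      then have "Im x = 3 * pi / c" using x by (simp add: S_def)
      then show ?thesis using c by (simp add: divide_strict_right_mono)
    qed simp
  qed
  ultimately have "bounded (kern ` S)" by (intro compact_imp_bounded compact_continuous_image)
  then obtain B where B: "\<And>x. x \<in> S \<Longrightarrow> norm (kern x) \<le> B" by (auto simp: bounded_iff)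
  have "norm (kern x) \<le> max B 32" if x: "\<bar>Im x - 3 * pi / c\<bar> \<le> M * \<bar>Re x\<bar>" for x
  proof (cases "\<bar>Re x\<bar> \<le> 1")
    case True
    then show ?thesis using B[of x] x by (simp add: S_def)
  next
    case False
    then show ?thesis
      using kern_bounded_right[of x] kern_bounded_right[of "- x"] by (auto simp: kern_uminus abs_if split: if_splits)
  qed
  then show ?thesis by (intro exI[of _ "max B 32"]) auto
qed

end

section \<open>Estimates for the sine and for horizontal integrals\<close>

lemma norm_sin_ge_exp:
  fixes u :: complex
  assumes "Im u \<ge> 0"
  shows "norm (sin u) \<ge> (exp (Im u) - exp (- Im u)) / 2"
proof -
  have "sin u = (exp (\<i> * u) - exp (- (\<i> * u))) / (2 * \<i>)" by (simp add: sin_exp_eq)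
  then have "norm (sin u) = norm (exp (- (\<i> * u)) - exp (\<i> * u)) / 2"
    by (simp add: norm_divide norm_mult norm_minus_commute)
  moreover have "norm (exp (- (\<i> * u))) - norm (exp (\<i> * u)) \<le> norm (exp (- (\<i> * u)) - exp (\<i> * u))"
    by (rule norm_triangle_ineq2)
  ultimately show ?thesis by simp
qed

text \<open>On these vertical lines cos (2 pi Re w) = -1, which makes |sin (pi w)| equal to cosh (pi
  Im w).\<close>

lemma norm_sin_half_integer_ge_1:
  fixes w :: complex
  assumes "\<bar>Re w\<bar> = real N + 1 / 2"
  shows "norm (sin (of_real pi * w)) \<ge> 1"
proof -
  let ?E = "exp (2 * (pi * Im w))"
  have "cos (2 * (pi * Re w)) = -1"
  proof -
    have "cos (2 * (pi * Re w)) = cos (2 * (pi * \<bar>Re w\<bar>))" by (cases "Re w \<ge> 0") auto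
    also have "2 * (pi * \<bar>Re w\<bar>) = 2 * real N * pi + pi" using assms by (simp add: algebra_simps)
    also have "cos \<dots> = -1" by (simp add: cos_add)
    finally show ?thesis .
  qed
  then have "(norm (sin (of_real pi * w)))\<^sup>2 = (?E + inverse ?E + 2) / 4"
    by (simp add: norm_sin_squared)
  moreover have "?E + inverse ?E \<ge> 2"
  proof -
    have "0 \<le> (?E - 1)\<^sup>2 / ?E" by simp
    also have "\<dots> = ?E + inverse ?E - 2" by (simp add: field_simps power2_eq_square)
    finally show ?thesis by simp
  qed
  ultimately have "1\<^sup>2 \<le> (norm (sin (of_real pi * w)))\<^sup>2" by simp
  then show ?thesis by (rule power2_le_imp_le) simp
qed

text \<open>A rational majorant replaces the Gaussian because it has the elementary antiderivative
  arctan; its integral over the whole line bounds the result for every R.\<close>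

lemma norm_contour_integral_horizontal_le:
  assumes cont: "continuous_on (closed_segment (Complex (- R) \<eta>) (Complex R \<eta>)) f"
    and R: "R > 0" and t: "t > 0" and K: "K \<ge> 0"
    and bound: "\<And>s. \<bar>s\<bar> \<le> R \<Longrightarrow> norm (f (Complex s \<eta>)) \<le> K / (1 + t * (s - s\<^sub>0)\<^sup>2)"
  shows "norm (contour_integral (linepath (Complex (- R) \<eta>) (Complex R \<eta>)) f) \<le> K * pi / sqrt t"
proof -
  let ?a = "Complex (- R) \<eta>" and ?b = "Complex R \<eta>"
  define s where "s u = - R + 2 * R * u" for u
  define F where "F = (\<lambda>u. f (linepath ?a ?b u) * (?b - ?a))"
  have "f contour_integrable_on linepath ?a ?b"
    using cont by (rule contour_integrable_continuous_linepath)
  then have F: "(F has_integral contour_integral (linepath ?a ?b) f) {0..1}"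
    unfolding F_def has_contour_integral_linepath[symmetric] by (rule has_contour_integral_integral)
  have lin: "linepath ?a ?b u = Complex (s u) \<eta>" for u
    by (simp add: linepath_def s_def complex_eq_iff algebra_simps)
  define A where "A = (\<lambda>u. K / sqrt t * arctan (sqrt t * (s u - s\<^sub>0)))"
  have int: "((\<lambda>u. 2 * R * (K / (1 + t * (s u - s\<^sub>0)\<^sup>2))) has_integral (A 1 - A 0)) {0..1}"
  proof (rule fundamental_theorem_of_calculus)
    fix u :: real
    have "(A has_real_derivative K / sqrt t * (inverse (1 + (sqrt t * (s u - s\<^sub>0))\<^sup>2) * (sqrt t * (2 * R)))) (at u)"
    proof -
      have "((\<lambda>u. sqrt t * (s u - s\<^sub>0)) has_real_derivative sqrt t * (2 * R)) (at u)"
        unfolding s_def by (auto intro!: derivative_eq_intros)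
      from DERIV_cmult[OF DERIV_chain2[OF DERIV_arctan this], of "K / sqrt t"]
      show ?thesis unfolding A_def .
    qed
    moreover have "K / sqrt t * (inverse (1 + (sqrt t * (s u - s\<^sub>0))\<^sup>2) * (sqrt t * (2 * R))) =
        2 * R * (K / (1 + t * (s u - s\<^sub>0)\<^sup>2))"
      using t by (simp add: power_mult_distrib divide_inverse)
    ultimately show "(A has_vector_derivative 2 * R * (K / (1 + t * (s u - s\<^sub>0)\<^sup>2))) (at u within {0..1})"
      by (simp add: has_real_derivative_iff_has_vector_derivative has_vector_derivative_at_within)
  qed simp
  have "norm (F u) \<le> 2 * R * (K / (1 + t * (s u - s\<^sub>0)\<^sup>2))" if "u \<in> {0..1}" for u
  proof -
    have "\<bar>s u\<bar> \<le> R" using that R mult_left_le[of u R] by (auto simp: s_def abs_le_iff)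
    then have "norm (f (Complex (s u) \<eta>)) \<le> K / (1 + t * (s u - s\<^sub>0)\<^sup>2)" by (rule bound)
    moreover have "?b - ?a = of_real (2 * R)" by (simp add: complex_eq_iff)
    then have "norm (?b - ?a) = 2 * R" using R by (simp only: norm_of_real)
    ultimately have "norm (f (Complex (s u) \<eta>)) * norm (?b - ?a) \<le> K / (1 + t * (s u - s\<^sub>0)\<^sup>2) * (2 * R)"
      using R by (intro mult_mono) (auto intro: order_trans[OF norm_ge_zero])
    then show ?thesis unfolding F_def lin norm_mult by (simp only: mult.commute)
  qed
  then have "norm (integral {0..1} F) \<le> integral {0..1} (\<lambda>u. 2 * R * (K / (1 + t * (s u - s\<^sub>0)\<^sup>2)))"
    using F int by (intro integral_norm_bound_integral) (auto intro: has_integral_integrable)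
  also have "integral {0..1} (\<lambda>u. 2 * R * (K / (1 + t * (s u - s\<^sub>0)\<^sup>2))) = A 1 - A 0"
    by (rule integral_unique[OF int])
  also have "integral {0..1} F = contour_integral (linepath ?a ?b) f"
    by (rule integral_unique[OF F])
  finally have "norm (contour_integral (linepath ?a ?b) f) \<le> A 1 - A 0" .
  also have "\<dots> \<le> K / sqrt t * (pi / 2) - K / sqrt t * (- (pi / 2))"
    unfolding A_def using K t arctan_bounded[of "sqrt t * (s 1 - s\<^sub>0)"] arctan_bounded[of "sqrt t * (s 0 - s\<^sub>0)"]
    by (intro diff_mono mult_left_mono) auto
  finally show ?thesis by simp
qed

section \<open>The residues of the contour integrand\<close>

locale rank_kernel_point = rank_kernel +
  fixes t v :: real
  assumes t: "t > 0"
begin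

text \<open>
  Heights in the $w$-plane scale with $\rho = \Re (1/z)$: the poles of $g(wz)$ lie on the line through
  $0$ and $w_0$, the first ones at the heights $\pm 2 \pi \rho / c$ and $\pm 4 \pi \rho / c$. The
  contour runs at the height $Y$ half way between them.
\<close>

definition z where "z = Complex t (t * v)"
definition \<rho> where "\<rho> = 1 / (t * (1 + v\<^sup>2))"
definition w\<^sub>0 where "w\<^sub>0 = 2 * of_real pi * \<i> / (of_nat c * z)"
definition H where "H w = exp (- (w\<^sup>2 * z)) * kern (w * z) / sin (of_real pi * w)"

lemma z_nonzero [simp]: "z \<noteq> 0" and Re_z [simp]: "Re z = t" and Im_z [simp]: "Im z = t * v"
  using t by (auto simp: z_def complex_eq_iff)

lemma one_plus_v: "1 + v\<^sup>2 > 0" "1 + v\<^sup>2 \<noteq> 0"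
  by (smt (verit) zero_le_power2)+

lemma \<rho>_pos: "\<rho> > 0"
  using t one_plus_v by (simp add: \<rho>_def)

text \<open>Because 1/z = \<open>\<rho>\<close> (1 - i v), the preimage of the imaginary axis under
  w \<mapsto> w z is the line through 0 in the direction v + i.\<close>

lemma Im_divide_z: "Im (\<i> * of_real \<kappa> / z) = \<kappa> * \<rho>" and Re_divide_z: "Re (\<i> * of_real \<kappa> / z) = \<kappa> * \<rho> * v"
proof -
  have "(of_real (\<kappa> * \<rho> * v) + \<i> * of_real (\<kappa> * \<rho>)) * z = \<i> * of_real \<kappa>"
  proof -
    have "\<rho> * t * (1 + v\<^sup>2) = 1" using t one_plus_v by (simp add: \<rho>_def)
    then have "\<kappa> * (\<rho> * t * (1 + v\<^sup>2)) = \<kappa>" by simp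
    then show ?thesis
      by (simp add: complex_eq_iff algebra_simps power2_eq_square)
  qed
  then have "\<i> * of_real \<kappa> / z = of_real (\<kappa> * \<rho> * v) + \<i> * of_real (\<kappa> * \<rho>)"
    by (simp add: divide_eq_eq)
  then show "Im (\<i> * of_real \<kappa> / z) = \<kappa> * \<rho>" "Re (\<i> * of_real \<kappa> / z) = \<kappa> * \<rho> * v"
    by simp_all
qed

lemma w\<^sub>0_eq: "w\<^sub>0 = \<i> * of_real (2 * pi / c) / z"
  by (simp add: w\<^sub>0_def)

lemma Im_w\<^sub>0: "Im w\<^sub>0 = 2 * pi / c * \<rho>" and Re_w\<^sub>0: "Re w\<^sub>0 = 2 * pi / c * \<rho> * v"
  unfolding w\<^sub>0_eq Im_divide_z Re_divide_z by simp_all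

lemma Im_w\<^sub>0_pos: "Im w\<^sub>0 > 0"
  unfolding Im_w\<^sub>0 using \<rho>_pos c by simp

text \<open>Completing the square in Re w: at each height the Gaussian is centred at Im w * v, that
  is, on the line through 0 and \<open>w\<^sub>0\<close>.\<close>

lemma norm_gauss: "norm (exp (- (w\<^sup>2 * z))) = exp (- (t * (Re w - Im w * v)\<^sup>2) + t * (Im w)\<^sup>2 * (1 + v\<^sup>2))"
proof -
  have "Re (- (w\<^sup>2 * z)) = - (t * (Re w - Im w * v)\<^sup>2) + t * (Im w)\<^sup>2 * (1 + v\<^sup>2)"
    by (simp add: power2_eq_square algebra_simps)
  then show ?thesis by (simp only: norm_exp_eq_Re)
qed

lemma Re_mult_z: "Re (w * z) = t * (Re w - Im w * v)"
  by (simp add: algebra_simps)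

lemma den_mult_z_nonzero:
  assumes "\<bar>Im w\<bar> < 4 * pi / c * \<rho>" "w \<noteq> w\<^sub>0" "w \<noteq> - w\<^sub>0"
  shows "den (w * z) \<noteq> 0"
proof (rule den_nonzero, cases "Re (w * z) = 0")
  case True
  define \<kappa> where "\<kappa> = Im (w * z)"
  have "w * z = \<i> * of_real \<kappa>" using True by (simp add: \<kappa>_def complex_eq_iff)
  then have w: "w = \<i> * of_real \<kappa> / z" by (simp add: eq_divide_eq)
  have "\<bar>\<kappa>\<bar> * \<rho> < 4 * pi / c * \<rho>"
    using assms(1) \<rho>_pos unfolding w Im_divide_z by (simp add: abs_mult)
  then have "\<bar>\<kappa>\<bar> < 4 * pi / c" using \<rho>_pos by (simp only: mult_less_cancel_right_pos)
  moreover have "\<bar>\<kappa>\<bar> \<noteq> 2 * pi / c"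
  proof
    assume "\<bar>\<kappa>\<bar> = 2 * pi / c"
    then consider "\<kappa> = 2 * pi / c" | "\<kappa> = - (2 * pi / c)" by linarith
    then show False
    proof cases
      case 1 then show False using assms(2) w w\<^sub>0_eq by simp
    next
      case 2 then show False using assms(3) w w\<^sub>0_eq by simp
    qed
  qed
  ultimately show "Re (w * z) \<noteq> 0 \<or> (\<bar>Im (w * z)\<bar> < 4 * pi / c \<and> \<bar>Im (w * z)\<bar> \<noteq> 2 * pi / c)"
    by (simp add: \<kappa>_def)
qed simp

definition strip :: "real \<Rightarrow> complex set" where
  "strip R = {w. \<bar>Re w\<bar> < R \<and> \<bar>Im w\<bar> < 4 * pi / c * \<rho>}"

lemma strip_eq_box: "strip R = box (Complex (- R) (- (4 * pi / c * \<rho>))) (Complex R (4 * pi / c * \<rho>))"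
  by (auto simp: strip_def in_box_complex_iff)

text \<open>At the integer 0 the zero of \<open>kern\<close> cancels the zero of the sine, so this
  point contributes residue 0.\<close>

definition poles :: "nat \<Rightarrow> complex set" where
  "poles N = of_int ` {- int N..int N} \<union> {w\<^sub>0, - w\<^sub>0}"

lemma sin_nonzero:
  assumes "\<bar>Re w\<bar> < real N + 1" "w \<notin> of_int ` {- int N..int N}"
  shows "sin (of_real pi * w) \<noteq> 0"
proof
  assume "sin (of_real pi * w) = 0"
  then obtain n :: int where "of_real pi * w = of_real (n * pi)"
    by (auto simp: sin_eq_0)
  then have w: "w = of_int n" by (simp add: mult.commute)
  then have "\<bar>real_of_int n\<bar> < real N + 1" using assms(1) by simp
  then have "n \<in> {- int N..int N}" by auto
  then show False using assms(2) w by blast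
qed

lemma holomorphic_H: "H holomorphic_on strip (real N + 1) - poles N"
  unfolding H_def[abs_def] kern_def[abs_def]
proof (intro holomorphic_intros)
  show "(\<lambda>w. num (w * z)) holomorphic_on strip (real N + 1) - poles N"
    "(\<lambda>w. den (w * z)) holomorphic_on strip (real N + 1) - poles N"
    unfolding num_def den_def by (intro holomorphic_intros)+
  fix w assume w: "w \<in> strip (real N + 1) - poles N"
  then show "den (w * z) \<noteq> 0" by (intro den_mult_z_nonzero) (auto simp: strip_def poles_def)
  show "sin (of_real pi * w) \<noteq> 0" using w by (intro sin_nonzero[of _ N]) (auto simp: strip_def poles_def)
qed

lemma residue_integer:
  assumes n: "\<bar>n\<bar> \<le> int N"
  shows "residue H (of_int n) = (-1) powi n * exp (- ((of_int n)\<^sup>2 * z)) * kern (of_int n * z) / of_real pi"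
proof -
  define U where "U = strip (real N + 1) - (poles N - {of_int n})"
  have nw: "of_int n \<noteq> w\<^sub>0" "of_int n \<noteq> - w\<^sub>0"
    using Im_w\<^sub>0_pos by (auto simp: complex_eq_iff)
  have "finite (poles N)" by (simp add: poles_def)
  then have U: "open U" "of_int n \<in> U"
    using n \<rho>_pos c by (auto simp: U_def strip_eq_box in_box_complex_iff intro!: open_Diff finite_imp_closed)
  have "\<bar>Im (of_int n :: complex)\<bar> < 4 * pi / c * \<rho>" using \<rho>_pos c by simp
  then have den: "den (of_int n * z) \<noteq> 0" by (rule den_mult_z_nonzero[OF _ nw])
  let ?g = "\<lambda>w. exp (- (w\<^sup>2 * z)) * kern (w * z)"
  have cont: "isCont ?g (of_int n)"
    unfolding kern_def num_def den_def
    using den[unfolded den_def] by (intro continuous_intros) auto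
  have "((\<lambda>w::complex. sin (of_real pi * w)) has_field_derivative of_real pi * cos (of_real pi * of_int n)) (at (of_int n))"
    by (auto intro!: derivative_eq_intros)
  moreover have "cos (of_real pi * of_int n) = ((-1) powi n :: complex)" "sin (of_real pi * of_int n :: complex) = 0"
  proof -
    have "of_real pi * of_int n = (of_real (pi * of_int n) :: complex)" by simp
    then have *: "cos (of_real pi * of_int n :: complex) = of_real (cos (pi * of_int n))"
        "sin (of_real pi * of_int n :: complex) = of_real (sin (pi * of_int n))"
      by (simp_all only: cos_of_real sin_of_real)
    show "cos (of_real pi * of_int n) = ((-1) powi n :: complex)"
      unfolding * by (cases "even n") (simp_all add: cos_npi_int)
    show "sin (of_real pi * of_int n :: complex) = 0"
      unfolding * by simp
  qed
  ultimately have "((\<lambda>w::complex. sin (of_real pi * w) / (w - of_int n)) \<longlongrightarrow> of_real pi * (-1) powi n) (at (of_int n))"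
    by (simp add: has_field_derivative_iff)
  then have "((\<lambda>w. ?g w / (sin (of_real pi * w) / (w - of_int n))) \<longlongrightarrow> ?g (of_int n) / (of_real pi * (-1) powi n)) (at (of_int n))"
    using cont by (intro tendsto_divide) (auto simp: isCont_def power_int_not_zero)
  then have lim: "((\<lambda>w. H w * (w - of_int n)) \<longlongrightarrow> ?g (of_int n) / (of_real pi * (-1) powi n)) (at (of_int n))"
    by (simp add: H_def)
  have "residue H (of_int n) = ?g (of_int n) / (of_real pi * (-1) powi n)"
  proof (rule residue_simple'[OF U _ lim])
    show "H holomorphic_on U - {of_int n}"
      by (rule holomorphic_on_subset[OF holomorphic_H[of N]]) (auto simp: U_def)
  qed
  also have "\<dots> = (-1) powi n * ?g (of_int n) / of_real pi"
    by (cases "even n") (auto simp: power_int_minus_left)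
  finally show ?thesis by (simp add: mult.assoc)
qed

text \<open>Near the simple zero of \<open>den\<close> the geometric sum is (1 - x^c) / (1 - x) with
  x = e^{-w z}; the derivative of 1 - x^c at \<open>w\<^sub>0\<close> is c z, the last divisor
  here.\<close>

definition main_residue :: complex where
  "main_residue = exp (- (w\<^sub>0\<^sup>2 * z)) * num (w\<^sub>0 * z) * (1 - exp (- (w\<^sub>0 * z))) / ((1 + exp (- (w\<^sub>0 * z))) * sin (of_real pi * w\<^sub>0)) / (of_nat c * z)"

lemma residue_w\<^sub>0: "residue H w\<^sub>0 = main_residue" and residue_minus_w\<^sub>0: "residue H (- w\<^sub>0) = main_residue"
proof -
  define x where "x = w\<^sub>0 * z"
  have x: "x = \<i> * of_real (2 * pi / c)" by (simp add: x_def w\<^sub>0_eq)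
  obtain N :: nat where N: "\<bar>Re w\<^sub>0\<bar> < real N + 1" by (meson reals_Archimedean2 less_add_one less_trans)
  define U where "U = strip (real N + 1) - (poles N - {w\<^sub>0})"
  define U' where "U' = strip (real N + 1) - (poles N - {- w\<^sub>0})"
  have fin: "finite (poles N)" by (simp add: poles_def)
  have ins: "w\<^sub>0 \<in> strip (real N + 1)" "- w\<^sub>0 \<in> strip (real N + 1)"
    using N \<rho>_pos c by (auto simp: strip_def Im_w\<^sub>0 abs_mult divide_strict_right_mono)
  then have U: "open U" "w\<^sub>0 \<in> U" "open U'" "- w\<^sub>0 \<in> U'"
    using fin by (auto simp: U_def U'_def strip_eq_box intro!: open_Diff finite_imp_closed)
  have "w\<^sub>0 \<notin> of_int ` {- int N..int N}"
    using Im_w\<^sub>0_pos by auto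
  then have sin: "sin (of_real pi * w\<^sub>0) \<noteq> 0" by (rule sin_nonzero[OF N])
  have pc: "2 * pi / c < pi" "2 * pi / c > 0" using c by (auto simp: divide_less_eq)
  have ex: "exp (- x) \<noteq> 1" "exp (- x) \<noteq> - 1"
  proof -
    have "Re (exp (- x)) = cos (2 * pi / c)" by (simp add: x Re_exp)
    moreover have "cos pi < cos (2 * pi / c)" "cos (2 * pi / c) < cos 0"
      using pc by (intro cos_monotone_0_pi; simp)+
    ultimately show "exp (- x) \<noteq> 1" "exp (- x) \<noteq> - 1" by auto
  qed
  have xc: "exp (- x) ^ c = 1"
  proof -
    have "exp (- x) ^ c = exp (of_nat c * (- x))" by (simp only: exp_of_nat_mult)
    also have "of_nat c * (- x) = - (2 * of_real pi * \<i>)" using c by (simp add: x)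
    finally show ?thesis by (simp add: exp_minus)
  qed
  let ?q = "\<lambda>w. exp (- (w * z))"
  let ?g = "\<lambda>w. exp (- (w\<^sup>2 * z)) * num (w * z) * (1 - ?q w) / ((1 + ?q w) * sin (of_real pi * w))"
  have cont: "isCont ?g w\<^sub>0"
    unfolding num_def using ex sin by (intro continuous_intros) (auto simp: x_def add_eq_0_iff)
  have "((\<lambda>w. 1 - ?q w ^ c) has_field_derivative of_nat c * z) (at w\<^sub>0)"
  proof -
    have "?q w\<^sub>0 ^ (c - 1) * ?q w\<^sub>0 = 1" using xc c by (simp add: x_def flip: power_Suc2)
    then have "of_nat c * (?q w\<^sub>0 ^ (c - 1) * ?q w\<^sub>0) * z = of_nat c * z" by simp
    then show ?thesis
      by (auto intro!: derivative_eq_intros simp: mult_ac)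
  qed
  then have "((\<lambda>w. (1 - ?q w ^ c) / (w - w\<^sub>0)) \<longlongrightarrow> of_nat c * z) (at w\<^sub>0)"
    using xc by (simp add: has_field_derivative_iff x_def)
  then have "((\<lambda>w. ?g w / ((1 - ?q w ^ c) / (w - w\<^sub>0))) \<longlongrightarrow> ?g w\<^sub>0 / (of_nat c * z)) (at w\<^sub>0)"
    using c by (intro tendsto_divide[OF cont[unfolded isCont_def]]) auto
  moreover have "\<forall>\<^sub>F w in at w\<^sub>0. ?g w / ((1 - ?q w ^ c) / (w - w\<^sub>0)) = H w * (w - w\<^sub>0)"
  proof -
    have "isCont ?q w\<^sub>0" by (intro continuous_intros)
    moreover have "?q w\<^sub>0 \<noteq> 1" using ex by (simp add: x_def)
    ultimately have "\<forall>\<^sub>F w in at w\<^sub>0. ?q w \<noteq> 1"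
      unfolding isCont_def by (rule tendsto_imp_eventually_ne)
    then show ?thesis
    proof eventually_elim
      case (elim w)
      then have "(\<Sum>j<c. ?q w ^ j) = (1 - ?q w ^ c) / (1 - ?q w)"
        using geometric[of "?q w"] by (simp add: eq_divide_eq mult.commute)
      then show ?case
        unfolding H_def kern_def den_def by (simp add: mult_ac)
    qed
  qed
  ultimately have lim: "((\<lambda>w. H w * (w - w\<^sub>0)) \<longlongrightarrow> main_residue) (at w\<^sub>0)"
    unfolding main_residue_def by (rule Lim_transform_eventually)
  show "residue H w\<^sub>0 = main_residue"
    by (rule residue_simple'[OF U(1,2) _ lim], rule holomorphic_on_subset[OF holomorphic_H[of N]])
       (auto simp: U_def)
  \<comment> \<open>\<open>H\<close> is odd, and so is the factor w - \<open>w\<^sub>0\<close> up to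
    reflection; the two changes of sign cancel.\<close>
  have "((\<lambda>w. H (- w) * (- w - w\<^sub>0)) \<longlongrightarrow> main_residue) (at (- w\<^sub>0))"
    using lim by (simp add: filterlim_filtermap filtermap_at_minus[symmetric])
  moreover have "H (- w) * (- w - w\<^sub>0) = H w * (w - - w\<^sub>0)" for w
  proof -
    have "H (- w) = - H w" by (simp add: H_def kern_uminus)
    then show ?thesis by (simp add: algebra_simps)
  qed
  ultimately have lim': "((\<lambda>w. H w * (w - - w\<^sub>0)) \<longlongrightarrow> main_residue) (at (- w\<^sub>0))" by simp
  show "residue H (- w\<^sub>0) = main_residue"
    by (rule residue_simple'[OF U(3,4) _ lim'], rule holomorphic_on_subset[OF holomorphic_H[of N]])
       (auto simp: U'_def)
qed

definition alt_term :: "nat \<Rightarrow> complex" where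
  "alt_term k = (-1) ^ k * exp (- ((of_nat (Suc k))\<^sup>2 * z)) * kern (of_nat (Suc k) * z)"

definition Y where "Y = 3 * pi / c * \<rho>"

text \<open>The half-integer R separates the integers, and the height Y encloses exactly the two
  poles \<open>w\<^sub>0\<close> and \<open>- w\<^sub>0\<close> of the kernel. Opposite points have
  equal residues, which doubles both parts; the sum enters negatively because the sign at n = k + 1
  is -(-1)^k.\<close>

lemma contour_integral_rectangle:
  assumes N: "\<bar>Re w\<^sub>0\<bar> < real N + 1 / 2"
  defines "R \<equiv> real N + 1 / 2"
  shows "contour_integral (rectpath (Complex (- R) (- Y)) (Complex R Y)) H =
      4 * \<i> * (of_real pi * main_residue - (\<Sum>k<N. alt_term k))"
    and "path_image (rectpath (Complex (- R) (- Y)) (Complex R Y)) \<subseteq> strip (real N + 1) - poles N"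
proof -
  let ?a = "Complex (- R) (- Y)" and ?b = "Complex R Y"
  have Y: "Y > 0" "Y < 4 * pi / c * \<rho>" "2 * pi / c * \<rho> < Y"
    unfolding Y_def using \<rho>_pos c by (auto intro!: mult_strict_right_mono divide_strict_right_mono)
  have R: "R > 0" "R < real N + 1" by (simp_all add: R_def)
  have sub: "poles N \<subseteq> box ?a ?b"
  proof
    fix w assume "w \<in> poles N"
    then consider n where "w = of_int n" "- int N \<le> n" "n \<le> int N" | "w = w\<^sub>0" | "w = - w\<^sub>0"
      by (auto simp: poles_def)
    then show "w \<in> box ?a ?b"
    proof cases
      case 1
      then have "- real N \<le> real_of_int n" "real_of_int n \<le> real N" by linarith+
      then show ?thesis using Y 1 by (auto simp: in_box_complex_iff R_def)
    qed (use N Y Im_w\<^sub>0 Im_w\<^sub>0_pos in \<open>auto simp: in_box_complex_iff R_def\<close>)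
  qed
  have cb: "cbox ?a ?b \<subseteq> strip (real N + 1)"
    using Y R by (auto simp: in_cbox_complex_iff strip_def)
  have img: "path_image (rectpath ?a ?b) = cbox ?a ?b - box ?a ?b"
    using R Y by (intro path_image_rectpath_cbox_minus_box) auto
  then show im: "path_image (rectpath ?a ?b) \<subseteq> strip (real N + 1) - poles N"
    using sub cb by blast
  have "contour_integral (rectpath ?a ?b) H =
      2 * pi * \<i> * (\<Sum>p\<in>poles N. winding_number (rectpath ?a ?b) p * residue H p)"
  proof (rule Residue_theorem[OF _ _ _ holomorphic_H])
    show "open (strip (real N + 1))" unfolding strip_eq_box by (rule open_box)
    show "connected (strip (real N + 1))"
      unfolding strip_eq_box by (intro convex_connected convex_box)
    show "finite (poles N)" by (simp add: poles_def)
    show "\<forall>w. w \<notin> strip (real N + 1) \<longrightarrow> winding_number (rectpath ?a ?b) w = 0"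
      using cb R Y by (auto intro!: winding_number_rectpath_outside)
  qed (use im in auto)
  also have "(\<Sum>p\<in>poles N. winding_number (rectpath ?a ?b) p * residue H p) = (\<Sum>p\<in>poles N. residue H p)"
    using sub by (intro sum.cong) (auto simp: winding_number_rectpath)
  also have "\<dots> = (\<Sum>p\<in>of_int ` {- int N..int N}. residue H p) + (\<Sum>p\<in>{w\<^sub>0, - w\<^sub>0}. residue H p)"
    unfolding poles_def using Im_w\<^sub>0_pos by (intro sum.union_disjoint) (auto simp: complex_eq_iff)
  also have "(\<Sum>p\<in>{w\<^sub>0, - w\<^sub>0}. residue H p) = 2 * main_residue"
  proof -
    have "w\<^sub>0 \<noteq> - w\<^sub>0" using Im_w\<^sub>0_pos by (auto simp: complex_eq_iff)
    then show ?thesis by (simp add: residue_w\<^sub>0 residue_minus_w\<^sub>0)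
  qed
  also have "(\<Sum>p\<in>of_int ` {- int N..int N}. residue H p) = - 2 * (\<Sum>k<N. alt_term k) / of_real pi"
  proof -
    define r where "r n = residue H (of_int n)" for n
    have r: "r n = (-1) powi n * exp (- ((of_int n)\<^sup>2 * z)) * kern (of_int n * z) / of_real pi" if "\<bar>n\<bar> \<le> int N" for n
      unfolding r_def by (rule residue_integer[OF that])
    have rn: "r (int (Suc k)) = - alt_term k / of_real pi" "r (- int (Suc k)) = - alt_term k / of_real pi" if "k < N" for k
    proof -
      show "r (int (Suc k)) = - alt_term k / of_real pi"
        by (subst r) (use that in \<open>auto simp: alt_term_def power_int_def nat_add_distrib\<close>)
      have m: "of_int (- int (Suc k)) = - (of_nat (Suc k) :: complex)" by simp
      have "(-1) powi (- int (Suc k)) = - ((-1) ^ k :: complex)"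
        by (simp add: power_int_minus power_int_def nat_add_distrib flip: power_inverse)
      then show "r (- int (Suc k)) = - alt_term k / of_real pi"
        by (subst r) (use that in \<open>simp_all add: m alt_term_def kern_uminus del: of_nat_Suc of_int_minus\<close>)
    qed
    have "(\<Sum>p\<in>of_int ` {- int N..int N}. residue H p) = (\<Sum>n\<in>{- int N..int N}. r n)"
      by (subst sum.reindex) (auto simp: inj_on_def r_def)
    moreover have "{- int N..int N} = insert 0 ((\<lambda>k. int (Suc k)) ` {..<N} \<union> (\<lambda>k. - int (Suc k)) ` {..<N})"
    proof (intro set_eqI iffI)
      fix n assume n: "n \<in> {- int N..int N}"
      consider "n = 0" | "n > 0" | "n < 0" by linarith
      then show "n \<in> insert 0 ((\<lambda>k. int (Suc k)) ` {..<N} \<union> (\<lambda>k. - int (Suc k)) ` {..<N})"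
      proof cases
        case 2
        then have "n = int (Suc (nat (n - 1)))" "nat (n - 1) < N" using n by auto
        then show ?thesis by blast
      next
        case 3
        then have "n = - int (Suc (nat (- n - 1)))" "nat (- n - 1) < N" using n by auto
        then show ?thesis by blast
      qed simp
    qed auto
    moreover have "(\<Sum>n\<in>insert 0 ((\<lambda>k. int (Suc k)) ` {..<N} \<union> (\<lambda>k. - int (Suc k)) ` {..<N}). r n) = r 0 + ((\<Sum>k<N. r (int (Suc k))) + (\<Sum>k<N. r (- int (Suc k))))"
      by (subst sum.insert, simp, force, subst sum.union_disjoint, simp, simp, force,
          subst sum.reindex, force simp: inj_on_def, subst sum.reindex, force simp: inj_on_def) simp
    moreover have "r 0 = 0" by (subst r) auto
    moreover have "(\<Sum>k<N. r (int (Suc k))) = (\<Sum>k<N. - alt_term k / of_real pi)"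
      using rn by (intro sum.cong) auto
    moreover have "(\<Sum>k<N. r (- int (Suc k))) = (\<Sum>k<N. - alt_term k / of_real pi)"
      using rn by (intro sum.cong) auto
    ultimately have "(\<Sum>p\<in>of_int ` {- int N..int N}. residue H p) =
        (\<Sum>k<N. - alt_term k / of_real pi) + (\<Sum>k<N. - alt_term k / of_real pi)"
      by (simp only: add_0_left)
    then show ?thesis by (simp add: sum_negf sum_divide_distrib[symmetric])
  qed
  moreover have "2 * of_real pi * \<i> * (- 2 * S / of_real pi + 2 * m) = 4 * \<i> * (of_real pi * m - S)" for S m :: complex
    by (simp add: field_simps)
  ultimately show "contour_integral (rectpath ?a ?b) H =
      4 * \<i> * (of_real pi * main_residue - (\<Sum>k<N. alt_term k))"
    by (simp only: of_real_mult of_real_numeral)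
qed

end

section \<open>The main residue in closed form\<close>

context rank_kernel begin

definition ampl :: real where
  "ampl = tan (pi / c) * sin (d * pi / c) * sin (e * pi / c)"

lemma ampl_pos: "ampl > 0"
proof -
  have "d < c" "e < c" using sum d e by linarith+
  then have "d * pi / c < pi" "e * pi / c < pi" by (simp_all add: divide_less_eq)
  moreover have "pi / c < pi / 2" using c by (intro divide_strict_left_mono) auto
  ultimately show ?thesis
    unfolding ampl_def using c d e by (intro mult_pos_pos tan_gt_zero sin_gt_zero) auto
qed

end

context rank_kernel_point begin

text \<open>At \<open>w\<^sub>0\<close> the variable of the kernel is 2 pi i/c, so its exponentials
  are powers of h^2 with h = e^{-i pi/c}. Each 1 - h^(2n) is h^n times 2 i sin (n pi/c), 1 + h^2 is
  h times 2 cos (pi/c), and the remaining powers of h multiply to h^c = -1. The exponent 4 pi^2/c^2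
  comes from the Gaussian and -2 pi^2/c from the sine.\<close>

lemma main_residue_eq:
  "main_residue = 8 * of_real ampl * exp (of_real (4 * pi\<^sup>2 / c\<^sup>2 - 2 * pi\<^sup>2 / c) / z) /
     (of_nat c * z * (1 - exp (- (of_real (4 * pi\<^sup>2 / c) / z))))"
proof -
  define h where "h = exp (- (\<i> * of_real (pi / c)))"
  define h' where "h' = exp (\<i> * of_real (pi / c))"
  have hh: "h * h' = 1" by (simp add: h_def h'_def exp_minus)
  define x where "x = w\<^sub>0 * z"
  have x: "x = \<i> * of_real (2 * pi / c)" by (simp add: x_def w\<^sub>0_eq)
  have X: "exp (- x) = h * h" 
  proof -
    have "- x = - (\<i> * of_real (pi / c)) + - (\<i> * of_real (pi / c))"
      by (simp add: x complex_eq_iff)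
    then show ?thesis unfolding h_def by (simp only: exp_add)
  qed
  have hn: "h ^ n = exp (- (\<i> * of_real (n * pi / c)))" "h' ^ n = exp (\<i> * of_real (n * pi / c))" for n :: nat
    unfolding h_def h'_def by (simp_all flip: exp_of_nat_mult add: mult_ac)
  have s: "1 - exp (- x) ^ n = h ^ n * (2 * \<i> * of_real (sin (n * pi / c)))" for n :: nat
  proof -
    have "2 * \<i> * of_real (sin (n * pi / c)) = h' ^ n - h ^ n"
      unfolding hn sin_of_real[symmetric] sin_exp_eq by simp
    moreover have "h ^ n * h' ^ n = 1" by (simp flip: power_mult_distrib add: hh)
    ultimately have S: "2 * \<i> * of_real (sin (n * pi / c)) = h' ^ n - h ^ n" and "1 = h ^ n * h' ^ n" by simp_all
    then show ?thesis unfolding X S power_mult_distrib right_diff_distrib by (simp only:)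
  qed
  have co: "1 + exp (- x) = h * (2 * of_real (cos (pi / c)))"
  proof -
    have "2 * of_real (cos (pi / c)) = h' + h"
      unfolding h_def h'_def cos_of_real[symmetric] cos_exp_eq by simp
    then show ?thesis unfolding X using hh by (simp add: algebra_simps)
  qed
  have hc: "h ^ c = - 1"
    unfolding hn using c by (simp add: exp_minus)
  have cos_pos: "cos (pi / c) > 0"
  proof (rule cos_gt_zero)
    show "pi / c < pi / 2" using c by (intro divide_strict_left_mono) auto
  qed (use c in simp)
  have main1: "num x * (1 - exp (- x)) / (1 + exp (- x)) = 4 * \<i> * of_real ampl"
  proof -
    have s1: "1 - exp (- x) = h * (2 * \<i> * of_real (sin (pi / c)))" using s[of 1] by simp
    have "h ^ c = h ^ (2 * a + d + e)" using sum by simp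
    also have "\<dots> = exp (- x) ^ a * h ^ d * h ^ e"
      unfolding X by (simp add: power_add power_mult power2_eq_square)
    finally have hc': "exp (- x) ^ a * h ^ d * h ^ e = - 1" using hc by simp
    have "num x * (1 - exp (- x)) = (exp (- x) ^ a * h ^ d * h ^ e) * h * ((2 * \<i>) ^ 3 *
        of_real (sin (d * pi / c) * sin (e * pi / c) * sin (pi / c)))"
      unfolding num_def s s1 by (simp add: power3_eq_cube mult_ac)
    also have "\<dots> = (1 + exp (- x)) * (4 * \<i> * of_real ampl)"
      unfolding hc' co ampl_def tan_def using cos_pos by (simp add: power3_eq_cube mult_ac)
    finally have "num x * (1 - exp (- x)) = (1 + exp (- x)) * (4 * \<i> * of_real ampl)" .
    moreover have "1 + exp (- x) \<noteq> 0" unfolding co h_def using cos_pos by simp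
    ultimately show ?thesis by simp
  qed
  define u where "u = of_real (2 * pi\<^sup>2 / c) / z"
  have main2: "sin (of_real pi * w\<^sub>0) = \<i> * exp u * (1 - exp (- (2 * u))) / 2"
  proof -
    have "of_real pi * w\<^sub>0 = \<i> * u" by (simp add: w\<^sub>0_eq u_def power2_eq_square)
    then have "sin (of_real pi * w\<^sub>0) = sin (\<i> * u)" by simp
    also have "\<dots> = \<i> * (exp u - exp (- u)) / 2"
      unfolding sin_exp_eq by (simp add: field_simps)
    also have "exp (- u) = exp u * exp (- (2 * u))" by (simp flip: exp_add)
    finally show ?thesis by (simp add: algebra_simps)
  qed
  have main3: "exp (- (w\<^sub>0\<^sup>2 * z)) = exp (of_real (4 * pi\<^sup>2 / c\<^sup>2) / z)"
    unfolding w\<^sub>0_eq by (simp add: power2_eq_square field_simps)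
  have "main_residue = exp (- (w\<^sub>0\<^sup>2 * z)) * (num x * (1 - exp (- x)) / (1 + exp (- x))) / sin (of_real pi * w\<^sub>0) / (of_nat c * z)"
    unfolding main_residue_def x_def by (simp add: mult.assoc)
  also have "\<dots> = exp (of_real (4 * pi\<^sup>2 / c\<^sup>2) / z) * (4 * \<i> * of_real ampl) /
      (\<i> * exp u * (1 - exp (- (2 * u))) / 2) / (of_nat c * z)"
    unfolding main1 main2 main3 ..
  also have "\<dots> = 8 * of_real ampl * (exp (of_real (4 * pi\<^sup>2 / c\<^sup>2) / z) * exp (- u)) / (of_nat c * z * (1 - exp (- (2 * u))))"
  proof -
    have "E * (4 * \<i> * A) / (\<i> * U * W / 2) / C = 8 * A * (E * inverse U) / (C * W)" for E A U W C :: complex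
    proof -
      have "E * (4 * \<i> * A) / (\<i> * U * W / 2) / C = \<i> * (8 * (E * A)) / (\<i> * (U * W * C))" by (simp add: mult_ac)
      also have "\<dots> = 8 * (E * A) / (U * W * C)" by (rule mult_divide_mult_cancel_left) simp
      also have "\<dots> = 8 * A * (E * inverse U) / (C * W)" by (simp add: divide_inverse mult_ac)
      finally show ?thesis .
    qed
    then show ?thesis unfolding exp_minus[of u] .
  qed
  also have "exp (of_real (4 * pi\<^sup>2 / c\<^sup>2) / z) * exp (- u) = exp (of_real (4 * pi\<^sup>2 / c\<^sup>2 - 2 * pi\<^sup>2 / c) / z)"
    by (simp add: u_def diff_divide_distrib flip: exp_add)
  also have "2 * u = of_real (4 * pi\<^sup>2 / c) / z" by (simp add: u_def)
  finally show ?thesis .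
qed

section \<open>The error of the approximation by residues\<close>

lemma H_uminus: "H (- w) = - H w"
  by (simp add: H_def kern_uminus)

lemma Y_rules: "Y > 0" "t * Y * (1 + v\<^sup>2) = 3 * pi / c" "t * Y\<^sup>2 * (1 + v\<^sup>2) = (3 * pi / c)\<^sup>2 * \<rho>"
proof -
  have r: "t * \<rho> * (1 + v\<^sup>2) = 1" using t one_plus_v by (simp add: \<rho>_def)
  show "Y > 0" using \<rho>_pos c by (simp add: Y_def)
  have "t * Y * (1 + v\<^sup>2) = 3 * pi / c * (t * \<rho> * (1 + v\<^sup>2))" by (simp only: Y_def mult_ac)
  also have "\<dots> = 3 * pi / c" unfolding r by (rule mult_1_right)
  finally show "t * Y * (1 + v\<^sup>2) = 3 * pi / c" .
  have "t * Y\<^sup>2 * (1 + v\<^sup>2) = t * Y * (1 + v\<^sup>2) * Y" by (simp add: power2_eq_square)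
  also have "\<dots> = 3 * pi / c * Y" using \<open>t * Y * (1 + v\<^sup>2) = 3 * pi / c\<close> by (simp only:)
  also have "\<dots> = (3 * pi / c)\<^sup>2 * \<rho>" unfolding Y_def power2_eq_square by (simp only: mult.assoc)
  finally show "t * Y\<^sup>2 * (1 + v\<^sup>2) = (3 * pi / c)\<^sup>2 * \<rho>" .
qed

definition sh where "sh = (exp (pi * Y) - exp (- (pi * Y))) / 2"

lemma sh_pos: "sh > 0"
  using Y_rules(1) by (simp add: sh_def)

lemma exp_minus_le: "exp (- x) \<le> 1 / (1 + x)" if "x \<ge> 0" for x :: real
  using exp_ge_add_one_self[of x] that by (simp add: exp_minus field_simps)

text \<open>At height Y the point w z runs along the line Im x = 3 pi/c + v Re x, inside the double
  cone of \<open>kern_bounded_line\<close>. The Gaussian is weakened to the majorant expected by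
  \<open>norm_contour_integral_horizontal_le\<close>.\<close>

lemma norm_H_top_le:
  assumes B: "\<And>x. \<bar>Im x - 3 * pi / c\<bar> \<le> \<bar>v\<bar> * \<bar>Re x\<bar> \<Longrightarrow> norm (kern x) \<le> B"
  shows "norm (H (Complex s Y)) \<le> B * exp ((3 * pi / c)\<^sup>2 * \<rho>) / sh / (1 + t * (s - Y * v)\<^sup>2)"
proof -
  let ?w = "Complex s Y"
  have "Im (?w * z) - 3 * pi / c = v * Re (?w * z)"
    unfolding Y_rules(2)[symmetric] by (simp add: algebra_simps power2_eq_square)
  then have "norm (kern (?w * z)) \<le> B" by (intro B) (simp add: abs_mult)
  moreover have "norm (exp (- (?w\<^sup>2 * z))) \<le> exp ((3 * pi / c)\<^sup>2 * \<rho>) * (1 / (1 + t * (s - Y * v)\<^sup>2))"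
    unfolding norm_gauss complex.sel Y_rules(3) exp_add
    using exp_minus_le[of "t * (s - Y * v)\<^sup>2"] t by (subst mult.commute, intro mult_left_mono) auto
  moreover have "sh \<le> norm (sin (of_real pi * ?w))"
    using norm_sin_ge_exp[of "of_real pi * ?w"] Y_rules(1) by (simp add: sh_def)
  ultimately have "norm (exp (- (?w\<^sup>2 * z))) * norm (kern (?w * z)) / norm (sin (of_real pi * ?w)) \<le>
      exp ((3 * pi / c)\<^sup>2 * \<rho>) * (1 / (1 + t * (s - Y * v)\<^sup>2)) * B / sh"
    using sh_pos t by (intro frac_le mult_mono) (auto intro!: mult_nonneg_nonneg divide_nonneg_nonneg add_nonneg_nonneg intro: order_trans[OF norm_ge_zero])
  then show ?thesis by (simp add: H_def norm_mult norm_divide mult_ac)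
qed

text \<open>Far enough out |Re (w z)| >= 1, where the kernel is bounded by 32, so the Gaussian alone
  makes the vertical sides small.\<close>

lemma norm_H_side_le:
  assumes w: "\<bar>Re w\<bar> = real N + 1 / 2" "\<bar>Im w\<bar> \<le> Y" and N: "t * (real N + 1 / 2 - Y * \<bar>v\<bar>) \<ge> 1"
  shows "norm (H w) \<le> 32 * exp ((3 * pi / c)\<^sup>2 * \<rho>) / (1 + t * (real N + 1 / 2 - Y * \<bar>v\<bar>)\<^sup>2)"
proof -
  let ?r = "real N + 1 / 2 - Y * \<bar>v\<bar>"
  have "0 < t * ?r" using N by linarith
  then have r: "?r > 0" using t by (rule zero_less_mult_pos)
  have "\<bar>Im w * v\<bar> \<le> Y * \<bar>v\<bar>" unfolding abs_mult using w by (intro mult_right_mono) auto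
  then have R: "?r \<le> \<bar>Re w - Im w * v\<bar>" using w(1) by linarith
  then have "t * ?r \<le> t * \<bar>Re w - Im w * v\<bar>" using t by simp
  also have "\<dots> = \<bar>Re (w * z)\<bar>" unfolding Re_mult_z abs_mult using t by simp
  finally have "1 \<le> \<bar>Re (w * z)\<bar>" using N by linarith
  then have k: "norm (kern (w * z)) \<le> 32"
    using kern_bounded_right[of "w * z"] kern_bounded_right[of "- (w * z)"] by (auto simp: kern_uminus abs_if split: if_splits)
  have "norm (exp (- (w\<^sup>2 * z))) \<le> exp (- (t * ?r\<^sup>2)) * exp ((3 * pi / c)\<^sup>2 * \<rho>)"
  proof -
    have "?r\<^sup>2 \<le> (Re w - Im w * v)\<^sup>2"
      using power_mono[OF R, of 2] r by simp
    moreover have "(Im w)\<^sup>2 \<le> Y\<^sup>2" using w(2) power_mono[OF w(2), of 2] by simp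
    ultimately show ?thesis
      unfolding norm_gauss Y_rules(3)[symmetric] exp_add[symmetric] using t one_plus_v
      by (intro exp_le_cancel_iff[THEN iffD2] add_mono le_imp_neg_le mult_left_mono mult_right_mono) auto
  qed
  also have "\<dots> \<le> 1 / (1 + t * ?r\<^sup>2) * exp ((3 * pi / c)\<^sup>2 * \<rho>)"
    using t by (intro mult_right_mono exp_minus_le) auto
  finally have g: "norm (exp (- (w\<^sup>2 * z))) \<le> 1 / (1 + t * ?r\<^sup>2) * exp ((3 * pi / c)\<^sup>2 * \<rho>)" .
  have s: "1 \<le> norm (sin (of_real pi * w))" by (rule norm_sin_half_integer_ge_1[OF w(1)])
  have "norm (exp (- (w\<^sup>2 * z))) * norm (kern (w * z)) / norm (sin (of_real pi * w)) \<le>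
      (1 / (1 + t * ?r\<^sup>2) * exp ((3 * pi / c)\<^sup>2 * \<rho>)) * 32 / 1"
    using g k s t by (intro frac_le mult_mono) auto
  then show ?thesis by (simp add: H_def norm_mult norm_divide mult_ac)
qed

lemma alt_sum_approx_finite:
  assumes B: "\<And>x. \<bar>Im x - 3 * pi / c\<bar> \<le> \<bar>v\<bar> * \<bar>Re x\<bar> \<Longrightarrow> norm (kern x) \<le> B"
    and N: "\<bar>Re w\<^sub>0\<bar> < real N + 1 / 2" "t * (real N + 1 / 2 - Y * \<bar>v\<bar>) \<ge> 1"
  shows "norm (of_real pi * main_residue - (\<Sum>k<N. alt_term k)) \<le>
     B * exp ((3 * pi / c)\<^sup>2 * \<rho>) / sh * pi / (2 * sqrt t) +
     32 * exp ((3 * pi / c)\<^sup>2 * \<rho>) * Y / (1 + t * (real N + 1 / 2 - Y * \<bar>v\<bar>)\<^sup>2)"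
proof -
  define R where "R = real N + 1 / 2"
  have R: "R > 0" by (simp add: R_def)
  define K where "K = B * exp ((3 * pi / c)\<^sup>2 * \<rho>) / sh"
  define V where "V = 32 * exp ((3 * pi / c)\<^sup>2 * \<rho>) / (1 + t * (R - Y * \<bar>v\<bar>)\<^sup>2)"
  have K: "K \<ge> 0"
  proof -
    have "0 \<le> B" using B[of "Complex 0 (3 * pi / c)"] order_trans[OF norm_ge_zero] by fastforce
    then show ?thesis using sh_pos by (simp add: K_def)
  qed
  have V: "V \<ge> 0" unfolding V_def using t by (intro divide_nonneg_nonneg add_nonneg_nonneg) auto
  let ?p1 = "Complex (- R) (- Y)" and ?p2 = "Complex R (- Y)" and ?p3 = "Complex R Y" and ?p4 = "Complex (- R) Y"
  note rect = contour_integral_rectangle[OF N(1), folded R_def]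
  have cont: "continuous_on (path_image (rectpath ?p1 ?p3)) H"
    using rect(2) by (intro holomorphic_on_imp_continuous_on holomorphic_on_subset[OF holomorphic_H])
  have segs: "path_image (rectpath ?p1 ?p3) = closed_segment ?p1 ?p2 \<union> closed_segment ?p2 ?p3 \<union>
      closed_segment ?p3 ?p4 \<union> closed_segment ?p4 ?p1"
    by (simp add: rectpath_def Let_def path_image_join Un_assoc)
  have c12: "continuous_on (closed_segment ?p1 ?p2) H" and c23: "continuous_on (closed_segment ?p2 ?p3) H"
    and c34: "continuous_on (closed_segment ?p3 ?p4) H" and c41: "continuous_on (closed_segment ?p4 ?p1) H"
    by (rule continuous_on_subset[OF cont], use segs in blast)+
  note int = c12[THEN contour_integrable_continuous_linepath] c23[THEN contour_integrable_continuous_linepath]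
    c34[THEN contour_integrable_continuous_linepath] c41[THEN contour_integrable_continuous_linepath]
  have "contour_integral (rectpath ?p1 ?p3) H = contour_integral (linepath ?p1 ?p2) H +
      (contour_integral (linepath ?p2 ?p3) H + (contour_integral (linepath ?p3 ?p4) H + contour_integral (linepath ?p4 ?p1) H))"
    using int by (simp add: rectpath_def Let_def contour_integrable_join)
  also have "norm \<dots> \<le> K * pi / sqrt t + (V * (2 * Y) + (K * pi / sqrt t + V * (2 * Y)))"
  proof (intro norm_triangle_mono)
    show "norm (contour_integral (linepath ?p1 ?p2) H) \<le> K * pi / sqrt t"
    proof (rule norm_contour_integral_horizontal_le[OF c12 R t K])
      fix s
      have "H (Complex s (- Y)) = - H (Complex (- s) Y)"
        using H_uminus[of "Complex (- s) Y"] by (simp add: complex_eq_iff Complex_eq)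
      then show "norm (H (Complex s (- Y))) \<le> K / (1 + t * (s - (- Y * v))\<^sup>2)"
        using norm_H_top_le[OF B, of "- s"] power2_minus[of "s + Y * v"] by (simp add: K_def)
    qed
    have "norm (contour_integral (linepath ?p4 ?p3) H) \<le> K * pi / sqrt t"
      by (rule norm_contour_integral_horizontal_le[where s\<^sub>0 = "Y * v"])
         (use c34 R t K norm_H_top_le[OF B] in \<open>auto simp: closed_segment_commute K_def\<close>)
    then show "norm (contour_integral (linepath ?p3 ?p4) H) \<le> K * pi / sqrt t"
      using contour_integral_reverse_linepath[of ?p3 ?p4 H] c34 by simp
    have side: "norm (contour_integral (linepath p p') H) \<le> V * (2 * Y)"
      if "continuous_on (closed_segment p p') H" "\<bar>Re p\<bar> = R" "Re p' = Re p" "{Im p, Im p'} = {- Y, Y}" for p p'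
    proof -
      have "norm (p' - p) = 2 * Y"
      proof -
        have "p' - p = \<i> * of_real (Im p' - Im p)" using that by (simp add: complex_eq_iff)
        then have "norm (p' - p) = \<bar>Im p' - Im p\<bar>" by (simp only: norm_mult norm_ii norm_of_real mult_1)
        then show ?thesis using that(4) Y_rules(1) by (auto simp: doubleton_eq_iff)
      qed
      moreover have "norm (contour_integral (linepath p p') H) \<le> V * norm (p' - p)"
      proof (rule contour_integral_bound_linepath)
        show "H contour_integrable_on linepath p p'" using that(1) by (rule contour_integrable_continuous_linepath)
        fix x assume "x \<in> closed_segment p p'"
        then have "\<exists>u. 0 \<le> u \<and> u \<le> 1 \<and> x = (1 - u) *\<^sub>R p + u *\<^sub>R p'" by (simp only: in_segment)
        then obtain u where u: "0 \<le> u" "u \<le> 1" "x = (1 - u) *\<^sub>R p + u *\<^sub>R p'" by (elim exE conjE)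
        have "Re x = Re p" unfolding u(3) by (simp add: that(3) algebra_simps)
        moreover have "\<bar>Im x\<bar> \<le> Y"
        proof -
          have "\<bar>Im x\<bar> \<le> \<bar>(1 - u) * Im p\<bar> + \<bar>u * Im p'\<bar>" unfolding u(3) by simp
          also have "\<dots> = (1 - u) * \<bar>Im p\<bar> + u * \<bar>Im p'\<bar>" using u by (simp add: abs_mult)
          also have "\<dots> = Y" using that(4) Y_rules(1) by (auto simp: doubleton_eq_iff algebra_simps)
          finally show ?thesis .
        qed
        ultimately show "norm (H x) \<le> V"
          using norm_H_side_le[of x N] that(2) N(2) by (simp add: R_def V_def)
      qed (rule V)
      ultimately show ?thesis by simp
    qed
    show "norm (contour_integral (linepath ?p2 ?p3) H) \<le> V * (2 * Y)"
      by (rule side[OF c23]) (use R in auto)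
    show "norm (contour_integral (linepath ?p4 ?p1) H) \<le> V * (2 * Y)"
      by (rule side[OF c41]) (use R in auto)
  qed
  finally have "norm (contour_integral (rectpath ?p1 ?p3) H) \<le> 2 * (K * pi / sqrt t) + 4 * (V * Y)"
    by (simp add: algebra_simps)
  moreover have "norm (contour_integral (rectpath ?p1 ?p3) H) = 4 * norm (of_real pi * main_residue - (\<Sum>k<N. alt_term k))"
    by (simp add: rect(1) norm_mult)
  moreover have "y \<le> b / 4" if "x \<le> b" "x = 4 * y" for x y b :: real using that by simp
  ultimately have "norm (of_real pi * main_residue - (\<Sum>k<N. alt_term k)) \<le> (2 * (K * pi / sqrt t) + 4 * (V * Y)) / 4"
    by blast
  also have "\<dots> = K * pi / (2 * sqrt t) + V * Y" by simp
  finally show ?thesis unfolding R_def K_def V_def by simp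
qed

text \<open>In \<open>alt_sum_approx_finite\<close> only the term of the vertical sides depends on
  N, and it tends to 0.\<close>

lemma alt_sum_approx:
  assumes B: "\<And>x. \<bar>Im x - 3 * pi / c\<bar> \<le> \<bar>v\<bar> * \<bar>Re x\<bar> \<Longrightarrow> norm (kern x) \<le> B"
    and S: "alt_term sums S"
  shows "norm (of_real pi * main_residue - S) \<le> B * exp ((3 * pi / c)\<^sup>2 * \<rho>) / sh * pi / (2 * sqrt t)"
proof -
  let ?K = "B * exp ((3 * pi / c)\<^sup>2 * \<rho>) / sh * pi / (2 * sqrt t)"
  let ?V = "\<lambda>N. 32 * exp ((3 * pi / c)\<^sup>2 * \<rho>) * Y / (1 + t * (real N + 1 / 2 - Y * \<bar>v\<bar>)\<^sup>2)"
  have "(\<lambda>N. norm (of_real pi * main_residue - (\<Sum>k<N. alt_term k))) \<longlonglongrightarrow> norm (of_real pi * main_residue - S)"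
    using S unfolding sums_def by (intro tendsto_intros)
  moreover have "?V \<longlonglongrightarrow> 0"
    using t by real_asymp
  then have "(\<lambda>N. ?K + ?V N) \<longlonglongrightarrow> ?K + 0" by (intro tendsto_intros)
  moreover have "\<forall>\<^sub>F N in sequentially. norm (of_real pi * main_residue - (\<Sum>k<N. alt_term k)) \<le> ?K + ?V N"
  proof -
    have "\<forall>\<^sub>F N in sequentially. \<bar>Re w\<^sub>0\<bar> < real N + 1 / 2" by real_asymp
    moreover have "\<forall>\<^sub>F N in sequentially. t * (real N + 1 / 2 - Y * \<bar>v\<bar>) \<ge> 1" using t by real_asymp
    ultimately show ?thesis
      by eventually_elim (rule alt_sum_approx_finite[OF B])
  qed
  ultimately show ?thesis using tendsto_le[OF sequentially_bot] by fastforce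
qed

end

section \<open>The coefficients\<close>

lemma integral_exp_period:
  fixes t :: real and m :: int
  shows "((\<lambda>\<theta>. exp (of_int m * Complex t \<theta>)) has_integral (if m = 0 then 2 * of_real pi else 0)) {- pi..pi}"
proof (cases "m = 0")
  case True
  then show ?thesis using has_integral_const_real[of "1 :: complex" "- pi" pi]
    by (simp add: scaleR_conv_of_real)
next
  case False
  let ?F = "\<lambda>\<theta>. exp (of_int m * Complex t \<theta>) / (of_int m * \<i>)"
  have "((\<lambda>\<theta>. exp (of_int m * Complex t \<theta>)) has_integral (?F pi - ?F (- pi))) {- pi..pi}"
  proof (rule fundamental_theorem_of_calculus)
    fix \<theta> :: real
    have C: "Complex t = (\<lambda>\<theta>. of_real t + \<i> * of_real \<theta>)" by (simp add: fun_eq_iff complex_eq_iff)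
    show "(?F has_vector_derivative exp (of_int m * Complex t \<theta>)) (at \<theta> within {- pi..pi})"
      unfolding C
      by (rule has_vector_derivative_real_field[where f = "\<lambda>w. exp (of_int m * (of_real t + \<i> * w)) / (of_int m * \<i>)"])
         (use False in \<open>auto intro!: derivative_eq_intros\<close>)
  qed simp
  moreover have "exp (of_int m * Complex t pi) = exp (of_int m * Complex t (- pi))"
  proof -
    have "of_int m * Complex t pi = of_int m * Complex t (- pi) + of_int (2 * m) * (of_real pi * \<i>)"
      by (simp add: complex_eq_iff)
    moreover have "exp (of_int (2 * m) * (of_real pi * \<i>)) = (1::complex)"
      by (simp add: exp_eq_1)
    ultimately show ?thesis by (simp only: exp_add mult_1_right)
  qed
  ultimately show ?thesis using False by simp
qed

lemma coefficient_integral: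
  fixes a :: "nat \<Rightarrow> real" and f :: "complex \<Rightarrow> complex"
  assumes f: "\<And>q. norm q < 1 \<Longrightarrow> (\<lambda>k. of_real (a k) * q ^ k) sums f q" and t: "t > 0"
  shows "((\<lambda>\<theta>. f (exp (- Complex t \<theta>)) * exp (of_nat n * Complex t \<theta>)) has_integral of_real (2 * pi * a n)) {- pi..pi}"
proof -
  define g where "g = (\<lambda>k \<theta>. of_real (a k) * exp (of_int (int n - int k) * Complex t \<theta>))"
  have g_eq: "g k \<theta> = of_real (a k) * exp (- Complex t \<theta>) ^ k * exp (of_nat n * Complex t \<theta>)" for k \<theta>
    unfolding g_def exp_of_nat_mult[symmetric] by (simp add: mult.assoc algebra_simps flip: exp_add)
  have C: "Complex t = (\<lambda>\<theta>. of_real t + \<i> * of_real \<theta>)" by (simp add: fun_eq_iff complex_eq_iff)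
  have cont: "continuous_on {- pi..pi} (g k)" for k
    unfolding g_def C by (intro continuous_intros)
  define r where "r = exp (- t)"
  \<comment> \<open>Convergence at the larger radius e^{-t/2} forces absolute convergence on the
    circle of radius e^{-t}, which allows integration term by term.\<close>
  have sm: "summable (\<lambda>k. norm (of_real (a k) * (of_real r :: complex) ^ k))"
  proof (rule powser_insidea)
    show "norm (of_real r :: complex) < norm (of_real (exp (- t / 2)) :: complex)" using t by (simp add: r_def)
    show "summable (\<lambda>k. of_real (a k) * (of_real (exp (- t / 2)) :: complex) ^ k)"
      by (rule sums_summable, rule f) (use t in simp)
  qed
  have "uniform_limit {- pi..pi} (\<lambda>N \<theta>. \<Sum>k<N. g k \<theta>) (\<lambda>\<theta>. \<Sum>k. g k \<theta>) sequentially"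
  proof (rule Weierstrass_m_test)
    fix k \<theta>
    have "norm (g k \<theta>) = norm (of_real (a k) * (of_real r :: complex) ^ k) * exp (n * t)"
      unfolding g_eq norm_mult norm_power by (simp add: r_def)
    then show "norm (g k \<theta>) \<le> norm (of_real (a k) * (of_real r :: complex) ^ k) * exp (n * t)" by simp
    show "summable (\<lambda>k. norm (of_real (a k) * (of_real r :: complex) ^ k) * exp (n * t))"
      using sm by (rule summable_mult2)
  qed
  then obtain I J where I: "\<And>N. ((\<lambda>\<theta>. \<Sum>k<N. g k \<theta>) has_integral I N) {- pi..pi}"
    and J: "((\<lambda>\<theta>. \<Sum>k. g k \<theta>) has_integral J) {- pi..pi}" and lim: "I \<longlonglongrightarrow> J"
    by (rule uniform_limit_integral) (auto intro!: continuous_intros cont)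
  have "I N = of_real (2 * pi * a n)" if "N > n" for N
  proof -
    have "((\<lambda>\<theta>. \<Sum>k<N. g k \<theta>) has_integral (\<Sum>k<N. of_real (a k) * (if int n - int k = 0 then 2 * of_real pi else 0))) {- pi..pi}"
      unfolding g_def by (intro has_integral_sum has_integral_mult_right integral_exp_period) auto
    then have "I N = (\<Sum>k<N. of_real (a k) * (if int n - int k = 0 then 2 * of_real pi else 0))"
      using I has_integral_unique by blast
    also have "\<dots> = (\<Sum>k<N. if k = n then of_real (2 * pi * a n) else 0)"
      by (intro sum.cong) auto
    also have "\<dots> = of_real (2 * pi * a n)" using that by simp
    finally show ?thesis .
  qed
  then have "\<forall>\<^sub>F N in sequentially. I N = of_real (2 * pi * a n)"
    using eventually_gt_at_top[of n] by (rule eventually_mono[rotated])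
  then have "I \<longlonglongrightarrow> of_real (2 * pi * a n)" by (rule tendsto_eventually)
  then have "J = of_real (2 * pi * a n)" using lim LIMSEQ_unique by blast
  moreover have "(\<Sum>k. g k \<theta>) = f (exp (- Complex t \<theta>)) * exp (of_nat n * Complex t \<theta>)" for \<theta>
  proof -
    have "(\<lambda>k. of_real (a k) * exp (- Complex t \<theta>) ^ k) sums f (exp (- Complex t \<theta>))"
      by (rule f) (use t in simp)
    from sums_mult2[OF this, of "exp (of_nat n * Complex t \<theta>)"] show ?thesis
      by (simp add: g_eq sums_iff)
  qed
  ultimately show ?thesis using J by simp
qed

lemma gf_overpartitions_exp:
  assumes "Re z > 0"
  shows "gf (exp (- z)) overpartitions = exp (log_gf z)"
proof -
  have "of_real (2 / odd_real m) / (exp (of_real (odd_real m) * z) - 1) =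
      2 / of_nat (2 * m + 1) * (exp (- z) ^ (2 * m + 1) / (1 - exp (- z) ^ (2 * m + 1)))" for m
  proof -
    have e: "exp (- z) ^ (2 * m + 1) = inverse (exp (of_real (odd_real m) * z))"
      unfolding exp_of_nat_mult[symmetric] odd_real_def by (simp add: exp_minus[symmetric] del: of_nat_Suc)
    have "inverse x / (1 - inverse x) = 1 / (x - 1)" if "x \<noteq> 0" for x :: complex
      using that by (simp add: field_simps)
    from this[OF exp_not_eq_zero] show ?thesis unfolding e by (simp add: odd_real_def del: of_nat_Suc)
  qed
  then show ?thesis
    using assms by (subst gf_overpartitions) (simp_all only: log_gf_def norm_exp_eq_Re, simp_all)
qed

lemma log_gf_of_real_Re: "t > 0 \<Longrightarrow> log_gf (of_real t) = of_real (Re (log_gf (of_real t)))"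
proof -
  assume t: "t > 0"
  have "(\<lambda>m. of_real (2 / odd_real m / (exp (odd_real m * t) - 1))) sums log_gf (of_real t)"
    using summable_sums[OF summable_log_gf(2)[of "of_real t"]] t
    by (simp add: log_gf_def exp_of_real[symmetric])
  then have "Im (log_gf (of_real t)) = 0"
    using sums_Im by (fastforce simp: sums_iff)
  then show ?thesis by (simp add: complex_eq_iff)
qed

text \<open>A bound by absolute values. A power of 1 / (1 - |q|) is affordable on the minor arcs,
  where P is exponentially smaller than the main term.\<close>

lemma norm_theta_sum_le:
  assumes q: "norm q < 1" and ab: "a < b" "2 * b \<le> c"
  shows "norm (\<Sum>k. theta_term a b c q k) \<le> 8 / (1 - norm q) ^ 3"
proof -
  define r where "r = norm q"
  have r: "0 \<le> r" "r < 1" using q by (auto simp: r_def)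
  have le: "norm (theta_term a b c q k) \<le> 8 / (1 - r)\<^sup>2 * r ^ k" for k
  proof -
    have p: "norm (1 - q ^ n) \<le> 2" for n
    proof -
      have "norm (q ^ n) \<le> 1" using q by (simp add: norm_power power_le_one)
      then show ?thesis using norm_triangle_ineq4[of 1 "q ^ n"] by simp
    qed
    have pow: "norm (q ^ ((Suc k)\<^sup>2 + a * Suc k)) \<le> r ^ k"
      unfolding norm_power r_def[symmetric]
      using r by (intro power_decreasing) (auto simp: power2_eq_square)
    obtain m where m: "c * Suc k = Suc m" using ab by (cases "c * Suc k") auto
    have D: "(1 - r)\<^sup>2 \<le> norm ((1 + q ^ Suc k) * (1 - q ^ (c * Suc k)))"
      unfolding norm_mult power2_eq_square m r_def
      using q by (intro mult_mono norm_one_plus_power_ge) auto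
    have "norm ((-1) ^ k * q ^ ((Suc k)\<^sup>2 + a * Suc k) * (1 - q ^ Suc k) * (1 - q ^ ((b - a) * Suc k)) * (1 - q ^ ((c - a - b) * Suc k)))
        \<le> 1 * r ^ k * 2 * 2 * 2"
      unfolding norm_mult by (intro mult_mono pow p) (use r in \<open>auto simp: norm_power\<close>)
    then have "norm (theta_term a b c q k) \<le> (1 * r ^ k * 2 * 2 * 2) / (1 - r)\<^sup>2"
      unfolding theta_term_def norm_divide using D r by (intro frac_le) auto
    then show ?thesis by simp
  qed
  have "norm (\<Sum>k. theta_term a b c q k) \<le> (\<Sum>k. 8 / (1 - r)\<^sup>2 * r ^ k)"
    using r by (intro norm_suminf_le[OF le] summable_mult summable_geometric) auto
  also have "\<dots> = 8 / (1 - r)\<^sup>2 * (1 / (1 - r))"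
    using r by (subst suminf_mult) (auto simp: suminf_geometric intro!: summable_geometric)
  also have "\<dots> = 8 / (1 - r) ^ 3" by (simp add: power2_eq_square power3_eq_cube)
  finally show ?thesis by (simp add: r_def)
qed

context rank_kernel_point begin

lemma alt_term_eq_theta_term:
  assumes "d = b - a" "e = c - a - b" and v: "b \<le> c"
  shows "alt_term k = theta_term a b c (exp (- z)) k"
proof -
  define X where "X = exp (- (of_nat (Suc k) * z))"
  have q: "exp (- z) ^ (n * Suc k) = X ^ n" for n
    unfolding X_def exp_of_nat_mult[symmetric] by (simp only: of_nat_mult mult_ac mult_minus_right)
  have q1: "exp (- z) ^ Suc k = X" using q[of 1] by simp
  have "norm X < 1" using t by (simp add: X_def del: of_nat_Suc)
  then have X: "1 - X \<noteq> 0" by auto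
  have sq: "exp (- z) ^ (Suc k)\<^sup>2 = exp (- ((of_nat (Suc k))\<^sup>2 * z))"
    unfolding exp_of_nat_mult[symmetric] by (simp del: of_nat_Suc)
  have "1 / (\<Sum>j<c. X ^ j) = (1 - X) / (1 - X ^ c)"
    using geometric[of X] X by (metis nonzero_divide_mult_cancel_left)
  then have "1 / den (of_nat (Suc k) * z) = (1 - X) / ((1 + X) * (1 - X ^ c))"
    unfolding den_def X_def[symmetric] by (metis divide_divide_eq_left mult.commute times_divide_times_eq mult_1)
  then have "kern (of_nat (Suc k) * z) = num (of_nat (Suc k) * z) * ((1 - X) / ((1 + X) * (1 - X ^ c)))"
    unfolding kern_def by (metis mult.right_neutral times_divide_eq_right)
  then show ?thesis
    unfolding alt_term_def theta_term_def power_add q q1 sq num_def X_def[symmetric] assms(1,2)[symmetric]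
    by (simp add: mult_ac)
qed

end

section \<open>The saddle point\<close>

text \<open>With R / t^2 in the place of n, the point t is the saddle: the linear terms in v cancel,
  and what remains is real and quadratic, or imaginary and cubic, to leading order.\<close>

lemma saddle_exponent:
  assumes t: "t > 0"
  shows "of_real R / Complex t (t * v) + of_real (R / t\<^sup>2) * Complex t (t * v) =
    of_real (R / t * (2 - v\<^sup>2 / (1 + v\<^sup>2))) + \<i> * of_real (R / t * (v ^ 3 / (1 + v\<^sup>2)))"
proof -
  define N where "N = 1 + v\<^sup>2"
  have N: "N \<noteq> 0" "v\<^sup>2 = N - 1" by (simp_all add: N_def add_pos_nonneg less_imp_neq[THEN not_sym])
  have v3: "v ^ 3 = v * (N - 1)" by (simp add: power3_eq_cube N(2)[symmetric] power2_eq_square)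
  have z: "Complex t (t * v) = of_real t * (1 + \<i> * of_real v)" by (simp add: complex_eq_iff)
  have "(1 + \<i> * of_real v) * (1 - \<i> * of_real v) = of_real N"
    by (simp add: N_def complex_eq_iff power2_eq_square)
  moreover have "1 + \<i> * of_real v \<noteq> 0" by (simp add: complex_eq_iff)
  ultimately have inv: "1 / (1 + \<i> * of_real v) = (1 - \<i> * of_real v) / of_real N"
    using N by (simp add: field_simps)
  have "of_real R / Complex t (t * v) = of_real (R / t) * (1 / (1 + \<i> * of_real v))"
    unfolding z by simp
  also have "\<dots> + of_real (R / t\<^sup>2) * Complex t (t * v) =
      of_real (R / t) * ((1 - \<i> * of_real v) / of_real N + (1 + \<i> * of_real v))"
    unfolding inv z using t by (simp add: power2_eq_square distrib_left)
  also have "(1 - \<i> * of_real v) / of_real N + (1 + \<i> * of_real v) =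
      of_real (2 - v\<^sup>2 / N) + \<i> * of_real (v ^ 3 / N)"
    using N(1) unfolding v3 N(2) by (simp add: complex_eq_iff field_simps)
  finally show ?thesis unfolding N_def by (simp add: distrib_left mult_ac)
qed

text \<open>The main term up to a positive factor depending on t. Here \<open>\<delta>\<close>
  stands for the deviation of the slowly varying factor of P from its value at the real point, and
  the denominator is left over from 1 / sin at the pole.\<close>

definition saddle_term :: "real \<Rightarrow> real \<Rightarrow> real \<Rightarrow> real \<Rightarrow> real \<Rightarrow> complex \<Rightarrow> complex" where
  "saddle_term K R \<beta> t v \<delta> = of_real K / Complex t (t * v) * exp (of_real R / Complex t (t * v)) * exp \<delta> /
     (1 - exp (- (of_real \<beta> / Complex t (t * v))))"

text \<open>Let L = R / t. For |v| <= L^(-1/2) the term is large and its argument small; up to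
  L^(-2/5) its real part is still nonnegative; beyond that only its size is used, which has lost the
  factor exp (- L^(1/5) / (1 + M^2)). As a lower bound is enough, no Gaussian integral has to be
  evaluated.\<close>

lemma saddle_term_lower:
  fixes K R \<beta> C M :: real
  assumes pos: "K > 0" "R > 0" "\<beta> > 0" "C \<ge> 0" "M \<ge> 0"
  shows "\<forall>\<^sub>F t in at_right 0. \<forall>v \<delta>. \<bar>v\<bar> \<le> M \<longrightarrow> norm \<delta> \<le> C * \<bar>v\<bar> \<longrightarrow>
    Re (saddle_term K R \<beta> t v \<delta> * exp (of_real (R / t\<^sup>2) * Complex t (t * v))) \<ge>
    (if \<bar>v\<bar> \<le> sqrt (t / R) then K / (2 * t) * exp (2 * (R / t) - 1) else 0) -
      2 * exp (C * M) * K / t * exp (2 * (R / t) - (R / t) powr (1 / 5) / (1 + M\<^sup>2))"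
proof -
  have M: "1 + M\<^sup>2 > 0" by (simp add: add_pos_nonneg)
  \<comment> \<open>The thresholds 1/12 here and 1/8 below put \<open>exp \<eta>\<close> within 1/4
    and \<open>D\<close> within 1/8 of 1, so that \<open>exp \<eta> / D\<close> has real part at
    least 1/2.\<close>
  have "\<forall>\<^sub>F t in at_right 0. C * (t / R) powr (2 / 5) + (t / R) powr (1 / 5) \<le> 1 / 12"
    using pos by real_asymp
  moreover have "\<forall>\<^sub>F t in at_right 0. (t / R) powr (2 / 5) + (1 + (t / R) powr (2 / 5)) * exp (- (\<beta> * (1 / (t * (1 + M\<^sup>2))))) \<le> 1 / 8"
    using pos M by real_asymp
  moreover have "\<forall>\<^sub>F t in at_right 0. exp (- (\<beta> * (1 / (t * (1 + M\<^sup>2))))) \<le> 1 / 2"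
    using pos M by real_asymp
  moreover have "\<forall>\<^sub>F t in at_right 0. t \<le> R" using pos by real_asymp
  moreover have "\<forall>\<^sub>F t in at_right 0. t > (0::real)" by (rule eventually_at_right_less)
  ultimately show ?thesis
  proof (eventually_elim, intro allI impI)
    fix t v :: real and \<delta> :: complex
    assume e1: "C * (t / R) powr (2 / 5) + (t / R) powr (1 / 5) \<le> 1 / 12"
      and e2: "(t / R) powr (2 / 5) + (1 + (t / R) powr (2 / 5)) * exp (- (\<beta> * (1 / (t * (1 + M\<^sup>2))))) \<le> 1 / 8"
      and e3: "exp (- (\<beta> * (1 / (t * (1 + M\<^sup>2))))) \<le> 1 / 2"
      and tR: "t \<le> R" and t: "t > 0" and v: "\<bar>v\<bar> \<le> M" and \<delta>: "norm \<delta> \<le> C * \<bar>v\<bar>"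
    let ?z = "Complex t (t * v)"
    define L where "L = R / t"
    \<comment> \<open>The exponent 2/5 lies between 1/3 and 1/2: L v^3 is then L^(-1/5), so the
      cubic phase is negligible up to this point, while L v^2 is L^(1/5) and the quadratic decay has
      already set in.\<close>
    define v\<^sub>1 where "v\<^sub>1 = (t / R) powr (2 / 5)"
    define P where "P = K / t * exp (L * (2 - v\<^sup>2 / (1 + v\<^sup>2)))"
    define \<eta> where "\<eta> = \<i> * of_real (L * (v ^ 3 / (1 + v\<^sup>2))) + \<delta>"
    define D where "D = (1 + \<i> * of_real v) * (1 - exp (- (of_real \<beta> / ?z)))"
    have v1v: "1 + v\<^sup>2 \<ge> 1" "1 + v\<^sup>2 > 0" by (simp_all add: add_pos_nonneg)
    have L: "L \<ge> 1" using tR t by (simp add: L_def)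
    have P: "P > 0" using pos t by (simp add: P_def)
    have tR1: "0 < t / R" "t / R \<le> 1" using t tR pos by simp_all
    have Lv3: "L * v\<^sub>1 ^ 3 = (t / R) powr (1 / 5)"
    proof -
      have "v\<^sub>1 ^ 3 = (t / R) powr (6 / 5)" using tR1 by (simp add: v\<^sub>1_def powr_powr flip: powr_numeral)
      moreover have "(t / R) powr (6 / 5) = (t / R) powr (1 / 5) * (t / R)"
        using tR1 powr_add[of "t / R" "1 / 5" 1] t pos by simp
      ultimately show ?thesis using t pos by (simp add: L_def)
    qed
    have Lv2: "L * v\<^sub>1\<^sup>2 = L powr (1 / 5)"
    proof -
      have "v\<^sub>1\<^sup>2 = (t / R) powr (4 / 5)" using tR1 by (simp add: v\<^sub>1_def powr_powr flip: powr_numeral)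
      moreover have "(t / R) powr (4 / 5) = L powr (- (4 / 5))"
        using tR1 L by (simp add: L_def powr_minus powr_divide t pos less_imp_le)
      ultimately show ?thesis using L powr_add[of L 1 "- (4 / 5)"] by simp
    qed
    have s_v1: "sqrt (t / R) \<le> v\<^sub>1"
      unfolding v\<^sub>1_def using tR1 by (simp add: powr_half_sqrt[symmetric] powr_mono')
    have z: "?z = of_real t * (1 + \<i> * of_real v)" by (simp add: complex_eq_iff)
    have U: "of_real K / ?z * exp (of_real R / ?z) * exp \<delta> / (1 - exp (- (of_real \<beta> / ?z))) * exp (of_real (R / t\<^sup>2) * ?z) =
        of_real P * (exp \<eta> / D)"
    proof -
      have "exp (of_real R / ?z) * exp (of_real (R / t\<^sup>2) * ?z) * exp \<delta> = of_real (exp (L * (2 - v\<^sup>2 / (1 + v\<^sup>2)))) * exp \<eta>"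
        unfolding exp_add[symmetric] saddle_exponent[OF t] exp_of_real[symmetric] \<eta>_def L_def by (simp add: add_ac)
      note A = this
      have gen: "k / (s * y) * a * d / w * n = (k / s) * (a * n * d) / (y * w)" for k s y a d w n :: complex
        by (simp add: mult_ac)
      have "of_real K / ?z = of_real K / (of_real t * (1 + \<i> * of_real v))" by (simp only: z)
      then have "of_real K / ?z * exp (of_real R / ?z) * exp \<delta> / (1 - exp (- (of_real \<beta> / ?z))) * exp (of_real (R / t\<^sup>2) * ?z) =
          of_real K / of_real t * (exp (of_real R / ?z) * exp (of_real (R / t\<^sup>2) * ?z) * exp \<delta>) / D"
        unfolding D_def by (simp only: gen)
      also have "\<dots> = of_real P * (exp \<eta> / D)" unfolding A P_def by simp
      finally show ?thesis .
    qed
    have q: "norm (exp (- (of_real \<beta> / ?z))) \<le> exp (- (\<beta> * (1 / (t * (1 + M\<^sup>2)))))"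
    proof -
      have "v\<^sup>2 \<le> M\<^sup>2" using v by (metis abs_ge_zero power2_abs power_mono)
      then have "1 / (t * (1 + M\<^sup>2)) \<le> 1 / (t * (1 + v\<^sup>2))"
        using t v1v M by (intro divide_left_mono mult_left_mono mult_pos_pos) auto
      moreover have "Re (of_real \<beta> / ?z) = \<beta> * (1 / (t * (1 + v\<^sup>2)))"
      proof -
        have "Re (of_real \<beta> / ?z) = \<beta> * t / (t\<^sup>2 + (t * v)\<^sup>2)" by (simp add: Re_divide)
        also have "t\<^sup>2 + (t * v)\<^sup>2 = t * (t * (1 + v\<^sup>2))" by (simp add: power2_eq_square algebra_simps)
        finally show ?thesis using t by simp
      qed
      ultimately have "\<beta> * (1 / (t * (1 + M\<^sup>2))) \<le> Re (of_real \<beta> / ?z)"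
        using pos(3) by (simp only:) (intro mult_left_mono, auto)
      then show ?thesis by (simp only: norm_exp_eq_Re uminus_complex.sel exp_le_cancel_iff neg_le_iff_le)
    qed
    have n1: "norm (1 + \<i> * of_real v) \<ge> 1"
      using abs_Re_le_cmod[of "1 + \<i> * of_real v"] by simp
    show "Re (saddle_term K R \<beta> t v \<delta> * exp (of_real (R / t\<^sup>2) * ?z)) \<ge>
      (if \<bar>v\<bar> \<le> sqrt (t / R) then K / (2 * t) * exp (2 * (R / t) - 1) else 0) -
      2 * exp (C * M) * K / t * exp (2 * (R / t) - (R / t) powr (1 / 5) / (1 + M\<^sup>2))"
    proof (cases "\<bar>v\<bar> \<le> v\<^sub>1")
      case True
      have "norm \<eta> \<le> 1 / 12"
      proof -
        have "\<bar>v ^ 3 / (1 + v\<^sup>2)\<bar> \<le> \<bar>v ^ 3\<bar> / 1" unfolding abs_divide using v1v by (intro frac_le) auto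
        also have "\<dots> \<le> v\<^sub>1 ^ 3" using True by (simp add: power_abs power_mono)
        finally have "L * \<bar>v ^ 3 / (1 + v\<^sup>2)\<bar> \<le> L * v\<^sub>1 ^ 3"
          using L by (intro mult_left_mono) auto
        moreover have "norm (\<i> * of_real (L * w)) = L * \<bar>w\<bar>" for w :: real
          using L by (simp add: norm_mult abs_mult)
        ultimately have "norm (\<i> * of_real (L * (v ^ 3 / (1 + v\<^sup>2)))) \<le> L * v\<^sub>1 ^ 3" by (simp only:)
        moreover have "C * \<bar>v\<bar> \<le> C * v\<^sub>1" using True pos by (intro mult_left_mono) auto
        ultimately show ?thesis
          unfolding \<eta>_def using \<delta> e1 norm_triangle_ineq[of "\<i> * of_real (L * (v ^ 3 / (1 + v\<^sup>2)))" \<delta>]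
          by (simp only: Lv3 v\<^sub>1_def[symmetric])
      qed
      then have exp_\<eta>: "norm (exp \<eta> - 1) \<le> 1 / 4" using norm_exp_bounds(2)[of \<eta>] by simp
      have D1: "norm (D - 1) \<le> 1 / 8"
      proof -
        have "D - 1 = \<i> * of_real v - (1 + \<i> * of_real v) * exp (- (of_real \<beta> / ?z))"
          by (simp add: D_def algebra_simps)
        also have "norm \<dots> \<le> \<bar>v\<bar> + norm (1 + \<i> * of_real v) * norm (exp (- (of_real \<beta> / ?z)))"
          by (rule order_trans[OF norm_triangle_ineq4]) (simp add: norm_mult)
        also have "\<dots> \<le> v\<^sub>1 + (1 + v\<^sub>1) * exp (- (\<beta> * (1 / (t * (1 + M\<^sup>2)))))"
        proof (intro add_mono mult_mono True q)
          show "norm (1 + \<i> * of_real v) \<le> 1 + v\<^sub>1"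
            using norm_triangle_ineq[of 1 "\<i> * of_real v"] True by (simp add: norm_mult)
        qed (simp_all add: v\<^sub>1_def)
        finally show ?thesis using e2 by (simp add: v\<^sub>1_def)
      qed
      have D7: "norm D \<ge> 7 / 8" using D1 norm_triangle_ineq2[of 1 "1 - D"] by (simp add: norm_minus_commute)
      then have "D \<noteq> 0" by auto
      then have "exp \<eta> / D - 1 = ((exp \<eta> - 1) - (D - 1)) / D" by (simp add: diff_divide_distrib)
      then have "norm (exp \<eta> / D - 1) = norm ((exp \<eta> - 1) - (D - 1)) / norm D" by (simp only: norm_divide)
      also have "\<dots> \<le> (1 / 4 + 1 / 8) / (7 / 8)"
        using D7 order_trans[OF norm_triangle_ineq4 add_mono[OF exp_\<eta> D1]] by (intro frac_le) auto
      finally have "norm (exp \<eta> / D - 1) \<le> 1 / 2" by simp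
      then have X: "Re (exp \<eta> / D) \<ge> 1 / 2" using abs_Re_le_cmod[of "exp \<eta> / D - 1"] by simp
      have "Re (of_real P * (exp \<eta> / D)) = P * Re (exp \<eta> / D)" by (simp only: Re_complex_of_real Im_complex_of_real times_complex.sel mult_zero_left diff_zero)
      also have "\<dots> \<ge> P * (1 / 2)" using X P by (intro mult_left_mono) auto
      finally have ReU: "Re (of_real P * (exp \<eta> / D)) \<ge> P / 2" by simp
      have ind: "P / 2 \<ge> (if \<bar>v\<bar> \<le> sqrt (t / R) then K / (2 * t) * exp (2 * (R / t) - 1) else 0)"
      proof (cases "\<bar>v\<bar> \<le> sqrt (t / R)")
        case True
        then have "v\<^sup>2 \<le> t / R" using tR1 by (metis abs_ge_zero power2_abs power_mono real_sqrt_pow2 less_imp_le)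
        moreover have "v\<^sup>2 / (1 + v\<^sup>2) \<le> v\<^sup>2 / 1" using v1v by (intro divide_left_mono) auto
        ultimately have "L * (v\<^sup>2 / (1 + v\<^sup>2)) \<le> L * (t / R)" using L by (intro mult_left_mono) auto
        also have "\<dots> = 1" using t pos by (simp add: L_def)
        finally have "2 * L - 1 \<le> L * (2 - v\<^sup>2 / (1 + v\<^sup>2))" by (simp add: right_diff_distrib)
        then have "K / t * exp (2 * L - 1) \<le> P" unfolding P_def using pos t by (intro mult_left_mono) auto
        then show ?thesis using True by (simp add: L_def)
      qed (use P in simp)
      have "0 \<le> 2 * exp (C * M) * K / t * exp (2 * (R / t) - (R / t) powr (1 / 5) / (1 + M\<^sup>2))"
        using pos t by simp
      then show ?thesis unfolding saddle_term_def U using ReU ind by linarith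
    next
      case False
      then have vs: "\<not> \<bar>v\<bar> \<le> sqrt (t / R)" using s_v1 by linarith
      have D2: "norm D \<ge> 1 / 2"
      proof -
        have "1 / 2 \<le> norm (1 - exp (- (of_real \<beta> / ?z)))"
          using order_trans[OF q e3] norm_triangle_ineq2[of 1 "exp (- (of_real \<beta> / ?z))"]
          unfolding norm_one by linarith
        then have "1 * (1 / 2) \<le> norm D" unfolding D_def norm_mult using n1 by (intro mult_mono) auto
        then show ?thesis by simp
      qed
      have E: "norm (exp \<eta>) \<le> exp (C * M)"
      proof -
        have "Re \<eta> \<le> C * M"
          using \<delta> complex_Re_le_cmod[of \<delta>] mult_left_mono[OF v pos(4)] by (simp add: \<eta>_def)
        then show ?thesis by simp
      qed
      have "norm (exp \<eta> / D) \<le> exp (C * M) / (1 / 2)" unfolding norm_divide using E D2 by (intro frac_le) auto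
      then have "norm (of_real P * (exp \<eta> / D)) \<le> P * (2 * exp (C * M))"
        unfolding norm_mult norm_of_real using P by (simp add: mult_left_mono)
      also have "P \<le> K / t * exp (2 * L - L powr (1 / 5) / (1 + M\<^sup>2))"
      proof -
        have "v\<^sub>1\<^sup>2 \<le> v\<^sup>2" using False power_mono[of v\<^sub>1 "\<bar>v\<bar>" 2] by (simp add: v\<^sub>1_def)
        moreover have "v\<^sup>2 \<le> M\<^sup>2" using v by (metis abs_ge_zero power2_abs power_mono)
        ultimately have "v\<^sub>1\<^sup>2 / (1 + M\<^sup>2) \<le> v\<^sup>2 / (1 + v\<^sup>2)" using v1v by (intro frac_le) auto
        then have "L * (v\<^sub>1\<^sup>2 / (1 + M\<^sup>2)) \<le> L * (v\<^sup>2 / (1 + v\<^sup>2))" using L by (intro mult_left_mono) auto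
        then have "L powr (1 / 5) / (1 + M\<^sup>2) \<le> L * (v\<^sup>2 / (1 + v\<^sup>2))" by (simp add: Lv2)
        then have "L * (2 - v\<^sup>2 / (1 + v\<^sup>2)) \<le> 2 * L - L powr (1 / 5) / (1 + M\<^sup>2)" by (simp add: right_diff_distrib)
        then show ?thesis unfolding P_def using pos t by (intro mult_left_mono) auto
      qed
      finally have "norm (of_real P * (exp \<eta> / D)) \<le> K / t * exp (2 * L - L powr (1 / 5) / (1 + M\<^sup>2)) * (2 * exp (C * M))"
        by simp
      then show ?thesis
        unfolding saddle_term_def U using vs abs_Re_le_cmod[of "of_real P * (exp \<eta> / D)"] by (simp add: L_def mult_ac)
    qed
  qed
qed

section \<open>The competing exponents and the major arc\<close>

context rank_kernel begin

definition rate :: real where "rate = (pi / 2 - 2 * pi / c)\<^sup>2"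
definition rate' :: real where "rate' = (pi / 2 - 3 * pi / c)\<^sup>2"

lemma rate_bounds: "rate > 2 / 5" "rate' < rate"
proof -
  have c2: "2 * pi / c \<le> 2 * pi / 7" by (rule divide_left_mono) (use c in auto)
  have c3: "3 * pi / c \<le> 3 * pi / 7" by (rule divide_left_mono) (use c in auto)
  have c23: "2 * pi / c < 3 * pi / c" by (rule divide_strict_right_mono) (use c in auto)
  \<comment> \<open>The extreme case is c = 7 with 3 pi/14, about 0.673.\<close>
  have "0.67 \<le> pi / 2 - 2 * pi / c" using c2 pi_approx by simp
  then have "0.67\<^sup>2 \<le> rate" unfolding rate_def by (intro power_mono) auto
  then show "rate > 2 / 5" by (simp add: power2_eq_square)
  have "0 \<le> pi / 2 - 3 * pi / c" using c3 pi_gt_zero by linarith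
  then show "rate' < rate" unfolding rate_def rate'_def using c23 by (intro power_strict_mono) auto
qed

end

context rank_kernel_point begin

lemma Re_of_real_divide_z: "Re (of_real x / z) = x * \<rho>"
proof -
  have "Im (\<i> * of_real x / z) = Re (of_real x / z)" by (simp flip: times_divide_eq_right)
  then show ?thesis using Im_divide_z[of x] by simp
qed

lemma norm_exp_of_real_divide_z: "norm (exp (of_real x / z)) = exp (x * \<rho>)"
  by (simp only: norm_exp_eq_Re Re_of_real_divide_z)

lemma \<rho>_le: "\<rho> \<le> 1 / t"
  unfolding \<rho>_def using t one_plus_v by (intro divide_left_mono mult_pos_pos) auto

lemma \<rho>_ge: "\<bar>v\<bar> \<le> M \<Longrightarrow> 1 / (t * (1 + M\<^sup>2)) \<le> \<rho>"
proof -
  assume "\<bar>v\<bar> \<le> M"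
  then have "v\<^sup>2 \<le> M\<^sup>2" by (metis abs_ge_zero power2_abs power_mono)
  then show ?thesis
    unfolding \<rho>_def using t one_plus_v by (intro divide_left_mono mult_left_mono mult_pos_pos) (auto simp: add_pos_nonneg)
qed

text \<open>Dividing by \<open>sh\<close>, which is of order e^{pi Y}, completes the square: pi^2/4
  + (3 pi/c)^2 - 3 pi^2/c = \<open>rate'\<close>. The bounds on v and t keep Y away from 0, hence
  \<open>sh\<close> comparable to e^{pi Y} with a constant depending on M and c only.\<close>

lemma error_bound:
  assumes B: "B \<ge> 0" and v: "\<bar>v\<bar> \<le> M" and t1: "t \<le> 1"
  shows "exp (pi\<^sup>2 / 4 * \<rho>) * (B * exp ((3 * pi / c)\<^sup>2 * \<rho>) / sh * pi / (2 * sqrt t)) \<le>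
    B * pi / (1 - exp (- (2 * pi * (3 * pi / c / (1 + M\<^sup>2))))) / sqrt t * exp (rate' / t)"
proof -
  define s where "s = 1 - exp (- (2 * pi * (3 * pi / c / (1 + M\<^sup>2))))"
  have M: "1 + M\<^sup>2 > 0" by (simp add: add_pos_nonneg)
  have s: "s > 0" using M c by (simp add: s_def)
  have "1 / (1 + M\<^sup>2) \<le> 1 / (t * (1 + M\<^sup>2))"
    using t t1 M by (intro divide_left_mono) (auto intro!: mult_left_le_one_le mult_pos_pos)
  then have "1 / (1 + M\<^sup>2) \<le> \<rho>" using \<rho>_ge[OF v] by linarith
  then have "3 * pi / c * (1 / (1 + M\<^sup>2)) \<le> Y" unfolding Y_def by (intro mult_left_mono) auto
  then have "2 * pi * (3 * pi / c / (1 + M\<^sup>2)) \<le> 2 * pi * Y" by (intro mult_left_mono) auto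
  then have "exp (- (2 * (pi * Y))) \<le> exp (- (2 * pi * (3 * pi / c / (1 + M\<^sup>2))))"
    by (simp only: exp_le_cancel_iff neg_le_iff_le mult.assoc)
  then have "exp (pi * Y) * s / 2 \<le> exp (pi * Y) * (1 - exp (- (2 * (pi * Y)))) / 2"
    unfolding s_def by (intro divide_right_mono mult_left_mono) auto
  also have "exp (pi * Y) * (1 - exp (- (2 * (pi * Y)))) / 2 = sh"
    by (simp add: sh_def right_diff_distrib flip: exp_add)
  finally have sh: "exp (pi * Y) * s / 2 \<le> sh" .
  have "exp (pi\<^sup>2 / 4 * \<rho>) * (B * exp ((3 * pi / c)\<^sup>2 * \<rho>) / sh * pi / (2 * sqrt t)) =
      B * pi * exp (pi\<^sup>2 / 4 * \<rho> + (3 * pi / c)\<^sup>2 * \<rho>) / (2 * sqrt t) / sh"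
    by (simp add: exp_add mult_ac)
  also have "\<dots> \<le> B * pi * exp (pi\<^sup>2 / 4 * \<rho> + (3 * pi / c)\<^sup>2 * \<rho>) / (2 * sqrt t) / (exp (pi * Y) * s / 2)"
    using sh s B t sh_pos by (intro divide_left_mono) (auto intro!: mult_pos_pos divide_nonneg_nonneg mult_nonneg_nonneg)
  also have "\<dots> = B * pi / s / sqrt t * exp (pi\<^sup>2 / 4 * \<rho> + (3 * pi / c)\<^sup>2 * \<rho> - pi * Y)"
    by (simp add: exp_diff)
  also have "pi\<^sup>2 / 4 * \<rho> + (3 * pi / c)\<^sup>2 * \<rho> - pi * Y = rate' * \<rho>"
    unfolding rate'_def Y_def by (simp add: power2_eq_square algebra_simps)
  also have "B * pi / s / sqrt t * exp (rate' * \<rho>) \<le> B * pi / s / sqrt t * exp (rate' / t)"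
  proof (intro mult_left_mono exp_le_cancel_iff[THEN iffD2])
    show "rate' * \<rho> \<le> rate' / t" using mult_left_mono[OF \<rho>_le, of rate'] by (simp add: rate'_def)
  qed (use B s t in auto)
  finally show ?thesis unfolding s_def .
qed

lemma main_term_eq:
  "exp (of_real (pi\<^sup>2 / 4) / z) * (of_real pi * main_residue) =
    of_real (8 * pi * ampl / c) / z * exp (of_real rate / z) / (1 - exp (- (of_real (4 * pi\<^sup>2 / c) / z)))"
proof -
  have "rate = pi\<^sup>2 / 4 + (4 * pi\<^sup>2 / c\<^sup>2 - 2 * pi\<^sup>2 / c)"
  proof -
    define x where "x = pi / c"
    have "2 * pi / c = 2 * x" "4 * pi\<^sup>2 / c\<^sup>2 = 4 * x\<^sup>2" "2 * pi\<^sup>2 / c = 2 * pi * x"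
      by (simp_all add: x_def power_divide power2_eq_square)
    then show ?thesis unfolding rate_def by (simp only:) (simp add: power2_eq_square algebra_simps)
  qed
  then have "exp (of_real rate / z) = exp (of_real (pi\<^sup>2 / 4) / z) * exp (of_real (4 * pi\<^sup>2 / c\<^sup>2 - 2 * pi\<^sup>2 / c) / z)"
    by (simp only: of_real_add add_divide_distrib exp_add)
  moreover have "E * (p * (8 * T * X / (n * y * W))) = 8 * p * T / n / y * (E * X) / W" for E p T X n y W :: complex
    by simp
  ultimately show ?thesis unfolding main_residue_eq by (simp only: of_real_mult of_real_divide of_real_numeral of_real_of_nat_eq)
qed

end

context rank_kernel begin

text \<open>P is split into the real number \<open>N\<close>, the factor \<open>exp \<delta>\<close>
  and exp (pi^2 / (4z)); the last is merged into the residue and into the error. Since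
  \<open>N\<close> is positive and depends on t alone, it comes out of the integral over the circle
  and does not affect the sign.\<close>

lemma major_arc:
  fixes M :: real
  assumes b: "a < b" "2 * b \<le> c" "d = b - a" "e = c - a - b" and M: "M \<ge> 0"
  shows "\<exists>C\<ge>0. \<exists>C'\<ge>0. \<forall>t v. 0 < t \<and> t \<le> 1 \<and> \<bar>v\<bar> \<le> M \<longrightarrow>
    (\<exists>\<delta> E. norm \<delta> \<le> C * \<bar>v\<bar> \<and> norm E \<le> C' / sqrt t * exp (rate' / t) \<and>
      2 * exp (log_gf (Complex t (t * v))) * (\<Sum>k. theta_term a b c (exp (- Complex t (t * v))) k) =
      of_real (exp (Re (log_gf (of_real t)) - pi\<^sup>2 / 4 / t)) *
        (saddle_term (16 * pi * ampl / c) rate (4 * pi\<^sup>2 / c) t v \<delta> + E))"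
proof -
  obtain C where C: "C \<ge> 0" "\<And>t v. t > 0 \<Longrightarrow> \<bar>v\<bar> \<le> M \<Longrightarrow>
     norm ((log_gf (Complex t (t * v)) - of_real (pi\<^sup>2 / 4) / Complex t (t * v)) -
           (log_gf (of_real t) - of_real (pi\<^sup>2 / 4) / of_real t)) \<le> C * \<bar>v\<bar>"
    using log_gf_variation[of M] by blast
  obtain B where B: "B \<ge> 0" "\<And>x. \<bar>Im x - 3 * pi / c\<bar> \<le> M * \<bar>Re x\<bar> \<Longrightarrow> norm (kern x) \<le> B"
    using kern_bounded_line[of M] by blast
  define s where "s = 1 - exp (- (2 * pi * (3 * pi / c / (1 + M\<^sup>2))))"
  have s: "s > 0" using c by (simp add: s_def add_pos_nonneg)
  define C' where "C' = 2 * exp (C * M) * (B * pi / s)"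
  have C': "C' \<ge> 0" using B s by (simp add: C'_def)
  have "\<exists>\<delta> E. norm \<delta> \<le> C * \<bar>v\<bar> \<and> norm E \<le> C' / sqrt t * exp (rate' / t) \<and>
      2 * exp (log_gf (Complex t (t * v))) * (\<Sum>k. theta_term a b c (exp (- Complex t (t * v))) k) =
      of_real (exp (Re (log_gf (of_real t)) - pi\<^sup>2 / 4 / t)) *
        (saddle_term (16 * pi * ampl / c) rate (4 * pi\<^sup>2 / c) t v \<delta> + E)"
    if tt: "0 < t" "t \<le> 1" and v: "\<bar>v\<bar> \<le> M" for t v
  proof -
    interpret rank_kernel_point a d e c t v by unfold_locales (rule tt(1))
    define S where "S = (\<Sum>k. theta_term a b c (exp (- z)) k)"
    have q: "norm (exp (- z)) < 1" using t by simp
    have "(\<lambda>k. alt_term k) = theta_term a b c (exp (- z))"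
      using alt_term_eq_theta_term[OF b(3,4)] b by (intro ext) simp
    then have S: "alt_term sums S"
      using Nbar_diff_sums(2)[OF q b(1,2)] by (simp add: S_def summable_sums)
    have kB: "norm (kern x) \<le> B" if "\<bar>Im x - 3 * pi / c\<bar> \<le> \<bar>v\<bar> * \<bar>Re x\<bar>" for x
      using that mult_right_mono[OF v, of "\<bar>Re x\<bar>"] by (intro B(2)) simp
    define D where "D = S - of_real pi * main_residue"
    have D: "norm D \<le> B * exp ((3 * pi / c)\<^sup>2 * \<rho>) / sh * pi / (2 * sqrt t)"
      unfolding D_def using alt_sum_approx[OF kB S] by (simp add: norm_minus_commute)
    define \<delta> where "\<delta> = (log_gf z - of_real (pi\<^sup>2 / 4) / z) - (log_gf (of_real t) - of_real (pi\<^sup>2 / 4) / of_real t)"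
    have \<delta>: "norm \<delta> \<le> C * \<bar>v\<bar>" unfolding \<delta>_def z_def by (rule C(2)[OF tt(1) v])
    define N where "N = exp (Re (log_gf (of_real t)) - pi\<^sup>2 / 4 / t)"
    define E where "E = 2 * exp \<delta> * exp (of_real (pi\<^sup>2 / 4) / z) * D"
    have "norm E = 2 * norm (exp \<delta>) * (exp (pi\<^sup>2 / 4 * \<rho>) * norm D)"
      unfolding E_def norm_mult norm_exp_of_real_divide_z by simp
    also have "\<dots> \<le> 2 * exp (C * M) * (B * pi / s / sqrt t * exp (rate' / t))"
    proof (rule mult_mono)
      have "norm \<delta> \<le> C * M" using \<delta> mult_left_mono[OF v C(1)] by linarith
      then show "2 * norm (exp \<delta>) \<le> 2 * exp (C * M)"
        using complex_Re_le_cmod[of \<delta>] by simp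
      have "exp (pi\<^sup>2 / 4 * \<rho>) * norm D \<le> exp (pi\<^sup>2 / 4 * \<rho>) * (B * exp ((3 * pi / c)\<^sup>2 * \<rho>) / sh * pi / (2 * sqrt t))"
        by (intro mult_left_mono D) auto
      also have "\<dots> \<le> B * pi / s / sqrt t * exp (rate' / t)"
        unfolding s_def by (rule error_bound[OF B(1) v tt(2)])
      finally show "exp (pi\<^sup>2 / 4 * \<rho>) * norm D \<le> B * pi / s / sqrt t * exp (rate' / t)" .
    qed auto
    finally have E: "norm E \<le> C' / sqrt t * exp (rate' / t)" by (simp add: C'_def)
    have W: "log_gf (of_real t) - of_real (pi\<^sup>2 / 4) / of_real t = of_real (Re (log_gf (of_real t)) - pi\<^sup>2 / 4 / t)"
      by (subst log_gf_of_real_Re[OF tt(1)]) simp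
    have "exp (log_gf z) = exp ((log_gf (of_real t) - of_real (pi\<^sup>2 / 4) / of_real t) + \<delta> + of_real (pi\<^sup>2 / 4) / z)"
      by (simp add: \<delta>_def)
    then have P: "exp (log_gf z) = of_real N * exp \<delta> * exp (of_real (pi\<^sup>2 / 4) / z)"
      unfolding exp_add W exp_of_real N_def .
    have "S = of_real pi * main_residue + D" by (simp add: D_def)
    then have "2 * exp (log_gf z) * S = of_real N * (2 * exp \<delta> * (exp (of_real (pi\<^sup>2 / 4) / z) * (of_real pi * main_residue)) + E)"
      unfolding P E_def by (simp add: algebra_simps)
    also have "2 * exp \<delta> * (exp (of_real (pi\<^sup>2 / 4) / z) * (of_real pi * main_residue)) =
        of_real (16 * pi * ampl / c) / z * exp (of_real rate / z) * exp \<delta> / (1 - exp (- (of_real (4 * pi\<^sup>2 / c) / z)))"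
      unfolding main_term_eq by simp
    finally show ?thesis
      using \<delta> E unfolding S_def N_def z_def saddle_term_def by blast
  qed
  then show ?thesis using C(1) C' by blast
qed

end

section \<open>Positivity of the coefficients\<close>

text \<open>The order sqrt t is that of the main contribution: a height of order 1/t on a range of
  \<open>\<theta>\<close> of length of order t sqrt t.\<close>

lemma eventually_exp_small:
  fixes A g C \<epsilon> :: real
  assumes "g > 0" "\<epsilon> > 0" "C \<ge> 0"
  shows "\<forall>\<^sub>F t in at_right 0. A / t ^ 3 * exp (C / sqrt t - g / t) \<le> \<epsilon> * sqrt t"
proof -
  have "\<forall>\<^sub>F t in at_right 0. 1 / t ^ 3 * exp (C / sqrt t - g / t) \<le> (\<epsilon> / (\<bar>A\<bar> + 1)) * sqrt t"
  proof -
    have "\<epsilon> / (\<bar>A\<bar> + 1) > 0" using assms by simp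
    moreover have "\<forall>\<^sub>F t in at_right 0. 1 / t ^ 3 * exp (C / sqrt t - g / t) \<le> \<epsilon>' * sqrt t" if "\<epsilon>' > 0" for \<epsilon>' :: real
    proof (cases "C = 0")
      case True
      then show ?thesis using assms that by simp real_asymp
    next
      case False
      then have "C > 0" using assms by simp
      then show ?thesis using assms that by real_asymp
    qed
    ultimately show ?thesis by blast
  qed
  moreover have "\<forall>\<^sub>F t in at_right 0. t > (0::real)" by (rule eventually_at_right_less)
  ultimately show ?thesis
  proof eventually_elim
    case (elim t)
    have "A / t ^ 3 * exp (C / sqrt t - g / t) \<le> (\<bar>A\<bar> + 1) * (1 / t ^ 3 * exp (C / sqrt t - g / t))"
      using elim by (simp add: divide_right_mono mult_right_mono)
    also have "\<dots> \<le> (\<bar>A\<bar> + 1) * ((\<epsilon> / (\<bar>A\<bar> + 1)) * sqrt t)"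
      using elim by (intro mult_left_mono) auto
    also have "\<dots> = \<epsilon> * sqrt t" by simp
    finally show ?case .
  qed
qed

lemma eventually_powr_small:
  fixes A g R \<epsilon> :: real
  assumes "g > 0" "\<epsilon> > 0" "R > 0"
  shows "\<forall>\<^sub>F t in at_right 0. A / t * exp (- ((R / t) powr (1 / 5) / g)) \<le> \<epsilon> * sqrt t"
proof -
  have "\<forall>\<^sub>F t in at_right 0. 1 / t * exp (- ((R / t) powr (1 / 5) / g)) \<le> \<epsilon>' * sqrt t" if "\<epsilon>' > 0" for \<epsilon>' :: real
    using assms that by real_asymp
  moreover have "\<epsilon> / (\<bar>A\<bar> + 1) > 0" using assms by simp
  ultimately have "\<forall>\<^sub>F t in at_right 0. 1 / t * exp (- ((R / t) powr (1 / 5) / g)) \<le> (\<epsilon> / (\<bar>A\<bar> + 1)) * sqrt t"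
    by blast
  moreover have "\<forall>\<^sub>F t in at_right 0. t > (0::real)" by (rule eventually_at_right_less)
  ultimately show ?thesis
  proof eventually_elim
    case (elim t)
    have "A / t * exp (- ((R / t) powr (1 / 5) / g)) \<le> (\<bar>A\<bar> + 1) * (1 / t * exp (- ((R / t) powr (1 / 5) / g)))"
      using elim by (simp add: divide_right_mono mult_right_mono)
    also have "\<dots> \<le> (\<bar>A\<bar> + 1) * ((\<epsilon> / (\<bar>A\<bar> + 1)) * sqrt t)"
      using elim by (intro mult_left_mono) auto
    also have "\<dots> = \<epsilon> * sqrt t" by simp
    finally show ?case .
  qed
qed

context rank_kernel begin

text \<open>A lower bound for the integrand relative to its size at the saddle: a plateau minus the
  errors from the tails of the saddle, from the contour and from the minor arcs. The last two are
  written in the common form required by \<open>eventually_exp_small\<close>, hence the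
  \<open>0 / sqrt t\<close>. The factor 128 is 2 * 8 * 2^3, and \<open>exp 10\<close> stems from
  \<open>Re_log_gf_minor_arc\<close>.\<close>

definition envelope :: "real \<Rightarrow> real \<Rightarrow> real \<Rightarrow> real \<Rightarrow> real \<Rightarrow> real" where
  "envelope A A' C t \<theta> =
     (if \<bar>\<theta>\<bar> \<le> t * sqrt (t / rate) then 16 * pi * ampl / c / (2 * t) * exp (- 1) else 0) -
     (A / t * exp (- ((rate / t) powr (1 / 5) / (1 + 100\<^sup>2))) +
      A' / t ^ 3 * exp (0 / sqrt t - (rate - rate') / t) +
      128 * exp 10 / t ^ 3 * exp (C / sqrt t - (rate - 2 / 5) / t))"

text \<open>The circle is cut at |\<open>\<theta>\<close>| = 100 t, where the minor arc bound starts
  to apply. On the inner part v = \<open>\<theta>\<close> / t is bounded, so the estimates for a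
  fixed M are uniform.\<close>

lemma integrand_lower_bound:
  assumes b: "a < b" "2 * b \<le> c" "d = b - a" "e = c - a - b"
  defines "F \<equiv> \<lambda>z. 2 * exp (log_gf z) * (\<Sum>k. theta_term a b c (exp (- z)) k)"
  shows "\<exists>A\<ge>0. \<exists>A'\<ge>0. \<exists>C\<ge>0. \<forall>\<^sub>F t in at_right 0. \<forall>\<theta>. \<bar>\<theta>\<bar> \<le> pi \<longrightarrow>
    Re (F (Complex t \<theta>) * exp (of_real (rate / t\<^sup>2) * Complex t \<theta>)) \<ge>
    exp (Re (log_gf (of_real t)) - pi\<^sup>2 / 4 / t) * exp (2 * (rate / t)) *
     envelope A A' C t \<theta>"
proof -
  have c0: "c > 0" using c by simp
  define K where "K = 16 * pi * ampl / c"
  have K: "K > 0" using ampl_pos c0 by (simp add: K_def)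
  have R: "rate > 0" using rate_bounds by simp
  obtain C\<^sub>1 C\<^sub>2 where C12: "C\<^sub>1 \<ge> 0" "C\<^sub>2 \<ge> 0" and major: "\<And>t v. 0 < t \<Longrightarrow> t \<le> 1 \<Longrightarrow> \<bar>v\<bar> \<le> 100 \<Longrightarrow>
    (\<exists>\<delta> E. norm \<delta> \<le> C\<^sub>1 * \<bar>v\<bar> \<and> norm E \<le> C\<^sub>2 / sqrt t * exp (rate' / t) \<and>
      F (Complex t (t * v)) = of_real (exp (Re (log_gf (of_real t)) - pi\<^sup>2 / 4 / t)) *
        (saddle_term K rate (4 * pi\<^sup>2 / c) t v \<delta> + E))"
    using major_arc[OF b, of 100] unfolding F_def K_def by auto
  obtain C\<^sub>3 where C3: "\<And>t. t > 0 \<Longrightarrow> Re (log_gf (of_real t)) \<ge> pi\<^sup>2 / 4 / t - C\<^sub>3 / sqrt t"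
    using Re_log_gf_real_ge by blast
  have "\<forall>\<^sub>F t in at_right 0. \<forall>v \<delta>. \<bar>v\<bar> \<le> 100 \<longrightarrow> norm \<delta> \<le> C\<^sub>1 * \<bar>v\<bar> \<longrightarrow>
    Re (saddle_term K rate (4 * pi\<^sup>2 / c) t v \<delta> * exp (of_real (rate / t\<^sup>2) * Complex t (t * v))) \<ge>
    (if \<bar>v\<bar> \<le> sqrt (t / rate) then K / (2 * t) * exp (2 * (rate / t) - 1) else 0) -
      2 * exp (C\<^sub>1 * 100) * K / t * exp (2 * (rate / t) - (rate / t) powr (1 / 5) / (1 + 100\<^sup>2))"
    by (rule saddle_term_lower) (use K R C12 c0 in auto)
  moreover have "\<forall>\<^sub>F t in at_right 0. t > (0::real)" by (rule eventually_at_right_less)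
  moreover have "\<forall>\<^sub>F t in at_right 0. t \<le> (1::real)" by real_asymp
  moreover have "\<forall>\<^sub>F t in at_right 0. sqrt (t / rate) \<le> 100" using R by real_asymp
  ultimately have "\<forall>\<^sub>F t in at_right 0. \<forall>\<theta>. \<bar>\<theta>\<bar> \<le> pi \<longrightarrow>
    Re (F (Complex t \<theta>) * exp (of_real (rate / t\<^sup>2) * Complex t \<theta>)) \<ge>
    exp (Re (log_gf (of_real t)) - pi\<^sup>2 / 4 / t) * exp (2 * (rate / t)) *
     envelope (2 * exp (C\<^sub>1 * 100) * K) C\<^sub>2 \<bar>C\<^sub>3\<bar> t \<theta>"
  proof (eventually_elim, intro allI impI)
    fix t \<theta> :: real
    assume saddle: "\<forall>v \<delta>. \<bar>v\<bar> \<le> 100 \<longrightarrow> norm \<delta> \<le> C\<^sub>1 * \<bar>v\<bar> \<longrightarrow>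
      Re (saddle_term K rate (4 * pi\<^sup>2 / c) t v \<delta> * exp (of_real (rate / t\<^sup>2) * Complex t (t * v))) \<ge>
      (if \<bar>v\<bar> \<le> sqrt (t / rate) then K / (2 * t) * exp (2 * (rate / t) - 1) else 0) -
        2 * exp (C\<^sub>1 * 100) * K / t * exp (2 * (rate / t) - (rate / t) powr (1 / 5) / (1 + 100\<^sup>2))"
      and t: "t > 0" "t \<le> 1" and s100: "sqrt (t / rate) \<le> 100" and \<theta>: "\<bar>\<theta>\<bar> \<le> pi"
    define N where "N = exp (Re (log_gf (of_real t)) - pi\<^sup>2 / 4 / t)"
    define X where "X = exp (of_real (rate / t\<^sup>2) * Complex t \<theta>)"
    define e\<^sub>1 where "e\<^sub>1 = 2 * exp (C\<^sub>1 * 100) * K / t * exp (- ((rate / t) powr (1 / 5) / (1 + 100\<^sup>2)))"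
    define e\<^sub>2 where "e\<^sub>2 = C\<^sub>2 / t ^ 3 * exp (0 / sqrt t - (rate - rate') / t)"
    define e\<^sub>3 where "e\<^sub>3 = 128 * exp 10 / t ^ 3 * exp (\<bar>C\<^sub>3\<bar> / sqrt t - (rate - 2 / 5) / t)"
    define G where "G = exp (2 * (rate / t))"
    have N: "N > 0" and G: "G > 0" by (simp_all add: N_def G_def)
    have e_nonneg: "e\<^sub>1 \<ge> 0" "e\<^sub>2 \<ge> 0" "e\<^sub>3 \<ge> 0" using t K C12 by (simp_all add: e\<^sub>1_def e\<^sub>2_def e\<^sub>3_def)
    have X: "norm X = exp (rate / t)" using t by (simp add: X_def power2_eq_square)
    have "N * G * ((if \<bar>\<theta>\<bar> \<le> t * sqrt (t / rate) then K / (2 * t) * exp (- 1) else 0) - (e\<^sub>1 + e\<^sub>2 + e\<^sub>3)) \<le> Re (F (Complex t \<theta>) * X)"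
    proof (cases "\<bar>\<theta>\<bar> \<le> 100 * t")
      case True
      define v where "v = \<theta> / t"
      have v: "\<bar>v\<bar> \<le> 100" and \<theta>v: "\<theta> = t * v" using True t by (simp_all add: v_def abs_divide divide_le_eq)
      obtain \<delta> E where \<delta>: "norm \<delta> \<le> C\<^sub>1 * \<bar>v\<bar>" and E: "norm E \<le> C\<^sub>2 / sqrt t * exp (rate' / t)"
        and FE: "F (Complex t (t * v)) = of_real N * (saddle_term K rate (4 * pi\<^sup>2 / c) t v \<delta> + E)"
        using major[OF t v] unfolding N_def by blast
      define U where "U = saddle_term K rate (4 * pi\<^sup>2 / c) t v \<delta>"
      have ind: "\<bar>\<theta>\<bar> \<le> t * sqrt (t / rate) \<longleftrightarrow> \<bar>v\<bar> \<le> sqrt (t / rate)"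
        using t by (simp add: \<theta>v abs_mult)
      have "(if \<bar>v\<bar> \<le> sqrt (t / rate) then K / (2 * t) * exp (2 * (rate / t) - 1) else 0) -
          2 * exp (C\<^sub>1 * 100) * K / t * exp (2 * (rate / t) - (rate / t) powr (1 / 5) / (1 + 100\<^sup>2)) \<le> Re (U * X)"
        using saddle v \<delta> unfolding U_def X_def \<theta>v by blast
      moreover have "exp (2 * (rate / t) - 1) = G * exp (- 1)"
        "exp (2 * (rate / t) - (rate / t) powr (1 / 5) / (1 + 100\<^sup>2)) = G * exp (- ((rate / t) powr (1 / 5) / (1 + 100\<^sup>2)))"
        unfolding G_def by (simp_all flip: exp_add)
      ultimately have 1: "G * (if \<bar>\<theta>\<bar> \<le> t * sqrt (t / rate) then K / (2 * t) * exp (- 1) else 0) - G * e\<^sub>1 \<le> Re (U * X)"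
        unfolding ind e\<^sub>1_def by (auto simp: mult_ac)
      have "norm (E * X) \<le> G * e\<^sub>2"
      proof -
        have "norm (E * X) \<le> C\<^sub>2 / sqrt t * exp (rate' / t) * exp (rate / t)"
          unfolding norm_mult X using E by (intro mult_right_mono) auto
        also have "\<dots> = C\<^sub>2 / sqrt t * (G * exp (- ((rate - rate') / t)))"
          unfolding G_def by (simp add: diff_divide_distrib flip: exp_add)
        also have "\<dots> \<le> C\<^sub>2 / t ^ 3 * (G * exp (- ((rate - rate') / t)))"
        proof (intro mult_right_mono divide_left_mono)
          have "t ^ 3 \<le> t ^ 1" using t by (intro power_decreasing) auto
          also have "t ^ 1 \<le> sqrt t" using t real_le_rsqrt[of t t] by (simp add: power2_eq_square mult_left_le)
          finally show "t ^ 3 \<le> sqrt t" .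
        qed (use C12 t G in auto)
        finally show ?thesis by (simp add: e\<^sub>2_def mult_ac)
      qed
      then have 2: "- (G * e\<^sub>2) \<le> Re (E * X)" using abs_Re_le_cmod[of "E * X"] by linarith
      have "Re (F (Complex t \<theta>) * X) = N * (Re (U * X) + Re (E * X))"
        unfolding \<theta>v FE U_def[symmetric] by (simp add: algebra_simps)
      moreover have "G * ((if \<bar>\<theta>\<bar> \<le> t * sqrt (t / rate) then K / (2 * t) * exp (- 1) else 0) - (e\<^sub>1 + e\<^sub>2 + e\<^sub>3)) \<le> Re (U * X) + Re (E * X)"
        using 1 2 mult_nonneg_nonneg[OF less_imp_le[OF G] e_nonneg(3)] unfolding right_diff_distrib distrib_left by linarith
      ultimately show ?thesis using N by (simp add: mult.assoc mult_left_mono)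
    next
      case False
      let ?q = "exp (- Complex t \<theta>)"
      have ind: "\<not> \<bar>\<theta>\<bar> \<le> t * sqrt (t / rate)"
        using False mult_left_mono[OF s100, of t] t by linarith
      have "norm (exp (log_gf (Complex t \<theta>))) \<le> exp (2 / 5 / t + 10)"
        using Re_log_gf_minor_arc[of t \<theta>] False t \<theta> by simp
      moreover have "norm (\<Sum>k. theta_term a b c ?q k) \<le> 8 / (t / 2) ^ 3"
      proof -
        have q: "norm ?q = exp (- t)" by simp
        have "t / 2 \<le> 1 - exp (- t)"
        proof -
          have "exp (- t) \<le> 1 / (1 + t)"
            using exp_ge_add_one_self[of t] t by (simp add: exp_minus field_simps)
          also have "\<dots> \<le> 1 - t / 2" using t by (simp add: field_simps)
          finally show ?thesis by simp
        qed
        then have "8 / (1 - norm ?q) ^ 3 \<le> 8 / (t / 2) ^ 3"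
          unfolding q using t by (intro divide_left_mono power_mono) auto
        then show ?thesis using norm_theta_sum_le[OF _ b(1,2), of ?q] t by force
      qed
      ultimately have "norm (F (Complex t \<theta>)) \<le> 2 * exp (2 / 5 / t + 10) * (8 / (t / 2) ^ 3)"
        unfolding F_def norm_mult by (intro mult_mono) auto
      then have "norm (F (Complex t \<theta>) * X) \<le> 2 * exp (2 / 5 / t + 10) * (8 / (t / 2) ^ 3) * exp (rate / t)"
        unfolding norm_mult X by (intro mult_right_mono) auto
      also have "\<dots> = 128 * exp 10 / t ^ 3 * exp (2 / 5 / t + rate / t)"
        by (simp add: exp_add power_divide)
      \<comment> \<open>The minor arc bound is absolute, whereas the envelope is relative to
        \<open>N\<close>, which might be small; by \<open>Re_log_gf_real_ge\<close> it is not
        smaller than exp (-|C3| / sqrt t).\<close>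
      also have "\<dots> \<le> N * exp (\<bar>C\<^sub>3\<bar> / sqrt t) * (128 * exp 10 / t ^ 3 * exp (2 / 5 / t + rate / t))"
      proof -
        have "- (\<bar>C\<^sub>3\<bar> / sqrt t) \<le> - (C\<^sub>3 / sqrt t)" using t by (simp add: divide_right_mono)
        then have "0 \<le> Re (log_gf (of_real t)) - pi\<^sup>2 / 4 / t + \<bar>C\<^sub>3\<bar> / sqrt t" using C3[OF t(1)] by linarith
        then have "1 \<le> N * exp (\<bar>C\<^sub>3\<bar> / sqrt t)" unfolding N_def by (simp flip: exp_add)
        then have "1 * (128 * exp 10 / t ^ 3 * exp (2 / 5 / t + rate / t)) \<le>
            N * exp (\<bar>C\<^sub>3\<bar> / sqrt t) * (128 * exp 10 / t ^ 3 * exp (2 / 5 / t + rate / t))"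
          using t by (intro mult_mono) (auto intro!: divide_right_mono mult_right_mono)
        then show ?thesis by simp
      qed
      also have "\<dots> = N * (G * e\<^sub>3)"
      proof -
        have "exp (\<bar>C\<^sub>3\<bar> / sqrt t) * exp (2 / 5 / t + rate / t) = G * exp (\<bar>C\<^sub>3\<bar> / sqrt t - (rate - 2 / 5) / t)"
          unfolding G_def exp_add[symmetric] by (simp add: diff_divide_distrib)
        then have "N * exp (\<bar>C\<^sub>3\<bar> / sqrt t) * (w * exp (2 / 5 / t + rate / t)) = N * (G * (w * exp (\<bar>C\<^sub>3\<bar> / sqrt t - (rate - 2 / 5) / t)))" for w
          by (simp add: mult_ac)
        then show ?thesis unfolding e\<^sub>3_def .
      qed
      finally have "- (N * (G * e\<^sub>3)) \<le> Re (F (Complex t \<theta>) * X)"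
        using abs_Re_le_cmod[of "F (Complex t \<theta>) * X"] by linarith
      moreover have "N * G * (e\<^sub>1 + e\<^sub>2) \<ge> 0" using N G e_nonneg by simp
      ultimately show ?thesis using ind by (simp add: algebra_simps)
    qed
    then show "Re (F (Complex t \<theta>) * exp (of_real (rate / t\<^sup>2) * Complex t \<theta>)) \<ge>
      exp (Re (log_gf (of_real t)) - pi\<^sup>2 / 4 / t) * exp (2 * (rate / t)) *
     envelope (2 * exp (C\<^sub>1 * 100) * K) C\<^sub>2 \<bar>C\<^sub>3\<bar> t \<theta>"
      unfolding N_def G_def X_def e\<^sub>1_def e\<^sub>2_def e\<^sub>3_def K_def envelope_def .
  qed
  moreover have "2 * exp (C\<^sub>1 * 100) * K \<ge> 0" using K by simp
  ultimately show ?thesis using C12(2) abs_ge_zero by blast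
qed

lemma eventually_Nbar_diff_pos:
  assumes b: "a < b" "2 * b \<le> c" "d = b - a" "e = c - a - b"
  shows "\<forall>\<^sub>F n in sequentially. Nbar (int b) (int c) n < Nbar (int a) (int c) n"
proof -
  define K where "K = 16 * pi * ampl / c"
  have K: "K > 0" using ampl_pos c by (simp add: K_def)
  have R: "rate > 0" using rate_bounds by simp
  define F where "F = (\<lambda>z. 2 * exp (log_gf z) * (\<Sum>k. theta_term a b c (exp (- z)) k))"
  obtain A A' C where C: "C \<ge> 0" and low: "\<forall>\<^sub>F t in at_right 0. \<forall>\<theta>. \<bar>\<theta>\<bar> \<le> pi \<longrightarrow>
    Re (F (Complex t \<theta>) * exp (of_real (rate / t\<^sup>2) * Complex t \<theta>)) \<ge>
    exp (Re (log_gf (of_real t)) - pi\<^sup>2 / 4 / t) * exp (2 * (rate / t)) *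
     envelope A A' C t \<theta>"
    using integrand_lower_bound[OF b] unfolding F_def by blast
  \<comment> \<open>Chosen so that the plateau integrates to 8 pi \<open>\<epsilon>\<close> sqrt t.
    The three errors, each at most \<open>\<epsilon>\<close> sqrt t on an interval of length 2 pi,
    use up at most 6 pi \<open>\<epsilon>\<close> sqrt t.\<close>
  define \<epsilon> where "\<epsilon> = K * exp (- 1) / sqrt rate / (8 * pi)"
  have \<epsilon>: "\<epsilon> > 0" using K R by (simp add: \<epsilon>_def)
  define a' where "a' n = (if n = 0 then 0 else real (Nbar (int a) (int c) n) - real (Nbar (int b) (int c) n))" for n
  have "0 < rate - rate'" "0 < rate - 2 / 5" using rate_bounds by auto
  then have small: "\<forall>\<^sub>F t in at_right 0. A' / t ^ 3 * exp (0 / sqrt t - (rate - rate') / t) \<le> \<epsilon> * sqrt t"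
    "\<forall>\<^sub>F t in at_right 0. 128 * exp 10 / t ^ 3 * exp (C / sqrt t - (rate - 2 / 5) / t) \<le> \<epsilon> * sqrt t"
    "\<forall>\<^sub>F t in at_right 0. A / t * exp (- ((rate / t) powr (1 / 5) / (1 + 100\<^sup>2))) \<le> \<epsilon> * sqrt t"
    using \<epsilon> R C by (intro eventually_exp_small eventually_powr_small; simp)+
  have wpi: "\<forall>\<^sub>F t in at_right 0. t * sqrt (t / rate) \<le> pi" using R pi_gt_zero by real_asymp
  have tpos: "\<forall>\<^sub>F t in at_right 0. t > (0::real)" by (rule eventually_at_right_less)
  \<comment> \<open>All estimates concern t tending to 0, so n is first tied to t by the saddle
    point equation; the substitution t = sqrt (rate / n) turns this into a statement about large
    n.\<close>
  have "\<forall>\<^sub>F t in at_right 0. \<forall>n. real n = rate / t\<^sup>2 \<longrightarrow> 0 < a' n"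
    using low small wpi tpos
  proof (eventually_elim, intro allI impI)
    fix t :: real and n :: nat
    assume low: "\<forall>\<theta>. \<bar>\<theta>\<bar> \<le> pi \<longrightarrow>
        Re (F (Complex t \<theta>) * exp (of_real (rate / t\<^sup>2) * Complex t \<theta>)) \<ge>
        exp (Re (log_gf (of_real t)) - pi\<^sup>2 / 4 / t) * exp (2 * (rate / t)) *
         envelope A A' C t \<theta>"
      and e2: "A' / t ^ 3 * exp (0 / sqrt t - (rate - rate') / t) \<le> \<epsilon> * sqrt t"
      and e3: "128 * exp 10 / t ^ 3 * exp (C / sqrt t - (rate - 2 / 5) / t) \<le> \<epsilon> * sqrt t"
      and e1: "A / t * exp (- ((rate / t) powr (1 / 5) / (1 + 100\<^sup>2))) \<le> \<epsilon> * sqrt t"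
      and w: "t * sqrt (t / rate) \<le> pi" and t: "t > 0" and n: "real n = rate / t\<^sup>2"
    define w where "w = t * sqrt (t / rate)"
    have w0: "0 \<le> w" "w \<le> pi" using w t R by (simp_all add: w_def)
    define N where "N = exp (Re (log_gf (of_real t)) - pi\<^sup>2 / 4 / t) * exp (2 * (rate / t))"
    have N: "N > 0" by (simp add: N_def)
    define P\<^sub>0 where "P\<^sub>0 = K / (2 * t) * exp (- 1)"
    define Q where "Q = A / t * exp (- ((rate / t) powr (1 / 5) / (1 + 100\<^sup>2))) +
           A' / t ^ 3 * exp (0 / sqrt t - (rate - rate') / t) +
           128 * exp 10 / t ^ 3 * exp (C / sqrt t - (rate - 2 / 5) / t)"
    have "((\<lambda>\<theta>. 2 * gf (exp (- Complex t \<theta>)) overpartitions * (\<Sum>k. theta_term a b c (exp (- Complex t \<theta>)) k) *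
        exp (of_nat n * Complex t \<theta>)) has_integral of_real (2 * pi * a' n)) {- pi..pi}"
      using Nbar_diff_sums(1)[OF _ b(1,2)] t unfolding a'_def
      by (rule coefficient_integral[where f = "\<lambda>q. 2 * gf q overpartitions * (\<Sum>k. theta_term a b c q k)"])
    moreover have "gf (exp (- Complex t \<theta>)) overpartitions = exp (log_gf (Complex t \<theta>))" for \<theta>
      by (rule gf_overpartitions_exp) (use t in simp)
    moreover have "of_nat n = (of_real (rate / t\<^sup>2) :: complex)" using n by (metis of_real_of_nat_eq)
    ultimately have "((\<lambda>\<theta>. F (Complex t \<theta>) * exp (of_real (rate / t\<^sup>2) * Complex t \<theta>)) has_integral of_real (2 * pi * a' n)) {- pi..pi}"
      by (simp only: F_def)
    from has_integral_linear[OF this bounded_linear_Re]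
    have int: "((\<lambda>\<theta>. Re (F (Complex t \<theta>) * exp (of_real (rate / t\<^sup>2) * Complex t \<theta>))) has_integral (2 * pi * a' n)) {- pi..pi}"
      by (simp only: o_def Re_complex_of_real)
    have "((\<lambda>\<theta>. P\<^sub>0) has_integral (2 * w * P\<^sub>0)) {- w..w}"
      using has_integral_const_real[of P\<^sub>0 "- w" w] w0 by simp
    moreover have "{- w..w} \<subseteq> {- pi..pi}" using w0 by auto
    ultimately have "((\<lambda>\<theta>. if \<theta> \<in> {- w..w} then P\<^sub>0 else 0) has_integral (2 * w * P\<^sub>0)) {- pi..pi}"
      by (simp only: has_integral_restrict)
    moreover have "((\<lambda>\<theta>. Q) has_integral (2 * pi * Q)) {- pi..pi}"
      using has_integral_const_real[of Q "- pi" pi] by simp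
    ultimately have "((\<lambda>\<theta>. N * ((if \<theta> \<in> {- w..w} then P\<^sub>0 else 0) - Q)) has_integral (N * (2 * w * P\<^sub>0 - 2 * pi * Q))) {- pi..pi}"
      by (intro has_integral_mult_right has_integral_diff)
    then have "N * (2 * w * P\<^sub>0 - 2 * pi * Q) \<le> 2 * pi * a' n"
    proof (rule has_integral_le[OF _ int])
      fix \<theta> assume "\<theta> \<in> {- pi..pi}"
      then have "\<bar>\<theta>\<bar> \<le> pi" by auto
      moreover have "\<theta> \<in> {- w..w} \<longleftrightarrow> \<bar>\<theta>\<bar> \<le> w" by auto
      ultimately show "N * ((if \<theta> \<in> {- w..w} then P\<^sub>0 else 0) - Q) \<le>
          Re (F (Complex t \<theta>) * exp (of_real (rate / t\<^sup>2) * Complex t \<theta>))"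
        using low unfolding N_def P\<^sub>0_def Q_def w_def envelope_def K_def by simp
    qed
    moreover have "0 < N * (2 * w * P\<^sub>0 - 2 * pi * Q)"
    proof (intro mult_pos_pos N)
      have "2 * w * P\<^sub>0 = \<epsilon> * sqrt t * (8 * pi)"
        using t by (simp add: w_def P\<^sub>0_def \<epsilon>_def real_sqrt_divide)
      moreover have "2 * pi * Q \<le> 2 * pi * (3 * (\<epsilon> * sqrt t))"
        unfolding Q_def using e1 e2 e3 by (intro mult_left_mono) auto
      moreover have "0 < pi * (\<epsilon> * sqrt t)" using \<epsilon> t by simp
      moreover have "x * (8 * pi) - 2 * pi * (3 * x) = 2 * (pi * x)" for x :: real by simp
      then have "\<epsilon> * sqrt t * (8 * pi) - 2 * pi * (3 * (\<epsilon> * sqrt t)) = 2 * (pi * (\<epsilon> * sqrt t))" .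
      ultimately show "0 < 2 * w * P\<^sub>0 - 2 * pi * Q" by linarith
    qed
    ultimately have "0 < 2 * pi * a' n" by linarith
    then show "0 < a' n" by (simp add: zero_less_mult_iff)
  qed
  moreover have "filterlim (\<lambda>n. sqrt (rate / real n)) (at_right 0) sequentially"
    using R by real_asymp
  ultimately have "\<forall>\<^sub>F n in sequentially. \<forall>m. real m = rate / (sqrt (rate / real n))\<^sup>2 \<longrightarrow> 0 < a' m"
    by (rule eventually_compose_filterlim)
  with eventually_gt_at_top[of 0] show ?thesis
  proof eventually_elim
    case (elim n)
    then have "real n = rate / (sqrt (rate / real n))\<^sup>2" using R by simp
    with elim have "0 < a' n" by blast
    then show ?case using elim by (simp add: a'_def)
  qed
qed

end

theorem theorem1:
  fixes a b c :: int
  assumes "c \<ge> 7"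
    and "0 \<le> a" and "a < b" and "b \<le> \<lfloor>real_of_int c / 2\<rfloor>"
  shows "\<exists>n\<^sub>0 :: nat. \<forall>n > n\<^sub>0. Nbar a c n > Nbar b c n"
proof -
  define a' b' c' where "a' = nat a" and "b' = nat b" and "c' = nat c"
  have bc: "2 * b \<le> c" using assms(4) by linarith
  have eq: "a = int a'" "b = int b'" "c = int c'"
    using assms bc by (simp_all add: a'_def b'_def c'_def)
  have ab: "a' < b'" "2 * b' \<le> c'" "c' \<ge> 7"
    using assms bc unfolding eq by auto
  interpret rank_kernel a' "b' - a'" "c' - a' - b'" c'
    by unfold_locales (use ab in auto)
  have "\<forall>\<^sub>F n in sequentially. Nbar b c n < Nbar a c n"
    using eventually_Nbar_diff_pos[OF ab(1,2) refl refl] unfolding eq .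
  then obtain n\<^sub>0 where "\<And>n. n \<ge> n\<^sub>0 \<Longrightarrow> Nbar b c n < Nbar a c n"
    by (auto simp: eventually_sequentially)
  then show ?thesis by (intro exI[of _ n\<^sub>0]) auto
qed

end
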